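(* Let $S\ge-\omega$ be a densely defined symmetric operator, not essentially self-adjoint, on a real Hilbert space $\mathscr H$, with Friedrichs extension $A_\circ$. Let $\tau:\mathscr H_\circ\to\mathfrak h$ be a continuous linear surjection onto a Hilbert space $\mathfrak h$ such that $\mathscr D(S)=\mathscr N:=\mathrm{kernel}(\tau)$, with $\mathscr N$ dense in $\mathscr H$. Let $\lambda_\circ>\omega$, let $G_\circ:=(\tau(A_\circ+\lambda_\circ)^{-1})^*:\mathfrak h\to\mathscr H$, let $\Theta\subset\mathfrak h\times\mathfrak h$ be a maximal monotone relation, and let $A_\Theta$ be the (maximal monotone of type $\lambda_\circ$) operator $$\mathscr D(A_\Theta)=\{u\in\mathscr H:\ u=u_\circ+G_\circ\xi_u,\ u_\circ\in\mathscr D(A_\circ),\ (\xi_u,\tau u_\circ)\in\Theta\},\qquad A_\Theta(u)=A_\circ u_\circ-\lambda_\circ G_\circ\xi_u .$$ Then: 1. The adjoint $S^*$ is given by $$\mathscr D(S^* )=\{u\in\mathscr H:\ u=u_\circ+G_\circ\xi,\ u_\circ\in\mathscr D(A_\circ),\ \xi\in\mathfrak h\},\qquad S^*u=A_\circ u_\circ-\lambda_\circ G_\circ\xi,$$ and so $A_\Theta\subset S^*$. 2. $S\subset A_\Theta\iff\mathscr N\subseteq\mathscr D(A_\Theta)\iff(0,0)\in\Theta\ \Longrightarrow\ \overline{\mathscr D(A_\Theta)}=\mathscr H$. 3. Hence, if $(0,0)\in\Theta$, then $A_\Theta$ generates a one-parameter continuous nonlinear semigroup defined on the whole Hilbert space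 $\mathscr H$. 4. $\mathscr D(A_\circ)\cap\mathscr D(A_\Theta)=\{u\in\mathscr D(A_\circ):(0,\tau u)\in\Theta\}$; hence $\mathscr D(A_\circ)\cap\mathscr D(A_\Theta)\neq\emptyset$ if and only if $0\in\mathscr D(\Theta)$. 5. $A_\Theta(u)=A_\circ u$ for all $u\in\mathscr D(A_\circ)\cap\mathscr D(A_\Theta)$. 6. The set $\mathscr D(A_\circ)\cap\mathscr D(A_\Theta)$ is convex and closed in $\mathscr H_\circ$.
   Context: $\mathscr H$, $\mathfrak h$ are real Hilbert spaces with scalar products $\langle\cdot,\cdot\rangle$ and $[\cdot,\cdot]$. $\mathscr H_\circ$ is $\mathscr D(A_\circ)$ with scalar product $\langle A_\circ u,A_\circ v\rangle+\langle u,v\rangle$; $(A_\circ+\lambda_\circ)^{-1}$ is viewed as a bounded map $\mathscr H\to\mathscr H_\circ$ and $G_\circ$ is the adjoint of the bounded map $\tau(A_\circ+\lambda_\circ)^{-1}:\mathscr H\to\mathfrak h$. The decomposition $u=u_\circ+G_\circ\xi$ is unique, so $A_\Theta$ is single-valued. $A\subset B$ for operators means inclusion of graphs. A relation $\Theta\subset\mathfrak h\times\mathfrak h$ is monotone if $[\tilde\xi-\tilde\zeta,\xi-\zeta]\ge0$ for all $(\xi,\tilde\xi),(\zeta,\tilde\zeta)\in\Theta$, and maximal monotone if not properly contained in another monotone relation; $\mathscr D(\Theta)=\{\xi:\exists\tilde\xi,\ (\xi,\tilde\xi)\in\Theta\}$. An operator $A$ on $\mathscr H$ is monotone of type $\lambda_\circ$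 if $\langle A(u)-A(v),u-v\rangle\ge-\lambda_\circ\|u-v\|^2$ for all $u,v\in\mathscr D(A)$, and maximal monotone of type $\lambda_\circ$ if moreover $\mathrm{range}(A+\lambda)=\mathscr H$ for some (equivalently any) $\lambda>\lambda_\circ$. A one-parameter continuous nonlinear semigroup (of type $\lambda_\circ$) on $\mathscr H$ is a family of maps $S_t:\mathscr H\to\mathscr H$, $t\ge0$, with $S_0(u)=u$, $S_{t_1}\circ S_{t_2}=S_{t_1+t_2}$, $\lim_{t\downarrow0}\|S_t(u)-u\|=0$ and $\|S_t(u)-S_t(v)\|\le e^{\lambda_\circ t}\|u-v\|$; its generator is $A(u)=\lim_{t\downarrow0}\frac1t(u-S_t(u))$, with domain the set of $u$ for which the limit exists. *)

theory Defs
  imports "HOL-Analysis.Analysis"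
begin

text \<open>
  A (possibly unbounded, possibly nonlinear) operator on \<open>'a\<close> is its graph, a single-valued
  \<open>('a \<times> 'a) set\<close>; its domain is \<^const>\<open>Domain\<close>, and inclusion of operators is
  \<open>\<subseteq>\<close>.  A real Hilbert space is a type of sort \<open>{real_inner, complete_space}\<close>.
\<close>

definition op_app :: "('a \<times> 'b) set \<Rightarrow> 'a \<Rightarrow> 'b" where
  "op_app A u = (THE w. (u, w) \<in> A)"

definition linear_operator :: "('a::real_vector \<times> 'a) set \<Rightarrow> bool" where
  "linear_operator A \<longleftrightarrow> single_valued A \<and> subspace A"

definition densely_defined :: "('a::topological_space \<times> 'a) set \<Rightarrow> bool" where
  "densely_defined A \<longleftrightarrow> closure (Domain A) = UNIV"

definition symmetric_operator :: "('a::real_inner \<times> 'a) set \<Rightarrow> bool" where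
  "symmetric_operator A \<longleftrightarrow> linear_operator A \<and>
     (\<forall>u\<in>Domain A. \<forall>v\<in>Domain A. op_app A u \<bullet> v = u \<bullet> op_app A v)"

definition bounded_below :: "('a::real_inner \<times> 'a) set \<Rightarrow> real \<Rightarrow> bool" where
  "bounded_below A m \<longleftrightarrow> (\<forall>u\<in>Domain A. op_app A u \<bullet> u \<ge> m * (norm u)\<^sup>2)"

text \<open>
  The Hilbert space adjoint of an unbounded operator, to be distinguished from the library's
  \<^const>\<open>adjoint\<close>, which is used below for the everywhere defined bounded map
  \<open>\<tau> (A + \<mu>)\<^sup>-\<^sup>1\<close>.
\<close>

definition op_adjoint :: "('a::real_inner \<times> 'a) set \<Rightarrow> ('a \<times> 'a) set" where
  "op_adjoint A = {(v, w). \<forall>u\<in>Domain A. op_app A u \<bullet> v = u \<bullet> w}"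

definition selfadjoint :: "('a::real_inner \<times> 'a) set \<Rightarrow> bool" where
  "selfadjoint A \<longleftrightarrow> linear_operator A \<and> densely_defined A \<and> op_adjoint A = A"

text \<open>\<open>closure A\<close> is the closure of the graph in \<open>'a \<times> 'a\<close>, i.e. the operator closure.\<close>

definition essentially_selfadjoint :: "('a::real_inner \<times> 'a) set \<Rightarrow> bool" where
  "essentially_selfadjoint A \<longleftrightarrow> selfadjoint (closure A)"

text \<open>
  The domain of the closure of the quadratic form \<open>u \<mapsto> \<langle>S u, u\<rangle>\<close>
  of a lower bounded symmetric \<open>S\<close>: limits in \<open>'a\<close> of sequences in the domain of \<open>S\<close>
  that are Cauchy for the form.  The Friedrichs extension is the restriction of the adjoint of
  \<open>S\<close> to this form domain.
\<close>

definition closed_form_domain :: "('a::real_inner \<times> 'a) set \<Rightarrow> 'a set" where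
  "closed_form_domain S = {u. \<exists>s :: nat \<Rightarrow> 'a. (\<forall>n. s n \<in> Domain S) \<and> s \<longlonglongrightarrow> u \<and>
     ((\<lambda>(m, n). op_app S (s m - s n) \<bullet> (s m - s n)) \<longlongrightarrow> 0) (sequentially \<times>\<^sub>F sequentially)}"

definition friedrichs_extension :: "('a::real_inner \<times> 'a) set \<Rightarrow> ('a \<times> 'a) set" where
  "friedrichs_extension S = {(u, w). u \<in> closed_form_domain S \<and> (u, w) \<in> op_adjoint S}"

text \<open>The space \<open>\<H>\<^sub>\<circ>\<close>: the domain of \<open>A\<close> with the graph scalar product.\<close>

definition graph_inner :: "('a::real_inner \<times> 'a) set \<Rightarrow> 'a \<Rightarrow> 'a \<Rightarrow> real" where
  "graph_inner A u v = op_app A u \<bullet> op_app A v + u \<bullet> v"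

definition graph_dist :: "('a::real_inner \<times> 'a) set \<Rightarrow> 'a \<Rightarrow> 'a \<Rightarrow> real" where
  "graph_dist A u v = sqrt (graph_inner A (u - v) (u - v))"

definition graph_topology :: "('a::real_inner \<times> 'a) set \<Rightarrow> 'a topology" where
  "graph_topology A = Metric_space.mtopology (Domain A) (graph_dist A)"

definition linear_map_on :: "'a::real_vector set \<Rightarrow> ('a \<Rightarrow> 'b::real_vector) \<Rightarrow> bool" where
  "linear_map_on V f \<longleftrightarrow> (\<forall>u\<in>V. \<forall>v\<in>V. f (u + v) = f u + f v) \<and> (\<forall>c. \<forall>u\<in>V. f (c *\<^sub>R u) = c *\<^sub>R f u)"

text \<open>\<open>resolvent A \<mu> f\<close> is \<open>(A + \<mu>)\<^sup>-\<^sup>1 f\<close>.\<close>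

definition resolvent :: "('a::real_vector \<times> 'a) set \<Rightarrow> real \<Rightarrow> 'a \<Rightarrow> 'a" where
  "resolvent A \<mu> f = (THE u. u \<in> Domain A \<and> op_app A u + \<mu> *\<^sub>R u = f)"

definition G_map :: "('a::real_inner \<times> 'a) set \<Rightarrow> ('a \<Rightarrow> 'b::real_inner) \<Rightarrow> real \<Rightarrow> 'b \<Rightarrow> 'a" where
  "G_map A \<tau> \<mu> = adjoint (\<lambda>f. \<tau> (resolvent A \<mu> f))"

definition monotone_relation :: "('b::real_inner \<times> 'b) set \<Rightarrow> bool" where
  "monotone_relation \<Theta> \<longleftrightarrow>
     (\<forall>(\<xi>, \<xi>')\<in>\<Theta>. \<forall>(\<zeta>, \<zeta>')\<in>\<Theta>. (\<xi>' - \<zeta>') \<bullet> (\<xi> - \<zeta>) \<ge> 0)"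

definition maximal_monotone_relation :: "('b::real_inner \<times> 'b) set \<Rightarrow> bool" where
  "maximal_monotone_relation \<Theta> \<longleftrightarrow>
     monotone_relation \<Theta> \<and> \<not> (\<exists>\<Theta>'. monotone_relation \<Theta>' \<and> \<Theta> \<subset> \<Theta>')"

definition monotone_operator_of_type :: "real \<Rightarrow> ('a::real_inner \<times> 'a) set \<Rightarrow> bool" where
  "monotone_operator_of_type \<mu> A \<longleftrightarrow> single_valued A \<and>
     (\<forall>u\<in>Domain A. \<forall>v\<in>Domain A.
        (op_app A u - op_app A v) \<bullet> (u - v) \<ge> - \<mu> * (norm (u - v))\<^sup>2)"

definition maximal_monotone_operator_of_type :: "real \<Rightarrow> ('a::real_inner \<times> 'a) set \<Rightarrow> bool" where
  "maximal_monotone_operator_of_type \<mu> A \<longleftrightarrow> monotone_operator_of_type \<mu> A \<and>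
     (\<exists>\<nu>>\<mu>. (\<lambda>u. op_app A u + \<nu> *\<^sub>R u) ` Domain A = UNIV)"

definition extension_operator ::
  "('a::real_inner \<times> 'a) set \<Rightarrow> ('a \<Rightarrow> 'b::real_inner) \<Rightarrow> real \<Rightarrow> ('b \<times> 'b) set \<Rightarrow> ('a \<times> 'a) set" where
  "extension_operator A \<tau> \<mu> \<Theta> =
     {(u\<^sub>0 + G_map A \<tau> \<mu> \<xi>, op_app A u\<^sub>0 - \<mu> *\<^sub>R G_map A \<tau> \<mu> \<xi>) | u\<^sub>0 \<xi>.
        u\<^sub>0 \<in> Domain A \<and> (\<xi>, \<tau> u\<^sub>0) \<in> \<Theta>}"

text \<open>Semigroups are families indexed by \<^typ>\<open>real\<close>; only times \<open>t \<ge> 0\<close> matter.\<close>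

definition nonlinear_semigroup ::
  "real \<Rightarrow> (real \<Rightarrow> 'a::real_normed_vector \<Rightarrow> 'a) \<Rightarrow> bool" where
  "nonlinear_semigroup \<mu> T \<longleftrightarrow>
     (\<forall>u. T 0 u = u) \<and>
     (\<forall>t1\<ge>0. \<forall>t2\<ge>0. T t1 \<circ> T t2 = T (t1 + t2)) \<and>
     (\<forall>u. ((\<lambda>t. norm (T t u - u)) \<longlongrightarrow> 0) (at_right 0)) \<and>
     (\<forall>t\<ge>0. \<forall>u v. norm (T t u - T t v) \<le> exp (\<mu> * t) * norm (u - v))"

definition semigroup_generator ::
  "(real \<Rightarrow> 'a::real_normed_vector \<Rightarrow> 'a) \<Rightarrow> ('a \<times> 'a) set" where
  "semigroup_generator T = {(u, w). ((\<lambda>t. (1 / t) *\<^sub>R (u - T t u)) \<longlongrightarrow> w) (at_right 0)}"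

end

theory Submission
  imports Defs
begin

text \<open>
  Adding \<open>lam\<close> to \<open>A\<^sub>\<Theta>\<close> gives \<open>(A\<^sub>0 + lam) u\<^sub>0\<close>, and \<open>G\<close> is adjoint to \<open>\<tau> (A\<^sub>0 + lam)\<^sup>-\<^sup>1\<close>, so the
  monotonicity of \<open>A\<^sub>\<Theta> + lam\<close> splits into the positivity of \<open>A\<^sub>0 + lam\<close> and the monotonicity of
  \<open>\<Theta>\<close>. The range condition reduces to solving \<open>\<eta> \<in> \<Theta> \<xi> + M \<xi>\<close> with \<open>M\<close> bounded and coercive,
  which follows from Minty's theorem and Banach's fixed point theorem; \<open>M\<close> is coercive because \<open>G\<close>
  is bounded below, by the uniform boundedness principle and the surjectivity of \<open>\<tau>\<close>. The range of
  \<open>G\<close> is then closed, so it equals the orthogonal complement of the range of \<open>S + lam\<close>; this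
  describes \<open>S\<^sup>*\<close>.

  The semigroup is the limit of the backward Euler schemes with steps \<open>2\<^sup>-\<^sup>j\<close>. Halving the step
  \<open>h\<close> changes the scheme started at \<open>u\<close> by \<open>O(sqrt h)\<close>: the squared increments of the operator
  along the scheme telescope. That the generator is not smaller than the operator uses the strong
  convergence of the Yosida approximations; that it is not larger is maximality.
\<close>

section \<open>Strongly convex minimisation and adjoints\<close>

text \<open>Two facts about \<open>G\<close> carry the linear part. Density of
  \<open>Domain S\<close> forces the range of \<open>G\<close> to meet \<open>Domain A0\<close> only
  in zero, so decompositions are unique; surjectivity of \<tau> makes \<open>G\<close> injective
  with closed range.

  \<open>G\<close> is tied to the shift \<open>lam\<close>, while the range condition lives at a
  shift \<nu> > lam. This mismatch is the source of \<open>M\<close>, which carries the factor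
  \<open>\<nu> - lam\<close>.

  For the semigroup, nested dyadic grids reduce the comparison of schemes to one step against two
  half steps. The estimates use a crude growth rate \<open>k \<ge> 0\<close> for every sign of
  \<open>lam\<close>; the exact rate, needed for the type and for the generator, reappears only in
  the limit.

  Riesz representation, projection onto a closed range and Minty's theorem share one minimisation
  lemma. The Friedrichs extension has its own, because \<open>Domain S\<close> need not be complete
  for the form norm.\<close>

lemma norm_diff_sq:
  fixes x y :: "'a::real_inner"
  shows "(norm (x - y))\<^sup>2 = (norm x)\<^sup>2 - 2 * (x \<bullet> y) + (norm y)\<^sup>2"
  by (simp add: power2_norm_eq_inner inner_diff inner_commute algebra_simps)

lemma norm_add_sq:
  fixes x y :: "'a::real_inner"
  shows "(norm (x + y))\<^sup>2 = (norm x)\<^sup>2 + 2 * (x \<bullet> y) + (norm y)\<^sup>2"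
  by (simp add: power2_norm_eq_inner inner_add inner_commute algebra_simps)

lemma norm_convex_comb_sq:
  fixes x y :: "'a::real_inner"
  shows "(norm ((1 - s) *\<^sub>R x + s *\<^sub>R y))\<^sup>2
         = (1 - s) * (norm x)\<^sup>2 + s * (norm y)\<^sup>2 - s * (1 - s) * (norm (y - x))\<^sup>2"
  unfolding power2_norm_eq_inner
  by (simp add: inner_add inner_diff inner_commute algebra_simps)

text \<open>A convex lower semicontinuous function enters as a closed convex set of pairs
  \<open>(z, t)\<close>, so infinite values need no encoding. The midpoint of two nearly optimal
  points cannot beat the infimum, which makes minimising sequences Cauchy. The extra quadratic term
  in the conclusion replaces an Euler equation in the applications.\<close>

lemma strongly_convex_minimum:
  fixes K :: "('a::{real_inner,complete_space} \<times> real) set"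
  assumes cl: "closed K" and cv: "convex K" and ne: "K \<noteq> {}"
    and below: "\<And>z t. (z, t) \<in> K \<Longrightarrow> m \<le> t + (norm z)\<^sup>2 / 2"
  obtains z0 t0 where "(z0, t0) \<in> K"
    and "\<And>z t. (z, t) \<in> K \<Longrightarrow>
           t0 + (norm z0)\<^sup>2 / 2 + (norm (z - z0))\<^sup>2 / 2 \<le> t + (norm z)\<^sup>2 / 2"
proof -
  define \<phi> :: "'a \<times> real \<Rightarrow> real" where "\<phi> p = snd p + (norm (fst p))\<^sup>2 / 2" for p
  define I where "I = Inf (\<phi> ` K)"
  have bdd: "bdd_below (\<phi> ` K)"
    using below by (intro bdd_belowI2[of _ m]) (auto simp: \<phi>_def)
  have I_le: "I \<le> \<phi> p" if "p \<in> K" for p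
    unfolding I_def by (rule cINF_lower[OF bdd that])
  have comb: "\<phi> ((1 - s) *\<^sub>R p + s *\<^sub>R p')
      = (1 - s) * \<phi> p + s * \<phi> p' - s * (1 - s) * (norm (fst p' - fst p))\<^sup>2 / 2" for s p p'
    using norm_convex_comb_sq[of s "fst p" "fst p'"]
    by (simp add: \<phi>_def field_simps)
  have in_K: "(1 - s) *\<^sub>R p + s *\<^sub>R p' \<in> K" if "p \<in> K" "p' \<in> K" "0 \<le> s" "s \<le> 1" for s p p'
    using cv that by (intro convexD) auto
  have mid: "(norm (fst p' - fst p))\<^sup>2 \<le> 4 * (\<phi> p - I) + 4 * (\<phi> p' - I)"
    if "p \<in> K" "p' \<in> K" for p p'
    using I_le[OF in_K[OF that, of "1/2"]] comb[of "1/2" p p'] by (simp add: field_simps)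
  have "\<exists>p\<in>K. \<phi> p < I + inverse (real (Suc n))" for n
    using cINF_less_iff[OF ne bdd, of "I + inverse (real (Suc n))"] by (simp add: I_def)
  then obtain p where pK: "\<And>n. p n \<in> K"
    and p_lt: "\<And>n. \<phi> (p n) < I + inverse (real (Suc n))"
    by metis
  have \<phi>_lim: "(\<lambda>n. \<phi> (p n)) \<longlonglongrightarrow> I"
  proof (rule tendsto_sandwich[of "\<lambda>_. I" _ _ "\<lambda>n. I + inverse (real (Suc n))"])
    show "(\<lambda>n. I + inverse (real (Suc n))) \<longlonglongrightarrow> I"
      using tendsto_add[OF tendsto_const LIMSEQ_inverse_real_of_nat, of I] by simp
    show "\<forall>\<^sub>F n in sequentially. I \<le> \<phi> (p n)" using I_le[OF pK] by simp
    show "\<forall>\<^sub>F n in sequentially. \<phi> (p n) \<le> I + inverse (real (Suc n))"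
      using less_imp_le[OF p_lt] by (intro always_eventually allI)
  qed simp
  have "Cauchy (\<lambda>n. fst (p n))"
    unfolding Cauchy_altdef2
  proof (intro allI impI)
    fix e :: real assume "0 < e"
    obtain n0 where n0: "inverse (real (Suc n0)) < e\<^sup>2 / 8"
      using reals_Archimedean[of "e\<^sup>2 / 8"] \<open>0 < e\<close> by auto
    have "dist (fst (p n)) (fst (p n0)) < e" if "n \<ge> n0" for n
    proof -
      have "inverse (real (Suc n)) \<le> inverse (real (Suc n0))"
        using that by (intro le_imp_inverse_le) auto
      hence "\<phi> (p n) - I < e\<^sup>2 / 8" "\<phi> (p n0) - I < e\<^sup>2 / 8"
        using p_lt[of n] p_lt[of n0] n0 by linarith+
      hence "(norm (fst (p n) - fst (p n0)))\<^sup>2 < e\<^sup>2"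
        using mid[OF pK[of n0] pK[of n]] by (simp add: algebra_simps)
      thus ?thesis using \<open>0 < e\<close> by (simp add: dist_norm power_less_imp_less_base)
    qed
    thus "\<exists>N. \<forall>n\<ge>N. dist (fst (p n)) (fst (p N)) < e" by blast
  qed
  then obtain z0 where z0: "(\<lambda>n. fst (p n)) \<longlonglongrightarrow> z0"
    using Cauchy_convergent convergent_def by blast
  define t0 where "t0 = I - (norm z0)\<^sup>2 / 2"
  have "(\<lambda>n. \<phi> (p n) - (norm (fst (p n)))\<^sup>2 / 2) \<longlonglongrightarrow> t0"
    unfolding t0_def by (intro tendsto_intros \<phi>_lim z0) simp
  hence "(\<lambda>n. snd (p n)) \<longlonglongrightarrow> t0" by (simp add: \<phi>_def)
  hence lim: "(\<lambda>n. (fst (p n), snd (p n))) \<longlonglongrightarrow> (z0, t0)" by (rule tendsto_Pair[OF z0])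
  have inK: "(z0, t0) \<in> K"
    by (rule closed_sequentially[OF cl _ lim]) (simp add: pK)
  have \<phi>0: "\<phi> (z0, t0) = I" by (simp add: \<phi>_def t0_def)
  have "t0 + (norm z0)\<^sup>2 / 2 + (norm (z - z0))\<^sup>2 / 2 \<le> t + (norm z)\<^sup>2 / 2" if "(z, t) \<in> K" for z t
  proof -
    \<comment> \<open>Compare \<open>z0\<close> with the point at parameter \<open>s\<close> on the
      segment towards \<open>z\<close>; dividing by \<open>s\<close> and letting it tend to zero
      leaves the full quadratic gap.\<close>
    have "(1 - s) * (norm (z - z0))\<^sup>2 / 2 \<le> \<phi> (z, t) - I" if s: "0 < s" "s < 1" for s
    proof -
      have "I \<le> (1 - s) * I + s * \<phi> (z, t) - s * (1 - s) * (norm (z - z0))\<^sup>2 / 2"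
        using I_le[OF in_K[OF inK \<open>(z, t) \<in> K\<close>, of s]] comb[of s "(z0, t0)" "(z, t)"] s \<phi>0 by simp
      hence "s * ((1 - s) * (norm (z - z0))\<^sup>2 / 2) \<le> s * (\<phi> (z, t) - I)"
        by (simp add: algebra_simps)
      thus ?thesis using s by simp
    qed
    hence "eventually (\<lambda>s. (1 - s) * (norm (z - z0))\<^sup>2 / 2 \<le> \<phi> (z, t) - I) (at_right 0)"
      using eventually_at_right_less[of "0::real"] eventually_at_right_real[of 0 1]
      by (auto elim: eventually_mono)
    moreover have "((\<lambda>s. (1 - s) * (norm (z - z0))\<^sup>2 / 2) \<longlongrightarrow> (1 - 0) * (norm (z - z0))\<^sup>2 / 2)
        (at_right (0::real))"
      by (intro tendsto_intros) auto
    ultimately have "(1 - 0) * (norm (z - z0))\<^sup>2 / 2 \<le> \<phi> (z, t) - I"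
      using tendsto_upperbound by (metis trivial_limit_at_right_real)
    thus ?thesis by (simp add: \<phi>_def t0_def)
  qed
  with inK show ?thesis using that by blast
qed

text \<open>Optimality over a linear space bounds a linear functional from below; scaling its
  argument then leaves only the value zero.\<close>

lemma linear_bounded_below_imp_zero:
  fixes f :: "'a::real_vector \<Rightarrow> real"
  assumes "linear f" and "\<And>x. m \<le> f x"
  shows "f x = 0"
proof (rule ccontr)
  assume "f x \<noteq> 0"
  have "f (((m - 1) / f x) *\<^sub>R x) = m - 1"
    using linear_scale[OF assms(1)] \<open>f x \<noteq> 0\<close> by simp
  thus False using assms(2)[of "((m - 1) / f x) *\<^sub>R x"] by simp
qed

text \<open>The representing vector minimises \<open>(norm z)\<^sup>2 / 2 - f z\<close>; the
  quadratic gap at the minimum bounds \<open>x \<bullet> z0 - f x\<close> from below uniformly in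
  \<open>x\<close>.\<close>

theorem Riesz_representation:
  fixes f :: "'a::{real_inner,complete_space} \<Rightarrow> real"
  assumes f: "bounded_linear f"
  obtains z where "\<And>x. f x = x \<bullet> z"
proof -
  interpret bounded_linear f by fact
  obtain C where C: "\<And>x. norm (f x) \<le> norm x * C" "0 \<le> C" using nonneg_bounded by blast
  let ?K = "range (\<lambda>z. (z, - f z))"
  have cl: "closed ?K"
  proof -
    have "?K = {p. snd p = - f (fst p)}" by (auto simp: image_def)
    moreover have "closed \<dots>"
      by (intro closed_Collect_eq continuous_intros continuous_on)
    ultimately show ?thesis by simp
  qed
  have cv: "convex ?K"
    by (intro convex_linear_image[of "\<lambda>z. (z, - f z)" UNIV, simplified])
       (auto intro!: linearI simp: add scale)
  have lb: "- (C\<^sup>2 / 2) \<le> t + (norm z)\<^sup>2 / 2" if "(z, t) \<in> ?K" for z t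
  proof -
    have "0 \<le> (norm z - C)\<^sup>2" by simp
    thus ?thesis using that C(1)[of z] by (auto simp: power2_diff abs_le_iff)
  qed
  obtain z0 t0 where z0: "(z0, t0) \<in> ?K" and
    min: "\<And>z t. (z, t) \<in> ?K \<Longrightarrow>
       t0 + (norm z0)\<^sup>2 / 2 + (norm (z - z0))\<^sup>2 / 2 \<le> t + (norm z)\<^sup>2 / 2"
    using strongly_convex_minimum[OF cl cv _ lb] by blast
  have "f x = x \<bullet> z0" for x
  proof -
    have "linear (\<lambda>x. x \<bullet> z0 - f x)"
      by (intro linearI) (auto simp: add scale inner_add_left algebra_simps)
    moreover have "(norm z0)\<^sup>2 - f z0 \<le> x \<bullet> z0 - f x" for x
    proof -
      have "t0 = - f z0" using z0 by auto
      moreover have "t0 + (norm z0)\<^sup>2 / 2 + (norm (x - z0))\<^sup>2 / 2 \<le> - f x + (norm x)\<^sup>2 / 2"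
        by (rule min) auto
      ultimately show ?thesis by (simp add: norm_diff_sq field_simps)
    qed
    ultimately show ?thesis using linear_bounded_below_imp_zero by force
  qed
  thus ?thesis using that by blast
qed

text \<open>\<open>adjoint\<close> is a Hilbert choice and carries information only once some map
  satisfies the identity; Riesz applied to \<open>x \<mapsto> T x \<bullet> y\<close> for each
  \<open>y\<close> supplies one.\<close>

lemma adjoint_inner:
  fixes T :: "'a::{real_inner,complete_space} \<Rightarrow> 'b::real_inner"
  assumes T: "bounded_linear T"
  shows "T x \<bullet> y = x \<bullet> adjoint T y"
proof -
  have "\<exists>z. \<forall>x. T x \<bullet> y = x \<bullet> z" for y
    using Riesz_representation[OF bounded_linear_compose[OF bounded_linear_inner_left T]] by metis
  hence "\<exists>g. \<forall>x y. T x \<bullet> y = x \<bullet> g y" by metis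
  thus ?thesis unfolding adjoint_def by (rule someI2_ex) blast
qed

lemma bounded_linear_adjoint:
  fixes T :: "'a::{real_inner,complete_space} \<Rightarrow> 'b::real_inner"
  assumes T: "bounded_linear T"
  shows "bounded_linear (adjoint T)"
proof -
  note adj = adjoint_inner[OF T, symmetric]
  obtain C where C: "\<And>x. norm (T x) \<le> norm x * C" "0 \<le> C"
    using bounded_linear.nonneg_bounded[OF T] by blast
  show ?thesis
  proof (rule bounded_linear_intro)
    fix x y r
    show "adjoint T (x + y) = adjoint T x + adjoint T y"
      by (subst vector_eq_ldot[symmetric]) (simp add: adj inner_add_right)
    show "adjoint T (r *\<^sub>R x) = r *\<^sub>R adjoint T x"
      by (subst vector_eq_ldot[symmetric]) (simp add: adj)
    have "norm (adjoint T x) * norm (adjoint T x) = T (adjoint T x) \<bullet> x"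
      by (metis adj power2_norm_eq_inner power2_eq_square)
    also have "\<dots> \<le> norm (adjoint T x) * C * norm x"
      using norm_cauchy_schwarz[of "T (adjoint T x)" x] C(1)[of "adjoint T x"]
      by (meson mult_right_mono norm_ge_zero order_trans)
    finally show "norm (adjoint T x) \<le> norm x * C"
      using C(2) by (cases "adjoint T x = 0") (simp_all add: algebra_simps)
  qed
qed

text \<open>The uniform boundedness principle by Baire: some level set \<open>E n\<close> contains a
  ball of radius \<open>r\<close>, and pairing \<open>x\<close> with the centre and with the point
  at distance \<open>r\<close> in the direction of \<open>x\<close> gives at most \<open>n\<close>
  each time.\<close>

lemma pointwise_bounded_imp_bounded:
  fixes F :: "'b::{real_inner,complete_space} set"
  assumes ptw: "\<And>y. \<exists>C. \<forall>x\<in>F. \<bar>x \<bullet> y\<bar> \<le> C"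
  shows "\<exists>C. \<forall>x\<in>F. norm x \<le> C"
proof -
  define E where "E n = {y. \<forall>x\<in>F. \<bar>x \<bullet> y\<bar> \<le> real n}" for n
  have cl: "closed (E n)" for n
  proof -
    have "E n = (\<Inter>x\<in>F. {y. \<bar>x \<bullet> y\<bar> \<le> real n})" by (auto simp: E_def)
    thus ?thesis by (auto intro!: closed_INT closed_Collect_le continuous_intros)
  qed
  have "\<exists>n. y \<in> E n" for y
  proof -
    obtain C where "\<forall>x\<in>F. \<bar>x \<bullet> y\<bar> \<le> C" using ptw by blast
    moreover obtain n :: nat where "C \<le> real n" using real_arch_simple by blast
    ultimately show ?thesis unfolding E_def by (auto intro: order_trans)
  qed
  hence "interior (\<Union>(range E)) = UNIV" by (metis UNIV_eq_I UnionI interior_UNIV rangeI)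
  hence "\<not> (\<forall>T\<in>range E. closedin euclidean T \<and> euclidean interior_of T = {})"
    using Baire_category_alt[of "euclidean :: 'b topology" "range E"]
    by (auto simp: completely_metrizable_space_euclidean)
  then obtain n y r where r: "0 < r" "cball y r \<subseteq> E n"
    using cl by (auto simp: mem_interior_cball)
  have "norm x \<le> 2 * real n / r" if "x \<in> F" for x
  proof (cases "x = 0")
    case False
    let ?d = "(r / norm x) *\<^sub>R x"
    have "y \<in> E n" "y + ?d \<in> E n" using r False by (auto simp: subset_iff dist_norm)
    hence "\<bar>x \<bullet> (y + ?d) - x \<bullet> y\<bar> \<le> 2 * real n"
      using that unfolding E_def by fastforce
    moreover have "x \<bullet> (y + ?d) - x \<bullet> y = r * norm x"
      using False by (simp add: inner_add_right power2_eq_square flip: power2_norm_eq_inner)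
    ultimately show ?thesis using r by (simp add: field_simps)
  qed (use r in simp)
  thus ?thesis by blast
qed

text \<open>Every \<open>y\<close> is some \<open>T f\<close>, so pairing it with \<open>x\<close>
  is pairing \<open>f\<close> with \<open>adjoint T x\<close>. The vectors with image in the unit
  ball are therefore weakly bounded, hence bounded.\<close>

lemma adjoint_bounded_below:
  fixes T :: "'a::{real_inner,complete_space} \<Rightarrow> 'b::{real_inner,complete_space}"
  assumes T: "bounded_linear T" and surj: "surj T"
  obtains c where "c > 0" and "\<And>y. c * norm y \<le> norm (adjoint T y)"
proof -
  interpret adj: bounded_linear "adjoint T" by (rule bounded_linear_adjoint[OF T])
  have "\<exists>C. \<forall>x\<in>{x. norm (adjoint T x) \<le> 1}. \<bar>x \<bullet> y\<bar> \<le> C" for y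
  proof -
    obtain f where f: "y = T f" using surj by blast
    have "\<bar>x \<bullet> y\<bar> \<le> norm f" if "norm (adjoint T x) \<le> 1" for x
      using Cauchy_Schwarz_ineq2[of f "adjoint T x"] mult_left_mono[OF that norm_ge_zero[of f]]
      by (simp add: f inner_commute[of x] adjoint_inner[OF T])
    thus ?thesis by blast
  qed
  then obtain C where C: "\<And>x. norm (adjoint T x) \<le> 1 \<Longrightarrow> norm x \<le> C"
    using pointwise_bounded_imp_bounded[of "{x. norm (adjoint T x) \<le> 1}"] by auto
  have C0: "0 \<le> C" using C[of 0] by (simp add: adj.zero)
  \<comment> \<open>\<open>C\<close> may vanish, when the target space is trivial;
    \<open>C + 1\<close> is safe to divide by, and a nonzero kernel vector scaled to norm
    \<open>C + 1\<close> is contradictory.\<close>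
  have "norm y \<le> (C + 1) * norm (adjoint T y)" for y
  proof (cases "adjoint T y = 0")
    case True
    have "y = 0"
    proof (rule ccontr)
      assume "y \<noteq> 0"
      have "norm (((C + 1) / norm y) *\<^sub>R y) \<le> C"
        by (rule C) (simp add: adj.scale True)
      thus False using \<open>y \<noteq> 0\<close> C0 by simp
    qed
    thus ?thesis by simp
  next
    case False
    have "norm ((1 / norm (adjoint T y)) *\<^sub>R y) \<le> C"
      by (rule C) (use False in \<open>simp add: adj.scale\<close>)
    hence "norm y \<le> C * norm (adjoint T y)" using False by (simp add: field_simps)
    thus ?thesis by (simp add: distrib_right add_increasing2)
  qed
  hence "1 / (C + 1) * norm y \<le> norm (adjoint T y)" for y
    using C0 by (simp add: field_simps)
  thus ?thesis using that[of "1 / (C + 1)"] C0 by simp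
qed

text \<open>The lower bound makes the range closed, so it contains a point nearest to
  \<open>z\<close>. The residual \<open>z0\<close> is orthogonal to the range, which puts it into
  the kernel of \<open>T\<close>; by hypothesis it is then orthogonal to \<open>z\<close> too, and
  hence to itself.\<close>

lemma orthogonal_kernel_in_range_adjoint:
  fixes T :: "'a::{real_inner,complete_space} \<Rightarrow> 'b::{real_inner,complete_space}"
  assumes T: "bounded_linear T" and surj: "surj T"
    and z: "\<And>x. T x = 0 \<Longrightarrow> x \<bullet> z = 0"
  shows "z \<in> range (adjoint T)"
proof -
  interpret adj: bounded_linear "adjoint T" by (rule bounded_linear_adjoint[OF T])
  obtain c where c: "c > 0" "\<And>y. c * norm y \<le> norm (adjoint T y)"
    using adjoint_bounded_below[OF T surj] by metis
  have "complete (range (adjoint T))"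
    using complete_isometric_image[of c UNIV "adjoint T"] c adj.bounded_linear_axioms
    by (auto simp: mult.commute complete_UNIV)
  hence "closed ((\<lambda>x. x - z) ` range (adjoint T))"
    by (intro closed_translation_subtract complete_imp_closed)
  \<comment> \<open>The zero in the second component encodes the indicator function of the
    translated range: minimising over it finds the point nearest to \<open>z\<close>.\<close>
  hence "closed ((\<lambda>x. x - z) ` range (adjoint T) \<times> {0::real})" by (intro closed_Times) auto
  moreover have "convex ((\<lambda>x. x - z) ` range (adjoint T) \<times> {0::real})"
    by (intro convex_Times convex_translation_subtract convex_linear_image) (auto intro: adj.linear)
  ultimately obtain z0 t0 where z0: "(z0, t0) \<in> (\<lambda>x. x - z) ` range (adjoint T) \<times> {0::real}"
    and min: "\<And>x t. (x, t) \<in> (\<lambda>x. x - z) ` range (adjoint T) \<times> {0} \<Longrightarrow>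
       t0 + (norm z0)\<^sup>2 / 2 + (norm (x - z0))\<^sup>2 / 2 \<le> t + (norm x)\<^sup>2 / 2"
    using strongly_convex_minimum[of "(\<lambda>x. x - z) ` range (adjoint T) \<times> {0::real}" 0] by auto
  obtain \<xi> where \<xi>: "z0 = adjoint T \<xi> - z" using z0 by auto
  have orth: "z0 \<bullet> adjoint T y = 0" for y
  proof (rule linear_bounded_below_imp_zero[where f = "\<lambda>y. z0 \<bullet> adjoint T y" and m = 0])
    show "linear (\<lambda>y. z0 \<bullet> adjoint T y)"
      by (intro linearI) (auto simp: adj.add adj.scale inner_add_right)
    show "0 \<le> z0 \<bullet> adjoint T y" for y
    proof -
      have "z0 + adjoint T y = adjoint T (\<xi> + y) - z" by (simp add: \<xi> adj.add)
      hence "t0 + (norm z0)\<^sup>2 / 2 + (norm (z0 + adjoint T y - z0))\<^sup>2 / 2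
          \<le> 0 + (norm (z0 + adjoint T y))\<^sup>2 / 2"
        by (intro min) auto
      thus ?thesis using z0 unfolding norm_add_sq[of z0 "adjoint T y"] by auto
    qed
  qed
  have "T z0 \<bullet> T z0 = 0" using orth[of "T z0"] by (simp add: adjoint_inner[OF T])
  hence "z0 \<bullet> z = 0" using z[of z0] by (simp add: inner_commute)
  hence "z0 \<bullet> z0 = 0" using orth[of \<xi>] \<xi> by (metis inner_diff_right diff_self)
  thus ?thesis using \<xi> by auto
qed

section \<open>Maximal monotone relations\<close>

text \<open>Maximality as it is used: adjoining one pair that is monotonically related to all of
  \<Theta> keeps the relation monotone, so the pair was there already.\<close>

lemma maximal_monotone_relation_iff:
  "maximal_monotone_relation \<Theta> \<longleftrightarrow> monotone_relation \<Theta> \<and>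
     (\<forall>x y. (\<forall>(a, b)\<in>\<Theta>. (y - b) \<bullet> (x - a) \<ge> 0) \<longrightarrow> (x, y) \<in> \<Theta>)"
  (is "_ \<longleftrightarrow> _ \<and> ?rel")
proof
  assume max: "maximal_monotone_relation \<Theta>"
  hence mono: "monotone_relation \<Theta>" by (simp add: maximal_monotone_relation_def)
  have "(x, y) \<in> \<Theta>" if rel: "\<forall>(a, b)\<in>\<Theta>. (y - b) \<bullet> (x - a) \<ge> 0" for x y
  proof (rule ccontr)
    assume "(x, y) \<notin> \<Theta>"
    moreover have "(b - y) \<bullet> (a - x) \<ge> 0" if "(a, b) \<in> \<Theta>" for a b
    proof -
      have "(b - y) \<bullet> (a - x) = (y - b) \<bullet> (x - a)" by (simp add: inner_diff)
      thus ?thesis using rel that by auto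
    qed
    hence "monotone_relation (insert (x, y) \<Theta>)"
      using mono rel unfolding monotone_relation_def by auto
    ultimately show False using max unfolding maximal_monotone_relation_def by blast
  qed
  with mono show "monotone_relation \<Theta> \<and> ?rel" by blast
next
  assume R: "monotone_relation \<Theta> \<and> ?rel"
  have "\<Theta>' \<subseteq> \<Theta>" if mono: "monotone_relation \<Theta>'" and sub: "\<Theta> \<subseteq> \<Theta>'" for \<Theta>'
  proof clarify
    fix x y assume xy: "(x, y) \<in> \<Theta>'"
    have "\<forall>(a, b)\<in>\<Theta>. (y - b) \<bullet> (x - a) \<ge> 0"
      using mono xy sub unfolding monotone_relation_def by fast
    thus "(x, y) \<in> \<Theta>" using R by blast
  qed
  thus "maximal_monotone_relation \<Theta>" using R unfolding maximal_monotone_relation_def by blast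
qed

lemma monotone_relationD:
  "monotone_relation \<Theta> \<Longrightarrow> (x, y) \<in> \<Theta> \<Longrightarrow> (a, b) \<in> \<Theta> \<Longrightarrow> (y - b) \<bullet> (x - a) \<ge> 0"
  by (fastforce simp: monotone_relation_def)

lemma maximal_monotoneD:
  assumes "maximal_monotone_relation \<Theta>" and "\<And>a b. (a, b) \<in> \<Theta> \<Longrightarrow> (y - b) \<bullet> (x - a) \<ge> 0"
  shows "(x, y) \<in> \<Theta>"
proof -
  have "\<forall>(a, b)\<in>\<Theta>. (y - b) \<bullet> (x - a) \<ge> 0" using assms(2) by auto
  thus ?thesis using assms(1) by (simp add: maximal_monotone_relation_iff)
qed

text \<open>Turns the equation \<open>x + \<rho> *\<^sub>R y = f\<close> into the search for a pair
  \<open>(x, - x)\<close>, the only case for which the minimisation is carried out.\<close>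

lemma maximal_monotone_affine:
  assumes max: "maximal_monotone_relation \<Theta>" and \<rho>: "\<rho> > 0"
  shows "maximal_monotone_relation ((\<lambda>(x, y). (x, \<rho> *\<^sub>R y - f)) ` \<Theta>)"
proof -
  have scale: "(\<rho> *\<^sub>R y - f - (\<rho> *\<^sub>R b - f)) \<bullet> (x - a) = \<rho> * ((y - b) \<bullet> (x - a))" for x y a b
    by (simp add: inner_diff algebra_simps)
  show ?thesis
    unfolding maximal_monotone_relation_iff
  proof (intro conjI allI impI)
    show "monotone_relation ((\<lambda>(x, y). (x, \<rho> *\<^sub>R y - f)) ` \<Theta>)"
      unfolding monotone_relation_def
      using max \<rho> scale monotone_relationD[of \<Theta>]
      by (force simp: maximal_monotone_relation_def simp del: add_diff_cancel_right')
  next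
    fix x y
    assume rel: "\<forall>(a, b)\<in>(\<lambda>(x, y). (x, \<rho> *\<^sub>R y - f)) ` \<Theta>. (y - b) \<bullet> (x - a) \<ge> 0"
    define y' where "y' = (1 / \<rho>) *\<^sub>R (y + f)"
    have y: "y = \<rho> *\<^sub>R y' - f" using \<rho> by (simp add: y'_def)
    have "(x, y') \<in> \<Theta>"
    proof (rule maximal_monotoneD[OF max])
      fix a b assume "(a, b) \<in> \<Theta>"
      hence "(y - (\<rho> *\<^sub>R b - f)) \<bullet> (x - a) \<ge> 0" using rel by force
      thus "(y' - b) \<bullet> (x - a) \<ge> 0" unfolding y scale using \<rho> by (simp add: zero_le_mult_iff)
    qed
    thus "(x, y) \<in> (\<lambda>(x, y). (x, \<rho> *\<^sub>R y - f)) ` \<Theta>" using y by force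
  qed
qed

text \<open>
  The Simons--Zalinescu proof of Minty's theorem: the Fitzpatrick function of \<open>\<Theta>\<close> (here
  represented by its epigraph \<open>K\<close>) dominates the duality pairing, so adding half the square of the
  norm gives a nonnegative strongly convex function, and its minimiser is the wanted pair.
\<close>

lemma maximal_monotone_contains_antidiagonal:
  fixes \<Theta> :: "('b::{real_inner,complete_space} \<times> 'b) set"
  assumes max: "maximal_monotone_relation \<Theta>"
  shows "\<exists>x. (x, - x) \<in> \<Theta>"
proof -
  have mono: "monotone_relation \<Theta>" using max by (simp add: maximal_monotone_relation_def)
  define K where "K = {p :: ('b \<times> 'b) \<times> real.
    \<forall>q\<in>\<Theta>. fst (fst p) \<bullet> snd q + fst q \<bullet> snd (fst p) - fst q \<bullet> snd q \<le> snd p}"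
  have K_iff: "((x, y), t) \<in> K \<longleftrightarrow> (\<forall>(a, b)\<in>\<Theta>. x \<bullet> b + a \<bullet> y - a \<bullet> b \<le> t)" for x y t
    by (auto simp: K_def)
  have K_INT: "K = (\<Inter>q\<in>\<Theta>. {p. fst (fst p) \<bullet> snd q + fst q \<bullet> snd (fst p) - fst q \<bullet> snd q \<le> snd p})"
    by (auto simp: K_def)
  have cl: "closed K"
    unfolding K_INT by (intro closed_INT ballI closed_Collect_le continuous_intros)
  have cv: "convex K"
    unfolding K_INT
  proof (intro convex_INT convexI)
    fix q :: "'b \<times> 'b" and p p' :: "('b \<times> 'b) \<times> real" and u v :: real
    assume *: "p \<in> {p. fst (fst p) \<bullet> snd q + fst q \<bullet> snd (fst p) - fst q \<bullet> snd q \<le> snd p}"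
      "p' \<in> {p. fst (fst p) \<bullet> snd q + fst q \<bullet> snd (fst p) - fst q \<bullet> snd q \<le> snd p}"
      and uv: "0 \<le> u" "0 \<le> v" "u + v = 1"
    have "u * (fst (fst p) \<bullet> snd q + fst q \<bullet> snd (fst p) - fst q \<bullet> snd q)
        + v * (fst (fst p') \<bullet> snd q + fst q \<bullet> snd (fst p') - fst q \<bullet> snd q) \<le> u * snd p + v * snd p'"
      using * uv by (intro add_mono mult_left_mono) auto
    moreover have "fst q \<bullet> snd q = u * (fst q \<bullet> snd q) + v * (fst q \<bullet> snd q)"
      using uv by (simp flip: distrib_right)
    ultimately show "u *\<^sub>R p + v *\<^sub>R p'
      \<in> {p. fst (fst p) \<bullet> snd q + fst q \<bullet> snd (fst p) - fst q \<bullet> snd q \<le> snd p}"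
      by (simp add: inner_add algebra_simps)
  qed
  have graph: "((a, b), a \<bullet> b) \<in> K" if ab: "(a, b) \<in> \<Theta>" for a b
    unfolding K_iff
  proof clarify
    fix c d assume "(c, d) \<in> \<Theta>"
    from monotone_relationD[OF mono ab this]
    show "a \<bullet> d + c \<bullet> b - c \<bullet> d \<le> a \<bullet> b" by (simp add: inner_diff inner_commute)
  qed
  \<comment> \<open>If \<open>t\<close> were below the pairing, \<open>(x, y)\<close> would be
    monotonically related to all of \<Theta> and so belong to it; the inequality defining
    \<open>K\<close>, tested at this very pair, gives the contradiction.\<close>
  have pairing: "x \<bullet> y \<le> t" if K: "((x, y), t) \<in> K" for x y t
  proof (rule ccontr)
    assume less: "\<not> x \<bullet> y \<le> t"
    have "(x, y) \<in> \<Theta>"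
    proof (rule maximal_monotoneD[OF max])
      fix a b assume "(a, b) \<in> \<Theta>"
      with K less have "x \<bullet> b + a \<bullet> y - a \<bullet> b \<le> x \<bullet> y" unfolding K_iff by fastforce
      thus "(y - b) \<bullet> (x - a) \<ge> 0" by (simp add: inner_diff inner_commute)
    qed
    with K less show False unfolding K_iff by fastforce
  qed
  have norm_pair: "(norm (x, y))\<^sup>2 = (norm x)\<^sup>2 + (norm y)\<^sup>2" for x y :: 'b
    by (simp add: norm_Pair)
  have below: "(norm (fst z + snd z))\<^sup>2 / 2 \<le> t + (norm z)\<^sup>2 / 2" if "(z, t) \<in> K" for z t
    using pairing[of "fst z" "snd z" t] that norm_pair[of "fst z" "snd z"]
    by (simp add: norm_add_sq field_simps)
  have ne: "K \<noteq> {}"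
  proof (cases "\<Theta> = {}")
    case True
    thus ?thesis by (auto simp: K_def)
  next
    case False
    then obtain a b where "(a, b) \<in> \<Theta>" by (metis equals0I surj_pair)
    thus ?thesis using graph by blast
  qed
  obtain z0 t0 where z0: "(z0, t0) \<in> K"
    and min: "\<And>z t. (z, t) \<in> K \<Longrightarrow>
       t0 + (norm z0)\<^sup>2 / 2 + (norm (z - z0))\<^sup>2 / 2 \<le> t + (norm z)\<^sup>2 / 2"
    using strongly_convex_minimum[OF cl cv ne, of 0] order_trans[OF _ below] by auto
  obtain x y where xy: "z0 = (x, y)" by force
  \<comment> \<open>Compare the minimiser with the point of \<open>K\<close> over
    \<open>(a, b)\<close>. The outcome says that \<open>(- y, - x)\<close> is monotonically related
    to \<Theta>.\<close>
  have key: "(norm (x + y))\<^sup>2 \<le> (- x - b) \<bullet> (- y - a)" if "(a, b) \<in> \<Theta>" for a b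
  proof -
    have "(norm (x + y))\<^sup>2 / 2 + ((norm (a - x))\<^sup>2 + (norm (b - y))\<^sup>2) / 2
        \<le> a \<bullet> b + ((norm a)\<^sup>2 + (norm b)\<^sup>2) / 2"
      using min[OF graph[OF that]] below[OF z0] by (simp add: xy norm_pair field_simps)
    moreover have "(- x - b) \<bullet> (- y - a) = x \<bullet> y + a \<bullet> b + x \<bullet> a + b \<bullet> y"
      by (simp add: inner_diff inner_commute)
    ultimately show ?thesis
      by (simp add: norm_add_sq norm_diff_sq inner_commute field_simps)
  qed
  have "(- y, - x) \<in> \<Theta>"
    using order_trans[OF zero_le_power2 key] by (rule maximal_monotoneD[OF max])
  \<comment> \<open>The pair now belongs to \<Theta> itself, and inserting it makes the right-hand
    side vanish.\<close>
  from key[OF this] have "x = - y" by (simp add: add_eq_0_iff)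
  thus ?thesis using \<open>(- y, - x) \<in> \<Theta>\<close> by (intro exI[of _ "- y"]) simp
qed

theorem Minty:
  fixes \<Theta> :: "('b::{real_inner,complete_space} \<times> 'b) set"
  assumes max: "maximal_monotone_relation \<Theta>" and \<rho>: "\<rho> > 0"
  obtains x y where "(x, y) \<in> \<Theta>" and "x + \<rho> *\<^sub>R y = f"
proof -
  obtain x where "(x, - x) \<in> (\<lambda>(x, y). (x, \<rho> *\<^sub>R y - f)) ` \<Theta>"
    using maximal_monotone_contains_antidiagonal[OF maximal_monotone_affine[OF max \<rho>]] by blast
  then obtain y where "(x, y) \<in> \<Theta>" "- x = \<rho> *\<^sub>R y - f" by auto
  moreover from this(2) have "x + \<rho> *\<^sub>R y = f" by (simp add: algebra_simps minus_equation_iff)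
  ultimately show ?thesis using that by blast
qed

text \<open>
  With \<open>J\<close> the resolvent of \<open>\<rho> \<Theta>\<close>, a solution is a fixed point of
  \<open>\<xi> \<mapsto> J (\<xi> - \<rho> M \<xi> + \<rho> f)\<close>, a contraction for small \<open>\<rho>\<close>.
\<close>

lemma maximal_monotone_plus_coercive_onto:
  fixes \<Theta> :: "('b::{real_inner,complete_space} \<times> 'b) set"
  assumes max: "maximal_monotone_relation \<Theta>" and M: "bounded_linear M"
    and m: "m > 0" and coercive: "\<And>x. m * (norm x)\<^sup>2 \<le> M x \<bullet> x"
  obtains x y where "(x, y) \<in> \<Theta>" and "y + M x = f"
proof -
  interpret M: bounded_linear M by fact
  obtain L' where L': "\<And>x. norm (M x) \<le> norm x * L'" "L' > 0" using M.pos_bounded by blast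
  define L where "L = max L' m"
  have L: "norm (M x) \<le> L * norm x" "L > 0" "m \<le> L" for x
    using L' order_trans[OF L'(1)[of x] mult_left_mono[of L' L "norm x"]] m
    by (auto simp: L_def mult.commute)
  \<comment> \<open>Minimises \<open>1 - 2 * \<rho> * m + \<rho>\<^sup>2 * L\<^sup>2\<close>, a
    bound for the squared contraction factor of \<open>x \<mapsto> x - \<rho> *\<^sub>R M x\<close>;
    the minimum is \<open>c\<^sup>2\<close>, nonnegative because \<open>L\<close> was enlarged to at
    least \<open>m\<close>.\<close>
  define \<rho> where "\<rho> = m / L\<^sup>2"
  have \<rho>: "\<rho> > 0" using L m by (simp add: \<rho>_def)
  have "\<exists>x y. (x, y) \<in> \<Theta> \<and> x + \<rho> *\<^sub>R y = g" for g using Minty[OF max \<rho>] by metis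
  then obtain J J' where J: "\<And>g. (J g, J' g) \<in> \<Theta>" "\<And>g. J g + \<rho> *\<^sub>R J' g = g" by metis
  have nonexp: "norm (J g - J h) \<le> norm (g - h)" for g h
  proof -
    have "0 \<le> \<rho> * ((J' g - J' h) \<bullet> (J g - J h))"
      using monotone_relationD[of \<Theta>, OF _ J(1)[of g] J(1)[of h]] max \<rho>
      by (simp add: maximal_monotone_relation_def)
    also have "\<dots> = (\<rho> *\<^sub>R J' g - \<rho> *\<^sub>R J' h) \<bullet> (J g - J h)" by (simp flip: scaleR_diff_right)
    also have "\<rho> *\<^sub>R J' g - \<rho> *\<^sub>R J' h = (g - h) - (J g - J h)"
      using J(2)[of g] J(2)[of h] by (metis (no_types, lifting) add_diff_add add_diff_cancel_left')
    finally have "(norm (J g - J h))\<^sup>2 \<le> (g - h) \<bullet> (J g - J h)"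
      by (simp add: inner_diff_left power2_norm_eq_inner)
    also have "\<dots> \<le> norm (g - h) * norm (J g - J h)" by (rule norm_cauchy_schwarz)
    finally show ?thesis by (cases "J g = J h") (auto simp: power2_eq_square)
  qed
  define c where "c = sqrt (1 - (m / L)\<^sup>2)"
  have mL: "0 < m / L" "m / L \<le> 1" using L m by auto
  hence mL2: "0 < (m / L)\<^sup>2" "(m / L)\<^sup>2 \<le> 1" by (auto simp: power_le_one)
  hence c: "0 \<le> c" "c < 1" by (auto simp: c_def)
  have contr: "norm (x - \<rho> *\<^sub>R M x) \<le> c * norm x" for x
  proof -
    have "(norm (x - \<rho> *\<^sub>R M x))\<^sup>2 = (norm x)\<^sup>2 - 2 * \<rho> * (M x \<bullet> x) + \<rho>\<^sup>2 * (norm (M x))\<^sup>2"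
      by (simp add: norm_diff_sq inner_commute power_mult_distrib)
    also have "\<dots> \<le> (norm x)\<^sup>2 - 2 * \<rho> * (m * (norm x)\<^sup>2) + \<rho>\<^sup>2 * (L * norm x)\<^sup>2"
      using \<rho> coercive L by (intro add_mono diff_left_mono mult_left_mono power_mono) auto
    also have "\<dots> = (c * norm x)\<^sup>2"
      using L mL2 by (simp add: c_def \<rho>_def power_mult_distrib field_simps power2_eq_square)
    finally show ?thesis using c by (auto intro: power2_le_imp_le)
  qed
  define F where "F x = J (x - \<rho> *\<^sub>R M x + \<rho> *\<^sub>R f)" for x
  have "dist (F x) (F y) \<le> c * dist x y" for x y
    using nonexp[of "x - \<rho> *\<^sub>R M x + \<rho> *\<^sub>R f" "y - \<rho> *\<^sub>R M y + \<rho> *\<^sub>R f"] contr[of "x - y"]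
    by (simp add: F_def dist_norm M.diff algebra_simps)
  then obtain x where x: "F x = x" using banach_fix_type[OF c, of F] by auto
  define y where "y = J' (x - \<rho> *\<^sub>R M x + \<rho> *\<^sub>R f)"
  have "(x, y) \<in> \<Theta>" using J(1) x unfolding F_def y_def by metis
  moreover have "x + \<rho> *\<^sub>R y = x - \<rho> *\<^sub>R M x + \<rho> *\<^sub>R f" using J(2) x unfolding F_def y_def by metis
  hence "\<rho> *\<^sub>R (y + M x) = \<rho> *\<^sub>R f" by (simp add: algebra_simps)
  hence "y + M x = f" using \<rho> by simp
  ultimately show ?thesis using that by blast
qed

section \<open>The backward Euler scheme\<close>

lemma geometric_increments_Cauchy:
  fixes X :: "nat \<Rightarrow> 'a::real_normed_vector"
  assumes le: "\<And>j. norm (X (Suc j) - X j) \<le> C * q ^ j" and q: "0 \<le> q" "q < 1"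
  shows "Cauchy X"
proof -
  have C: "0 \<le> C" using order_trans[OF norm_ge_zero le[of 0]] by simp
  have tail: "norm (X (j + n) - X j) \<le> C * q ^ j / (1 - q)" for j n
  proof -
    have "norm (X (j + n) - X j) \<le> (\<Sum>i<n. C * q ^ (j + i))"
    proof (induction n)
      case (Suc n)
      have "norm (X (j + Suc n) - X j) \<le> norm (X (Suc (j + n)) - X (j + n)) + norm (X (j + n) - X j)"
        using norm_triangle_ineq[of "X (Suc (j + n)) - X (j + n)" "X (j + n) - X j"] by simp
      with Suc le[of "j + n"] show ?case by simp
    qed simp
    also have "\<dots> = C * q ^ j * (\<Sum>i<n. q ^ i)" by (simp add: power_add sum_distrib_left mult.assoc)
    also have "\<dots> = C * q ^ j * ((1 - q ^ n) / (1 - q))" using q by (simp add: sum_gp_strict)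
    also have "\<dots> \<le> C * q ^ j * (1 / (1 - q))"
      using C q by (intro mult_left_mono divide_right_mono) auto
    finally show ?thesis by simp
  qed
  have lim: "(\<lambda>j. C * q ^ j / (1 - q)) \<longlonglongrightarrow> C * 0 / (1 - q)"
    by (intro tendsto_intros LIMSEQ_power_zero) (use q in auto)
  show ?thesis
    unfolding Cauchy_altdef2
  proof (intro allI impI)
    fix e :: real assume "0 < e"
    hence "\<forall>\<^sub>F j in sequentially. C * q ^ j / (1 - q) < e"
      using order_tendstoD(2)[OF lim] by simp
    then obtain j where "C * q ^ j / (1 - q) < e" by (auto simp: eventually_sequentially)
    hence "\<forall>n\<ge>j. dist (X n) (X j) < e"
      using tail[of j] by (metis dist_norm le_Suc_ex le_less_trans)
    thus "\<exists>N. \<forall>n\<ge>N. dist (X n) (X N) < e" by blast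
  qed
qed

section \<open>Quasi-maximal monotone operators and one implicit step\<close>

lemma single_valued_op_app: "single_valued A \<Longrightarrow> (x, y) \<in> A \<Longrightarrow> op_app A x = y"
  unfolding op_app_def single_valued_def by (rule the_equality) auto

lemma op_app_in_graph: "single_valued A \<Longrightarrow> x \<in> Domain A \<Longrightarrow> (x, op_app A x) \<in> A"
  by (metis Domain.cases single_valued_op_app)

text \<open>The range condition is asked at every \<nu> > lam because the Euler steps use
  \<open>1 / h\<close> with arbitrarily small \<open>h\<close>, the Yosida approximations
  \<open>lam + 1 / e n\<close>, and maximality \<open>lam + 1\<close>.\<close>

locale quasi_maximal_monotone =
  fixes A :: "('a::{real_inner,complete_space} \<times> 'a) set" and lam :: real
  assumes single: "single_valued A"
    and mono: "(x, y) \<in> A \<Longrightarrow> (x', y') \<in> A \<Longrightarrow> - lam * (norm (x - x'))\<^sup>2 \<le> (y - y') \<bullet> (x - x')"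
    and onto: "\<nu> > lam \<Longrightarrow> \<exists>x y. (x, y) \<in> A \<and> y + \<nu> *\<^sub>R x = f"
begin

abbreviation a :: "'a \<Rightarrow> 'a" where "a \<equiv> op_app A"

abbreviation D :: "'a set" where "D \<equiv> Domain A"

lemma a_eq: "(x, y) \<in> A \<Longrightarrow> a x = y"
  by (rule single_valued_op_app[OF single])

lemma a_graph: "x \<in> D \<Longrightarrow> (x, a x) \<in> A"
  by (rule op_app_in_graph[OF single])

lemma a_mono: "x \<in> D \<Longrightarrow> y \<in> D \<Longrightarrow> - lam * (norm (x - y))\<^sup>2 \<le> (a x - a y) \<bullet> (x - y)"
  by (intro mono a_graph)

text \<open>Solve the range equation for the value it should have at \<open>u\<close>, namely
  \<open>w + (lam + 1) *\<^sub>R u\<close>. The hypothesis at the solution \<open>x\<close> then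
  bounds the square of \<open>norm (u - x)\<close> by zero.\<close>

lemma maximal:
  assumes "\<And>v. v \<in> D \<Longrightarrow> - lam * (norm (u - v))\<^sup>2 \<le> (w - a v) \<bullet> (u - v)"
  shows "(u, w) \<in> A"
proof -
  obtain x y where xy: "(x, y) \<in> A" "y + (lam + 1) *\<^sub>R x = w + (lam + 1) *\<^sub>R u"
    using onto[of "lam + 1" "w + (lam + 1) *\<^sub>R u"] by auto
  hence wy: "w - y = (- (lam + 1)) *\<^sub>R (u - x)" by (simp add: algebra_simps)
  have "- lam * (norm (u - x))\<^sup>2 \<le> (w - y) \<bullet> (u - x)"
    using assms[of x] a_eq[OF xy(1)] xy(1) by (auto simp: Domain_iff)
  hence "(norm (u - x))\<^sup>2 \<le> 0" unfolding wy by (simp add: power2_norm_eq_inner algebra_simps)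
  hence "u = x" by simp
  with wy xy(1) show ?thesis by simp
qed

lemma closed_graph:
  assumes "\<And>n. (x n, y n) \<in> A" "x \<longlonglongrightarrow> u" "y \<longlonglongrightarrow> w"
  shows "(u, w) \<in> A"
proof (rule maximal)
  fix v assume "v \<in> D"
  have "\<forall>n. - lam * (norm (x n - v))\<^sup>2 \<le> (y n - a v) \<bullet> (x n - v)"
    using mono[OF assms(1) a_graph[OF \<open>v \<in> D\<close>]] by blast
  moreover have "(\<lambda>n. - lam * (norm (x n - v))\<^sup>2) \<longlonglongrightarrow> - lam * (norm (u - v))\<^sup>2"
    "(\<lambda>n. (y n - a v) \<bullet> (x n - v)) \<longlonglongrightarrow> (w - a v) \<bullet> (u - v)"
    by (intro tendsto_intros assms)+
  ultimately show "- lam * (norm (u - v))\<^sup>2 \<le> (w - a v) \<bullet> (u - v)"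
    by (intro LIMSEQ_le) auto
qed

text \<open>One implicit Euler step of length \<open>h\<close>: the solution of
  \<open>x + h A x = f\<close>.\<close>

definition J :: "real \<Rightarrow> 'a \<Rightarrow> 'a" where
  "J h f = (SOME x. (x, (1 / h) *\<^sub>R (f - x)) \<in> A)"

text \<open>A nonnegative growth rate for every sign of \<open>lam\<close>. The factor 2 absorbs the
  implicit Euler factor: as long as \<open>h * k \<le> 1\<close>, \<open>1 / (1 - h * lam)\<close>
  is at most \<open>exp (k * h)\<close>.\<close>

definition k :: real where "k = 2 * max lam 0"

definition step :: "real \<Rightarrow> bool" where "step h \<longleftrightarrow> 0 < h \<and> h * k \<le> 1"

lemma k_nonneg: "0 \<le> k" by (simp add: k_def)

lemma stepD:
  assumes "step h"
  shows "0 < h" and "h * lam < 1" and "1 \<le> exp (k * h) * (1 - h * lam)" and "step (h / 2)"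
proof -
  show h: "0 < h" using assms by (simp add: step_def)
  have hk: "h * k \<le> 1" using assms by (simp add: step_def)
  have "2 * (h * lam) \<le> h * k" using h by (simp add: k_def algebra_simps)
  thus hl: "h * lam < 1" using hk by linarith
  have "1 \<le> (1 + k * h) * (1 - h * lam)"
  proof (cases "lam \<le> 0")
    case True
    thus ?thesis using h by (simp add: k_def max_def mult_nonneg_nonpos)
  next
    case False
    hence "0 \<le> h * lam" "h * lam \<le> 1 / 2" using h hk by (auto simp: k_def max_def)
    \<comment> \<open>With \<open>x = h * lam\<close> the claim is
      \<open>(1 + 2 * x) * (1 - x) = 1 + x * (1 - 2 * x) \<ge> 1\<close>.\<close>
    hence "0 \<le> h * lam * (1 - 2 * (h * lam))" using mult_nonneg_nonneg[of "h * lam" "1 - 2 * (h * lam)"] by simp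
    thus ?thesis using False by (simp add: k_def max_def algebra_simps)
  qed
  also have "\<dots> \<le> exp (k * h) * (1 - h * lam)"
    using hl exp_ge_add_one_self[of "k * h"] by (intro mult_right_mono) auto
  finally show "1 \<le> exp (k * h) * (1 - h * lam)" .
  have "h * k / 2 \<le> h * k" using h k_nonneg by simp
  thus "step (h / 2)" using hk h by (simp add: step_def)
qed

lemma step_expand:
  assumes "step h" "(1 - h * lam) * r \<le> s" "0 \<le> r"
  shows "r \<le> exp (k * h) * s"
proof -
  have "1 * r \<le> exp (k * h) * (1 - h * lam) * r"
    using stepD(3)[OF assms(1)] assms(3) by (rule mult_right_mono)
  also have "\<dots> \<le> exp (k * h) * s" using assms(2) by (simp add: mult.assoc)
  finally show ?thesis by simp
qed

lemma J_graph:
  assumes "step h"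
  shows "(J h f, (1 / h) *\<^sub>R (f - J h f)) \<in> A"
proof -
  have "lam < 1 / h" using stepD[OF assms] by (simp add: field_simps)
  then obtain x y where xy: "(x, y) \<in> A" "y + (1 / h) *\<^sub>R x = (1 / h) *\<^sub>R f" using onto by blast
  from xy(2) have "y = (1 / h) *\<^sub>R (f - x)" by (simp add: algebra_simps)
  with xy(1) have "\<exists>x. (x, (1 / h) *\<^sub>R (f - x)) \<in> A" by blast
  thus ?thesis unfolding J_def by (rule someI_ex)
qed

lemma J_dom: "step h \<Longrightarrow> J h f \<in> D"
  using J_graph by blast

lemma J_eq: "step h \<Longrightarrow> J h f = f - h *\<^sub>R a (J h f)"
  using a_eq[OF J_graph, of h f] stepD(1)[of h] by simp

lemma J_contract:
  assumes h: "step h"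
  shows "(1 - h * lam) * norm (J h f - J h g) \<le> norm (f - g)"
proof -
  let ?d = "J h f - J h g"
  have "(f - g) - ?d = h *\<^sub>R (a (J h f) - a (J h g))"
    using J_eq[OF h, of f] J_eq[OF h, of g] by (metis (no_types, lifting) add_diff_add add_diff_cancel_left' diff_diff_eq2 diff_add_cancel scaleR_diff_right)
  hence "((f - g) - ?d) \<bullet> ?d = h * ((a (J h f) - a (J h g)) \<bullet> ?d)" by simp
  also have "\<dots> \<ge> h * (- lam * (norm ?d)\<^sup>2)"
    using stepD(1)[OF h] by (intro mult_left_mono a_mono J_dom h) auto
  finally have "(1 - h * lam) * (norm ?d)\<^sup>2 \<le> (f - g) \<bullet> ?d"
    by (simp add: inner_diff_left[of "f - g"] power2_norm_eq_inner algebra_simps)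
  also have "\<dots> \<le> norm (f - g) * norm ?d" by (rule norm_cauchy_schwarz)
  finally show ?thesis by (cases "norm ?d = 0") (auto simp: power2_eq_square simp flip: mult.assoc)
qed

lemma J_lipschitz: "step h \<Longrightarrow> norm (J h f - J h g) \<le> exp (k * h) * norm (f - g)"
  by (intro step_expand J_contract norm_ge_zero)

text \<open>One step moves \<open>x\<close> by \<open>- (h *\<^sub>R a (J h x))\<close>, so
  monotonicity between \<open>x\<close> and \<open>J h x\<close>, divided by \<open>h\<close>,
  becomes an inequality between the two values of \<open>a\<close>.\<close>

lemma a_J_inner:
  assumes h: "step h" and x: "x \<in> D"
  shows "(1 - h * lam) * (norm (a (J h x)))\<^sup>2 \<le> a x \<bullet> a (J h x)"
proof -
  let ?y = "a (J h x)"
  have J: "J h x - x = - (h *\<^sub>R ?y)" using J_eq[OF h, of x] by (simp add: algebra_simps)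
  have "h * (- lam * h * (norm ?y)\<^sup>2) \<le> h * (a x \<bullet> ?y - (norm ?y)\<^sup>2)"
    using a_mono[OF J_dom[OF h] x, of x] stepD(1)[OF h] unfolding J
    by (simp add: power_mult_distrib inner_diff dot_square_norm power2_eq_square algebra_simps)
  hence "- lam * h * (norm ?y)\<^sup>2 \<le> a x \<bullet> ?y - (norm ?y)\<^sup>2"
    using stepD(1)[OF h] by (simp only: mult_le_cancel_left_pos)
  thus ?thesis by (simp add: algebra_simps)
qed

lemma a_J_norm:
  assumes h: "step h" and x: "x \<in> D"
  shows "norm (a (J h x)) \<le> exp (k * h) * norm (a x)"
proof (rule step_expand[OF h])
  have "(1 - h * lam) * (norm (a (J h x)))\<^sup>2 \<le> norm (a x) * norm (a (J h x))"
    using a_J_inner[OF h x] norm_cauchy_schwarz order_trans by blast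
  thus "(1 - h * lam) * norm (a (J h x)) \<le> norm (a x)"
    by (cases "norm (a (J h x)) = 0") (auto simp: power2_eq_square simp flip: mult.assoc)
qed simp

text \<open>In this form the norms telescope along the scheme, with an error proportional to
  \<open>h\<close> per step.\<close>

lemma a_J_diff:
  assumes h: "step h" and x: "x \<in> D"
  shows "(norm (a x - a (J h x)))\<^sup>2
    \<le> (norm (a x))\<^sup>2 - (norm (a (J h x)))\<^sup>2 + k * h * (norm (a (J h x)))\<^sup>2"
proof -
  have "2 * lam * (h * (norm (a (J h x)))\<^sup>2) \<le> k * (h * (norm (a (J h x)))\<^sup>2)"
    using stepD(1)[OF h] by (intro mult_right_mono) (auto simp: k_def)
  thus ?thesis using a_J_inner[OF h x] by (simp add: norm_diff_sq algebra_simps)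
qed

text \<open>Two half steps solve the equation of the full step up to the residual
  \<open>(h / 2) *\<^sub>R (a z - a y)\<close>; monotonicity at \<open>J h x\<close> and
  \<open>y\<close> turns this into an error bound without any continuity of
  \<open>a\<close>.\<close>

lemma J_half_twice:
  fixes x :: 'a
  assumes h: "step h"
  defines "z \<equiv> J (h / 2) x"
  defines "y \<equiv> J (h / 2) z"
  shows "norm (J h x - y) \<le> exp (k * h) * (h / 2 * norm (a z - a y))"
proof (rule step_expand[OF h])
  let ?p = "J h x"
  note h2 = stepD(4)[OF h]
  have "y = x - (h / 2) *\<^sub>R a z - (h / 2) *\<^sub>R a y"
    using J_eq[OF h2, of x] J_eq[OF h2, of z] unfolding z_def[symmetric] y_def[symmetric] by simp
  moreover have "h *\<^sub>R a y = (h / 2) *\<^sub>R a y + (h / 2) *\<^sub>R a y" by (simp flip: scaleR_left.add)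
  ultimately have d: "?p - y = (h / 2) *\<^sub>R (a z - a y) - h *\<^sub>R (a ?p - a y)"
    using J_eq[OF h, of x] by (simp add: algebra_simps)
  have "(norm (?p - y))\<^sup>2 = (h / 2) * ((a z - a y) \<bullet> (?p - y)) - h * ((a ?p - a y) \<bullet> (?p - y))"
    unfolding power2_norm_eq_inner by (subst (1) d) (simp add: inner_diff_left)
  also have "\<dots> \<le> (h / 2) * (norm (a z - a y) * norm (?p - y)) - h * (- lam * (norm (?p - y))\<^sup>2)"
    using stepD(1)[OF h] unfolding y_def
    by (intro diff_mono mult_left_mono norm_cauchy_schwarz a_mono J_dom h h2) auto
  finally have "(1 - h * lam) * norm (?p - y) * norm (?p - y) \<le> h / 2 * norm (a z - a y) * norm (?p - y)"
    by (simp add: power2_eq_square algebra_simps)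
  thus "(1 - h * lam) * norm (?p - y) \<le> h / 2 * norm (a z - a y)"
    using stepD(1)[OF h] by (cases "norm (?p - y) = 0") (auto simp: zero_le_mult_iff)
qed simp

section \<open>Iterated steps: stability, displacement and step halving\<close>

definition X :: "real \<Rightarrow> nat \<Rightarrow> 'a \<Rightarrow> 'a" where "X h n = J h ^^ n"

lemma X_0 [simp]: "X h 0 u = u" and X_Suc: "X h (Suc n) u = J h (X h n u)"
  by (simp_all add: X_def)

lemma X_add: "X h (m + n) u = X h m (X h n u)"
  by (simp add: X_def funpow_add)

lemma X_dom: "step h \<Longrightarrow> u \<in> D \<Longrightarrow> X h n u \<in> D"
  by (induction n) (auto simp: X_Suc J_dom)

text \<open>The exact factor is kept beside the cruder bound of \<open>X_lipschitz\<close> because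
  it tends to \<open>exp (lam * t)\<close>, which fixes the type of the limit semigroup.\<close>

lemma X_contract:
  assumes h: "step h"
  shows "norm (X h n u - X h n v) \<le> (1 / (1 - h * lam)) ^ n * norm (u - v)"
proof (induction n)
  case (Suc n)
  have "norm (X h (Suc n) u - X h (Suc n) v) \<le> 1 / (1 - h * lam) * norm (X h n u - X h n v)"
    using J_contract[OF h, of "X h n u" "X h n v"] stepD(2)[OF h] by (simp add: X_Suc field_simps)
  also have "\<dots> \<le> 1 / (1 - h * lam) * ((1 / (1 - h * lam)) ^ n * norm (u - v))"
    using Suc stepD(2)[OF h] by (intro mult_left_mono) auto
  finally show ?case by (simp add: mult.assoc)
qed simp

lemma X_lipschitz:
  assumes h: "step h"
  shows "norm (X h n u - X h n v) \<le> exp (k * (h * n)) * norm (u - v)"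
proof (induction n)
  case (Suc n)
  have "norm (X h (Suc n) u - X h (Suc n) v) \<le> exp (k * h) * norm (X h n u - X h n v)"
    by (simp add: X_Suc J_lipschitz[OF h])
  also have "\<dots> \<le> exp (k * h) * (exp (k * (h * n)) * norm (u - v))"
    using Suc by (intro mult_left_mono) auto
  finally show ?case by (simp add: exp_add algebra_simps)
qed simp

lemma a_X_norm:
  assumes h: "step h" and u: "u \<in> D"
  shows "norm (a (X h n u)) \<le> exp (k * (h * n)) * norm (a u)"
proof (induction n)
  case (Suc n)
  have "norm (a (X h (Suc n) u)) \<le> exp (k * h) * norm (a (X h n u))"
    by (simp add: X_Suc a_J_norm[OF h X_dom[OF h u]])
  also have "\<dots> \<le> exp (k * h) * (exp (k * (h * n)) * norm (a u))"
    using Suc by (intro mult_left_mono) auto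
  finally show ?case by (simp add: exp_add algebra_simps)
qed simp

lemma X_Suc_diff:
  assumes h: "step h" and u: "u \<in> D"
  shows "norm (X h (Suc n) u - X h n u) \<le> h * (exp (k * (h * Suc n)) * norm (a u))"
proof -
  have "X h (Suc n) u - X h n u = - (h *\<^sub>R a (X h (Suc n) u))"
    using J_eq[OF h, of "X h n u"] by (simp add: X_Suc algebra_simps)
  thus ?thesis
    using a_X_norm[OF h u, of "Suc n"] stepD(1)[OF h] by simp
qed

lemma X_displacement:
  assumes h: "step h" and u: "u \<in> D"
  shows "norm (X h n u - u) \<le> h * n * (exp (k * (h * n)) * norm (a u))"
proof (induction n)
  case (Suc n)
  have "norm (X h (Suc n) u - u) \<le> norm (X h (Suc n) u - X h n u) + norm (X h n u - u)"
    using norm_triangle_ineq[of "X h (Suc n) u - X h n u" "X h n u - u"] by simp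
  also have "\<dots> \<le> h * (exp (k * (h * Suc n)) * norm (a u)) + h * n * (exp (k * (h * n)) * norm (a u))"
    using X_Suc_diff[OF h u] Suc by (intro add_mono)
  also have "\<dots> \<le> h * (exp (k * (h * Suc n)) * norm (a u)) + h * n * (exp (k * (h * Suc n)) * norm (a u))"
    using stepD(1)[OF h] k_nonneg by (intro add_left_mono mult_left_mono mult_right_mono) (auto intro!: mult_left_mono)
  finally show ?case by (simp add: algebra_simps)
qed simp

text \<open>
  This is what makes the scheme Cauchy under step refinement although \<open>a\<close> is not continuous.
\<close>

lemma a_X_variation:
  assumes h: "step h" and u: "u \<in> D" and t: "h * n \<le> t"
  shows "(\<Sum>i<n. norm (a (X h i u) - a (X h (Suc i) u)))
    \<le> sqrt n * ((1 + k * t * exp (2 * k * t)) * norm (a u))"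
proof -
  let ?d = "\<lambda>i. norm (a (X h i u) - a (X h (Suc i) u))"
  have hpos: "0 < h" using stepD(1)[OF h] .
  have t0: "0 \<le> t" using t hpos by (meson mult_nonneg_nonneg of_nat_0_le_iff less_imp_le order_trans)
  have telescope: "(\<Sum>i<m. (?d i)\<^sup>2)
      \<le> (norm (a u))\<^sup>2 - (norm (a (X h m u)))\<^sup>2 + (\<Sum>i<m. k * h * (norm (a (X h (Suc i) u)))\<^sup>2)" for m
  proof (induction m)
    case (Suc m)
    have "(?d m)\<^sup>2 \<le> (norm (a (X h m u)))\<^sup>2 - (norm (a (X h (Suc m) u)))\<^sup>2
        + k * h * (norm (a (X h (Suc m) u)))\<^sup>2"
      using a_J_diff[OF h X_dom[OF h u], of m] by (simp add: X_Suc)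
    with Suc show ?case by simp
  qed simp
  have "(\<Sum>i<n. k * h * (norm (a (X h (Suc i) u)))\<^sup>2)
      \<le> of_nat (card {..<n}) * (k * h * (exp (2 * k * t) * (norm (a u))\<^sup>2))"
  proof (rule sum_bounded_above)
    fix i assume "i \<in> {..<n}"
    hence "h * Suc i \<le> h * n" using hpos by (intro mult_left_mono) auto
    hence "k * (h * Suc i) \<le> k * t" using t k_nonneg by (intro mult_left_mono) auto
    hence "norm (a (X h (Suc i) u)) \<le> exp (k * t) * norm (a u)"
      using a_X_norm[OF h u, of "Suc i"] by (meson exp_le_cancel_iff mult_right_mono norm_ge_zero order_trans)
    hence "(norm (a (X h (Suc i) u)))\<^sup>2 \<le> (exp (k * t) * norm (a u))\<^sup>2"
      by (intro power_mono) auto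
    also have "\<dots> = exp (2 * k * t) * (norm (a u))\<^sup>2"
      by (simp add: power_mult_distrib flip: exp_double)
    finally show "k * h * (norm (a (X h (Suc i) u)))\<^sup>2 \<le> k * h * (exp (2 * k * t) * (norm (a u))\<^sup>2)"
      using hpos k_nonneg by (intro mult_left_mono) auto
  qed
  also have "\<dots> = h * n * (k * exp (2 * k * t) * (norm (a u))\<^sup>2)" by (simp add: algebra_simps)
  also have "\<dots> \<le> t * (k * exp (2 * k * t) * (norm (a u))\<^sup>2)"
    using t k_nonneg by (intro mult_right_mono) auto
  finally have bound: "(\<Sum>i<n. k * h * (norm (a (X h (Suc i) u)))\<^sup>2)
      \<le> t * (k * exp (2 * k * t) * (norm (a u))\<^sup>2)" .
  define C where "C = 1 + k * t * exp (2 * k * t)"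
  have C: "1 \<le> C" using k_nonneg t0 by (simp add: C_def)
  have "(\<Sum>i<n. (?d i)\<^sup>2) \<le> (norm (a u))\<^sup>2 + t * (k * exp (2 * k * t) * (norm (a u))\<^sup>2)"
    using telescope[of n] bound zero_le_power2[of "norm (a (X h n u))"] by linarith
  also have "\<dots> = C * (norm (a u))\<^sup>2" by (simp add: C_def algebra_simps)
  \<comment> \<open>\<open>C \<ge> 1\<close> permits passing to its square, which makes the final
    bound a perfect square.\<close>
  also have "\<dots> \<le> C\<^sup>2 * (norm (a u))\<^sup>2"
    using C by (intro mult_right_mono) (auto simp: power2_eq_square)
  finally have "(\<Sum>i<n. (?d i)\<^sup>2) * card {..<n} \<le> C\<^sup>2 * (norm (a u))\<^sup>2 * n"
    by (simp add: mult_right_mono)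
  \<comment> \<open>Cauchy-Schwarz over \<open>n\<close> terms. Only a factor \<open>sqrt n\<close>
    arises, so multiplying by the step leaves an error of order \<open>sqrt h\<close> over a fixed
    time.\<close>
  hence "(\<Sum>i<n. ?d i)\<^sup>2 \<le> C\<^sup>2 * (norm (a u))\<^sup>2 * n"
    using sum_squared_le_sum_of_squares[of ?d "{..<n}"] by linarith
  also have "\<dots> = (sqrt n * (C * norm (a u)))\<^sup>2" by (simp add: power_mult_distrib)
  finally show ?thesis
    unfolding C_def[symmetric] by (rule power2_le_imp_le) (use C in auto)
qed

lemma X_halving:
  assumes h: "step h" and u: "u \<in> D"
  shows "norm (X h n u - X (h / 2) (2 * n) u)
    \<le> exp (k * (h * n)) * (h / 2 * (\<Sum>i<2 * n. norm (a (X (h / 2) i u) - a (X (h / 2) (Suc i) u))))"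
proof (induction n)
  case (Suc n)
  let ?d = "\<lambda>i. norm (a (X (h / 2) i u) - a (X (h / 2) (Suc i) u))"
  let ?x = "X (h / 2) (2 * n) u"
  have hpos: "0 < h" using stepD(1)[OF h] .
  have "norm (X h (Suc n) u - X (h / 2) (2 * Suc n) u)
      \<le> norm (J h (X h n u) - J h ?x) + norm (J h ?x - J (h / 2) (J (h / 2) ?x))"
    using norm_triangle_ineq[of "J h (X h n u) - J h ?x" "J h ?x - J (h / 2) (J (h / 2) ?x)"]
    by (simp add: X_Suc)
  also have "\<dots> \<le> exp (k * h) * (exp (k * (h * n)) * (h / 2 * (\<Sum>i<2 * n. ?d i)))
      + exp (k * h) * (h / 2 * ?d (Suc (2 * n)))"
  proof (rule add_mono)
    show "norm (J h (X h n u) - J h ?x) \<le> exp (k * h) * (exp (k * (h * n)) * (h / 2 * (\<Sum>i<2 * n. ?d i)))"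
      by (rule order_trans[OF J_lipschitz[OF h] mult_left_mono[OF Suc]]) simp
    show "norm (J h ?x - J (h / 2) (J (h / 2) ?x)) \<le> exp (k * h) * (h / 2 * ?d (Suc (2 * n)))"
      using J_half_twice[OF h, of ?x] by (simp add: X_Suc)
  qed
  also have "\<dots> \<le> exp (k * h) * (exp (k * (h * n)) * (h / 2 * (\<Sum>i<2 * n. ?d i)))
      + exp (k * h) * (exp (k * (h * n)) * (h / 2 * ?d (Suc (2 * n))))"
  proof (intro add_left_mono mult_left_mono)
    have "1 \<le> exp (k * (h * n))" using hpos k_nonneg by simp
    from mult_right_mono[OF this, of "h / 2 * ?d (Suc (2 * n))"]
    show "h / 2 * ?d (Suc (2 * n)) \<le> exp (k * (h * n)) * (h / 2 * ?d (Suc (2 * n)))" using hpos by simp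
  qed simp
  also have "\<dots> = exp (k * (h * Suc n)) * (h / 2 * ((\<Sum>i<2 * n. ?d i) + ?d (Suc (2 * n))))"
    by (simp add: exp_add algebra_simps)
  \<comment> \<open>\<open>J_half_twice\<close> produces only the second increment of each pair of
    half steps; the first is added to complete the sum.\<close>
  also have "\<dots> \<le> exp (k * (h * Suc n)) * (h / 2 * (\<Sum>i<2 * Suc n. ?d i))"
    using hpos by (intro mult_left_mono) auto
  finally show ?case .
qed simp

section \<open>Dyadic time grids\<close>

definition hs :: "nat \<Rightarrow> real" where "hs j = (1 / 2) ^ j / (k + 1)"

definition N :: "nat \<Rightarrow> real \<Rightarrow> nat" where "N j t = nat \<lfloor>t / hs j\<rfloor>"

lemma hs_Suc: "hs (Suc j) = hs j / 2"
  by (simp add: hs_def)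

lemma hs_bounds: "0 < hs j" "hs j \<le> (1 / 2) ^ j" "hs j \<le> 1"
proof -
  show "0 < hs j" using k_nonneg by (simp add: hs_def)
  have "hs j \<le> (1 / 2) ^ j / 1" unfolding hs_def using k_nonneg by (intro divide_left_mono) auto
  thus "hs j \<le> (1 / 2) ^ j" by simp
  also have "\<dots> \<le> 1" by (simp add: power_le_one)
  finally show "hs j \<le> 1" .
qed

text \<open>The divisor \<open>k + 1\<close> in \<open>hs\<close> makes every step admissible from
  the coarsest on, also when \<open>k\<close> is zero.\<close>

lemma hs_step: "step (hs j)"
proof -
  have "hs j * k \<le> (1 / (k + 1)) * k"
    unfolding hs_def using k_nonneg by (intro mult_right_mono divide_right_mono power_le_one) auto
  also have "\<dots> \<le> 1" using k_nonneg by (simp add: field_simps)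
  finally show ?thesis using hs_bounds(1) by (simp add: step_def)
qed

lemma hs_tendsto: "hs \<longlonglongrightarrow> 0"
  by (rule tendsto_sandwich[of "\<lambda>_. 0" _ _ "\<lambda>j. (1 / 2) ^ j"])
     (auto intro!: always_eventually less_imp_le hs_bounds LIMSEQ_power_zero)

lemma N_bounds:
  assumes "0 \<le> t"
  shows "hs j * N j t \<le> t" "t < hs j * N j t + hs j"
proof -
  have N: "real (N j t) = of_int \<lfloor>t / hs j\<rfloor>"
    using assms hs_bounds(1)[of j] by (simp add: N_def)
  have "real (N j t) \<le> t / hs j" "t / hs j < real (N j t) + 1" unfolding N by linarith+
  thus "hs j * N j t \<le> t" "t < hs j * N j t + hs j"
    using hs_bounds(1)[of j] by (simp_all add: field_simps)
qed

text \<open>Rounding down commutes with halving the grid and with adding times only up to one step.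
  Both uses pay for that extra step with \<open>X_Suc_diff\<close>.\<close>

lemma N_unique_upto:
  assumes "hs j * m \<le> t" "t < hs j * m + 2 * hs j"
  shows "N j t = m \<or> N j t = Suc m"
proof -
  have "0 \<le> t" using assms(1) hs_bounds(1)[of j] by (meson mult_nonneg_nonneg of_nat_0_le_iff less_imp_le order_trans)
  have "hs j * m < hs j * (N j t + 1)" "hs j * N j t < hs j * (m + 2)"
    using assms N_bounds[OF \<open>0 \<le> t\<close>, of j] by (simp_all add: algebra_simps)
  hence "real m < N j t + 1" "real (N j t) < m + 2"
    using hs_bounds(1)[of j] by (simp_all only: mult_less_cancel_left_pos)
  thus ?thesis by linarith
qed

lemma hs_N_tendsto:
  assumes "0 \<le> t"
  shows "(\<lambda>j. hs j * N j t) \<longlonglongrightarrow> t"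
proof (rule tendsto_sandwich[of "\<lambda>j. t - hs j" _ _ "\<lambda>_. t"])
  show "(\<lambda>j. t - hs j) \<longlonglongrightarrow> t" using tendsto_diff[OF tendsto_const hs_tendsto, of t] by simp
qed (use N_bounds[OF assms] in \<open>auto intro!: always_eventually less_imp_le simp: algebra_simps\<close>)

definition Y :: "nat \<Rightarrow> real \<Rightarrow> 'a \<Rightarrow> 'a" where "Y j t = X (hs j) (N j t)"

lemma exp_N_le: "0 \<le> t \<Longrightarrow> exp (k * (hs j * N j t)) \<le> exp (k * t)"
  using N_bounds(1)[of t j] k_nonneg by (simp add: mult_left_mono)

lemma Y_lipschitz:
  assumes "0 \<le> t"
  shows "norm (Y j t u - Y j t v) \<le> exp (k * t) * norm (u - v)"
  unfolding Y_def using X_lipschitz[OF hs_step] exp_N_le[OF assms]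
  by (meson mult_right_mono norm_ge_zero order_trans)

text \<open>The possible extra half step costs \<open>O(h)\<close>, which is within
  \<open>O(sqrt h)\<close> because \<open>h \<le> 1\<close>. The halving error is
  \<open>h / 2 * sqrt (2 * n)\<close> times constants, and \<open>h * n \<le> t\<close> turns it
  into \<open>sqrt t * sqrt h\<close>. Along dyadic steps both decay geometrically with ratio
  \<open>sqrt (1 / 2)\<close>.\<close>

lemma Y_increment:
  assumes u: "u \<in> D" and t: "0 \<le> t"
  shows "norm (Y (Suc j) t u - Y j t u)
    \<le> exp (k * t) * norm (a u) * (1 + sqrt t * (1 + k * t * exp (2 * k * t))) * sqrt (1 / 2) ^ j"
proof -
  define h where "h = hs j"
  define n where "n = N j t"
  define C where "C = 1 + k * t * exp (2 * k * t)"
  have h: "step h" "step (h / 2)" "0 < h" "h \<le> 1"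
    using hs_step[of j] stepD(4) hs_bounds[of j] by (auto simp: h_def)
  have C: "0 \<le> C" using k_nonneg t by (simp add: C_def)
  have hn: "h * n \<le> t" "t < h * n + h" using N_bounds[OF t, of j] by (auto simp: h_def n_def)
  have ekt: "exp (k * (h * n)) \<le> exp (k * t)" using exp_N_le[OF t] by (simp add: h_def n_def)
  have "N (Suc j) t = 2 * n \<or> N (Suc j) t = Suc (2 * n)"
    using hn by (intro N_unique_upto) (auto simp: hs_Suc h_def)
  hence "norm (Y (Suc j) t u - X (h / 2) (2 * n) u) \<le> exp (k * t) * norm (a u) * sqrt h"
  proof
    assume "N (Suc j) t = 2 * n"
    thus ?thesis using h by (simp add: Y_def hs_Suc h_def)
  next
    assume N: "N (Suc j) t = Suc (2 * n)"
    have "norm (Y (Suc j) t u - X (h / 2) (2 * n) u)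
        \<le> h / 2 * (exp (k * (h / 2 * Suc (2 * n))) * norm (a u))"
      using X_Suc_diff[OF h(2) u, of "2 * n"] N by (simp add: Y_def hs_Suc h_def)
    also have "\<dots> \<le> h / 2 * (exp (k * t) * norm (a u))"
      using exp_N_le[OF t, of "Suc j"] h(3) unfolding N
      by (intro mult_left_mono mult_right_mono) (simp_all add: hs_Suc h_def)
    also have "\<dots> \<le> sqrt h * (exp (k * t) * norm (a u))"
    proof (rule mult_right_mono)
      have "h * h \<le> h * 1" using h by (intro mult_left_mono) auto
      hence "h \<le> sqrt h" by (intro real_le_rsqrt) (simp add: power2_eq_square)
      thus "h / 2 \<le> sqrt h" using h by linarith
    qed simp
    finally show ?thesis using h by (simp add: mult_ac)
  qed
  moreover have "norm (X (h / 2) (2 * n) u - Y j t u) \<le> exp (k * t) * norm (a u) * (sqrt t * C * sqrt h)"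
  proof -
    have var: "(\<Sum>i<2 * n. norm (a (X (h / 2) i u) - a (X (h / 2) (Suc i) u)))
        \<le> sqrt (2 * n) * (C * norm (a u))"
      unfolding C_def using a_X_variation[OF h(2) u, of "2 * n" t] hn by simp
    have "norm (X (h / 2) (2 * n) u - Y j t u) \<le> exp (k * (h * n)) *
        (h / 2 * (\<Sum>i<2 * n. norm (a (X (h / 2) i u) - a (X (h / 2) (Suc i) u))))"
      using X_halving[OF h(1) u, of n] by (simp add: Y_def h_def n_def norm_minus_commute)
    also have "\<dots> \<le> exp (k * t) * (h / 2 * (sqrt (2 * n) * (C * norm (a u))))"
      using var ekt h by (intro mult_mono mult_left_mono mult_nonneg_nonneg sum_nonneg) auto
    also have "h / 2 * (sqrt (2 * n) * (C * norm (a u))) = (h / 2 * sqrt (2 * n)) * (C * norm (a u))"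
      by simp
    also have "\<dots> \<le> (sqrt t * sqrt h) * (C * norm (a u))"
    proof (intro mult_right_mono mult_nonneg_nonneg C)
      have "(h / 2 * sqrt (2 * n))\<^sup>2 = h * (h * n) / 2"
        by (simp add: power_mult_distrib power2_eq_square)
      also have "\<dots> \<le> h * t" using hn h t mult_left_mono[OF hn(1), of h] mult_nonneg_nonneg[of h t] by linarith
      also have "\<dots> = (sqrt t * sqrt h)\<^sup>2" using h t by (simp add: power_mult_distrib)
      finally show "h / 2 * sqrt (2 * n) \<le> sqrt t * sqrt h"
        by (rule power2_le_imp_le) (use h t in auto)
    qed auto
    finally show ?thesis by (simp add: mult_ac)
  qed
  ultimately have "norm (Y (Suc j) t u - Y j t u)
      \<le> exp (k * t) * norm (a u) * sqrt h + exp (k * t) * norm (a u) * (sqrt t * C * sqrt h)"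
    using norm_triangle_ineq[of "Y (Suc j) t u - X (h / 2) (2 * n) u" "X (h / 2) (2 * n) u - Y j t u"]
    by simp
  also have "\<dots> = exp (k * t) * norm (a u) * (1 + sqrt t * C) * sqrt h" by (simp add: algebra_simps)
  also have "\<dots> \<le> exp (k * t) * norm (a u) * (1 + sqrt t * C) * sqrt (1 / 2) ^ j"
  proof (intro mult_left_mono mult_nonneg_nonneg add_nonneg_nonneg C)
    have "sqrt h \<le> sqrt ((1 / 2) ^ j)" using hs_bounds(2)[of j] by (simp add: h_def)
    thus "sqrt h \<le> sqrt (1 / 2) ^ j" by (simp add: real_sqrt_power)
  qed (use t in auto)
  finally show ?thesis by (simp add: C_def)
qed

end

section \<open>The semigroup and its generator\<close>

text \<open>The logarithm of the factor is \<open>h j * N j\<close> times the difference quotient at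
  zero of \<open>x \<mapsto> - ln (1 - x * lam)\<close>, whose derivative there is
  \<open>lam\<close>.\<close>

lemma implicit_Euler_factor_tendsto:
  fixes h :: "nat \<Rightarrow> real" and N :: "nat \<Rightarrow> nat"
  assumes h: "h \<longlonglongrightarrow> 0" and hpos: "\<And>j. 0 < h j" and hN: "(\<lambda>j. h j * N j) \<longlonglongrightarrow> t"
  shows "(\<lambda>j. (1 / (1 - h j * lam)) ^ N j) \<longlonglongrightarrow> exp (lam * t)"
proof -
  have "((\<lambda>x. - ln (1 - x * lam) / x) \<longlongrightarrow> lam) (at 0)"
  proof -
    have "((\<lambda>x. - ln (1 - x * lam)) has_real_derivative lam) (at 0)"
      by (auto intro!: derivative_eq_intros)
    thus ?thesis by (simp add: has_field_derivative_iff)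
  qed
  moreover have "filterlim h (at 0) sequentially"
    using h hpos by (auto simp: filterlim_at less_imp_neq[symmetric])
  ultimately have "(\<lambda>j. - ln (1 - h j * lam) / h j) \<longlonglongrightarrow> lam"
    by (rule filterlim_compose)
  hence "(\<lambda>j. exp ((- ln (1 - h j * lam) / h j) * (h j * N j))) \<longlonglongrightarrow> exp (lam * t)"
    by (intro tendsto_intros hN)
  moreover have "\<forall>\<^sub>F j in sequentially.
      exp ((- ln (1 - h j * lam) / h j) * (h j * N j)) = (1 / (1 - h j * lam)) ^ N j"
  proof -
    have "(\<lambda>j. 1 - h j * lam) \<longlonglongrightarrow> 1 - 0 * lam" by (intro tendsto_intros h)
    hence "\<forall>\<^sub>F j in sequentially. 0 < 1 - h j * lam" by (rule order_tendstoD(1)) simp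
    thus ?thesis
    proof eventually_elim
      case (elim j)
      have "exp ((- ln (1 - h j * lam) / h j) * (h j * N j)) = exp (real (N j) * (- ln (1 - h j * lam)))"
        using hpos[of j] by (simp add: field_simps)
      also have "\<dots> = (1 / (1 - h j * lam)) ^ N j"
        using elim by (simp add: exp_of_nat_mult exp_minus inverse_eq_divide power_one_over)
      finally show ?case .
    qed
  qed
  ultimately show ?thesis by (rule Lim_transform_eventually)
qed

locale dense_quasi_maximal_monotone = quasi_maximal_monotone +
  assumes dense: "closure D = UNIV"
begin

lemma approx_in_D:
  assumes "0 < e"
  obtains v where "v \<in> D" "norm (u - v) < e"
  using dense assms closure_approachable[of u D] by (metis UNIV_I dist_commute dist_norm)

lemma eq_of_eq_on_D:
  fixes f g :: "'a \<Rightarrow> 'a"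
  assumes "continuous_on UNIV f" "continuous_on UNIV g" "\<And>u. u \<in> D \<Longrightarrow> f u = g u"
  shows "f u = g u"
proof -
  have "closure D \<subseteq> {u. f u = g u}"
    by (intro closure_minimal closed_Collect_eq) (use assms in auto)
  thus ?thesis using dense by auto
qed

text \<open>\<open>Y_increment\<close> needs a starting point in \<open>D\<close>; the Lipschitz
  constants are uniform in \<open>j\<close>, so density carries the convergence to the whole
  space.\<close>

lemma Y_Cauchy:
  assumes t: "0 \<le> t"
  shows "Cauchy (\<lambda>j. Y j t u)"
proof (rule metric_CauchyI)
  fix e :: real assume e: "0 < e"
  obtain v where v: "v \<in> D" "norm (u - v) < e / (3 * exp (k * t))"
    using approx_in_D[of "e / (3 * exp (k * t))"] e by auto
  have "norm (Y j t u - Y j t v) < e / 3" for j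
    using Y_lipschitz[OF t, of j u v] v(2) by (simp add: field_simps)
  hence uv: "dist (Y j t u) (Y j t v) < e / 3" for j by (simp add: dist_norm)
  have "Cauchy (\<lambda>j. Y j t v)"
    using Y_increment[OF v(1) t] by (rule geometric_increments_Cauchy) (auto simp: real_sqrt_lt_1_iff)
  then obtain M where M: "\<And>i j. i \<ge> M \<Longrightarrow> j \<ge> M \<Longrightarrow> dist (Y i t v) (Y j t v) < e / 3"
    using metric_CauchyD[of _ "e / 3"] e by (metis divide_pos_pos zero_less_numeral)
  have "dist (Y i t u) (Y j t u) < e" if "i \<ge> M" "j \<ge> M" for i j
  proof -
    have "dist (Y i t u) (Y j t u)
        \<le> dist (Y i t u) (Y i t v) + dist (Y i t v) (Y j t v) + dist (Y j t v) (Y j t u)"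
      by (metis (no_types, opaque_lifting) add_right_mono dist_triangle order_trans)
    thus ?thesis using uv[of i] uv[of j] M[OF that] by (simp add: dist_commute)
  qed
  thus "\<exists>M. \<forall>m\<ge>M. \<forall>n\<ge>M. dist (Y m t u) (Y n t u) < e" by blast
qed

section \<open>The limit semigroup\<close>

definition T :: "real \<Rightarrow> 'a \<Rightarrow> 'a" where "T t u = lim (\<lambda>j. Y j t u)"

lemma T_limit: "0 \<le> t \<Longrightarrow> (\<lambda>j. Y j t u) \<longlonglongrightarrow> T t u"
  unfolding T_def using Y_Cauchy Cauchy_convergent convergent_LIMSEQ_iff by blast

lemma T_0: "T 0 u = u"
proof -
  have "(\<lambda>j. Y j 0 u) = (\<lambda>j. u)" by (simp add: Y_def N_def)
  thus ?thesis using T_limit[of 0 u] by (simp add: LIMSEQ_const_iff)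
qed

lemma T_lipschitz:
  assumes t: "0 \<le> t"
  shows "norm (T t u - T t v) \<le> exp (lam * t) * norm (u - v)"
proof (rule LIMSEQ_le)
  show "(\<lambda>j. norm (Y j t u - Y j t v)) \<longlonglongrightarrow> norm (T t u - T t v)"
    by (intro tendsto_intros T_limit t)
  show "(\<lambda>j. (1 / (1 - hs j * lam)) ^ N j t * norm (u - v)) \<longlonglongrightarrow> exp (lam * t) * norm (u - v)"
    by (intro tendsto_intros implicit_Euler_factor_tendsto hs_tendsto hs_bounds hs_N_tendsto t)
  show "\<exists>M. \<forall>j\<ge>M. norm (Y j t u - Y j t v) \<le> (1 / (1 - hs j * lam)) ^ N j t * norm (u - v)"
    unfolding Y_def using X_contract[OF hs_step] by blast
qed

lemma T_continuous_on: "0 \<le> t \<Longrightarrow> continuous_on UNIV (T t)"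
  by (rule lipschitz_on_continuous_on[of "exp (lam * t)"])
     (auto intro!: lipschitz_onI simp: dist_norm T_lipschitz)

text \<open>On \<open>D\<close> the step counts for \<open>t + s\<close> and for \<open>t\<close>
  after \<open>s\<close> differ by at most one step, whose length tends to zero; continuity extends
  the identity to the closure.\<close>

lemma T_add:
  assumes s: "0 \<le> s" and t: "0 \<le> t"
  shows "T t (T s u) = T (t + s) u"
proof (rule eq_of_eq_on_D[of "\<lambda>u. T t (T s u)" "T (t + s)" u])
  show "continuous_on UNIV (\<lambda>u. T t (T s u))"
    using continuous_on_compose[OF T_continuous_on[OF s] continuous_on_subset[OF T_continuous_on[OF t] subset_UNIV]]
    by (simp add: o_def)
  show "continuous_on UNIV (T (t + s))" using s t by (intro T_continuous_on) auto
  fix u assume u: "u \<in> D"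
  have ts: "0 \<le> t + s" using s t by simp
  let ?C = "exp (k * (t + s)) * norm (a u)"
  have "norm (Y j (t + s) u - Y j t (Y j s u)) \<le> hs j * ?C" for j
  proof -
    have comp: "Y j t (Y j s u) = X (hs j) (N j t + N j s) u" by (simp add: Y_def X_add)
    have "N j (t + s) = N j t + N j s \<or> N j (t + s) = Suc (N j t + N j s)"
      using N_bounds[OF s, of j] N_bounds[OF t, of j] by (intro N_unique_upto) (simp_all add: distrib_left)
    thus ?thesis
    proof
      assume "N j (t + s) = N j t + N j s"
      thus ?thesis using hs_bounds(1)[of j] by (simp add: comp) (simp add: Y_def)
    next
      assume N: "N j (t + s) = Suc (N j t + N j s)"
      have "norm (Y j (t + s) u - Y j t (Y j s u))
          \<le> hs j * (exp (k * (hs j * N j (t + s))) * norm (a u))"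
        unfolding comp unfolding Y_def N by (rule X_Suc_diff[OF hs_step u])
      also have "\<dots> \<le> hs j * ?C"
        using exp_N_le[OF ts] hs_bounds(1)[of j] by (intro mult_left_mono mult_right_mono) auto
      finally show ?thesis .
    qed
  qed
  hence "(\<lambda>j. Y j (t + s) u - Y j t (Y j s u)) \<longlonglongrightarrow> 0"
    by (intro Lim_null_comparison[OF always_eventually[OF allI] tendsto_mult_left_zero[OF hs_tendsto]])
  \<comment> \<open>The Lipschitz bound uniform in \<open>j\<close> lets the starting point pass to
    its limit while the outer scheme varies with the same \<open>j\<close>.\<close>
  moreover have "(\<lambda>j. Y j t (Y j s u) - Y j t (T s u)) \<longlonglongrightarrow> 0"
  proof (rule Lim_null_comparison[OF always_eventually[OF allI]])
    show "norm (Y j t (Y j s u) - Y j t (T s u)) \<le> exp (k * t) * norm (Y j s u - T s u)" for j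
      by (rule Y_lipschitz[OF t])
    show "(\<lambda>j. exp (k * t) * norm (Y j s u - T s u)) \<longlonglongrightarrow> 0"
      using T_limit[OF s, of u] by (intro tendsto_mult_right_zero tendsto_norm_zero LIM_zero)
  qed
  ultimately have "(\<lambda>j. (Y j (t + s) u - Y j t (Y j s u)) + (Y j t (Y j s u) - Y j t (T s u))) \<longlonglongrightarrow> 0 + 0"
    by (rule tendsto_add)
  hence "(\<lambda>j. Y j (t + s) u - Y j t (T s u)) \<longlonglongrightarrow> 0" by simp
  moreover have "(\<lambda>j. Y j (t + s) u - Y j t (T s u)) \<longlonglongrightarrow> T (t + s) u - T t (T s u)"
    by (intro tendsto_intros T_limit ts t)
  ultimately show "T t (T s u) = T (t + s) u" using LIMSEQ_unique by fastforce
qed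

section \<open>Behaviour at time zero\<close>

lemma T_displacement:
  assumes u: "u \<in> D" and t: "0 \<le> t"
  shows "norm (T t u - u) \<le> t * (exp (k * t) * norm (a u))"
proof (rule LIMSEQ_le)
  show "(\<lambda>j. norm (Y j t u - u)) \<longlonglongrightarrow> norm (T t u - u)" by (intro tendsto_intros T_limit t)
  show "(\<lambda>j. hs j * N j t * (exp (k * (hs j * N j t)) * norm (a u))) \<longlonglongrightarrow> t * (exp (k * t) * norm (a u))"
    by (intro tendsto_intros hs_N_tendsto t)
  show "\<exists>M. \<forall>j\<ge>M. norm (Y j t u - u) \<le> hs j * N j t * (exp (k * (hs j * N j t)) * norm (a u))"
    unfolding Y_def using X_displacement[OF hs_step u] by blast
qed

lemma T_right_continuous:
  shows "((\<lambda>t. norm (T t u - u)) \<longlongrightarrow> 0) (at_right 0)"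
proof (rule tendstoI)
  fix e :: real assume e: "0 < e"
  define E where "E = exp \<bar>lam\<bar>"
  have E: "1 \<le> E" by (simp add: E_def)
  obtain v where v: "v \<in> D" "norm (u - v) < e / (2 * (E + 1))"
    using approx_in_D[of "e / (2 * (E + 1))"] e E by auto
  have "((\<lambda>t. t * (exp (k * t) * norm (a v))) \<longlongrightarrow> 0 * (exp (k * 0) * norm (a v))) (at_right 0)"
    by (intro tendsto_intros)
  hence "\<forall>\<^sub>F t in at_right 0. t * (exp (k * t) * norm (a v)) < e / 2"
    using order_tendstoD(2)[of _ 0 _ "e / 2"] e by simp
  moreover have "\<forall>\<^sub>F t in at_right (0::real). t \<in> {0<..<1}" by (rule eventually_at_right_real) simp
  ultimately show "\<forall>\<^sub>F t in at_right 0. dist (norm (T t u - u)) 0 < e"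
  proof eventually_elim
    case (elim t)
    hence t: "0 \<le> t" "t \<le> 1" by auto
    have "lam * t \<le> \<bar>lam\<bar> * 1" using t by (intro mult_mono) auto
    hence "exp (lam * t) * norm (u - v) \<le> E * norm (u - v)"
      by (intro mult_right_mono) (auto simp: E_def)
    hence "norm (T t u - T t v) \<le> E * norm (u - v)" using T_lipschitz[OF t(1), of u v] by linarith
    moreover have "norm (T t v - v) < e / 2" using T_displacement[OF v(1) t(1)] elim by linarith
    moreover have "norm (T t u - u) \<le> norm (T t u - T t v) + norm (T t v - v) + norm (v - u)"
      using norm_triangle_ineq[of "T t u - T t v" "T t v - u"] norm_triangle_ineq[of "T t v - v" "v - u"]
      by simp
    moreover have "(E + 1) * norm (u - v) < e / 2" using v(2) E by (simp add: field_simps)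
    ultimately show ?case by (simp add: norm_minus_commute algebra_simps)
  qed
qed

text \<open>A first-order form of the inequality for integral solutions: expand the squared distance
  to \<open>v\<close> over one step, drop the square of the increment, and apply monotonicity at the
  new point and \<open>v\<close>. The term \<open>C * t\<close> pays for replacing the moving point
  by \<open>u\<close>.\<close>

lemma T_inequality:
  assumes u: "u \<in> D" and v: "v \<in> D"
  obtains C where "\<And>t. 0 \<le> t \<Longrightarrow> t \<le> 1 \<Longrightarrow>
    (norm (T t u - v))\<^sup>2 - (norm (u - v))\<^sup>2
      \<le> 2 * t * (a v \<bullet> (v - u) + lam * (norm (u - v))\<^sup>2 + C * t)"
proof -
  \<comment> \<open>\<open>E\<close> bounds the displacement per unit time up to time 1;
    \<open>C\<close> collects the resulting errors in the inner product and in the squared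
    norm.\<close>
  define E where "E = exp k * norm (a u)"
  define C where "C = norm (a v) * E + \<bar>lam\<bar> * (E\<^sup>2 + 2 * E * norm (u - v))"
  have E: "0 \<le> E" by (simp add: E_def)
  have "(norm (T t u - v))\<^sup>2 - (norm (u - v))\<^sup>2
      \<le> 2 * t * (a v \<bullet> (v - u) + lam * (norm (u - v))\<^sup>2 + C * t)" if t: "0 \<le> t" "t \<le> 1" for t
  proof -
    define B where "B = a v \<bullet> (v - u) + lam * (norm (u - v))\<^sup>2 + C * t"
    have discrete: "(norm (X h n u - v))\<^sup>2 - (norm (u - v))\<^sup>2 \<le> 2 * (h * n) * B"
      if h: "step h" and n: "h * n \<le> t" for h n
      using n
    proof (induction n)
      case (Suc n)
      have hpos: "0 < h" using stepD(1)[OF h] .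
      let ?x = "X h (Suc n) u"
      have "norm (?x - u) \<le> h * Suc n * (exp (k * (h * Suc n)) * norm (a u))"
        by (rule X_displacement[OF h u])
      also have "\<dots> \<le> t * (exp (k * 1) * norm (a u))"
        using Suc.prems t k_nonneg mult_left_mono[of "h * Suc n" 1 k] by (intro mult_mono) auto
      finally have disp: "norm (?x - u) \<le> t * E" by (simp add: E_def)
      have Xv: "X h n u - v = (?x - v) + h *\<^sub>R a ?x"
        using J_eq[OF h, of "X h n u"] by (simp add: X_Suc algebra_simps)
      have "(norm (X h n u - v))\<^sup>2 = (norm (?x - v))\<^sup>2 + 2 * h * (a ?x \<bullet> (?x - v)) + (h * norm (a ?x))\<^sup>2"
        unfolding Xv norm_add_sq by (simp add: inner_commute power_mult_distrib)
      hence "(norm (?x - v))\<^sup>2 \<le> (norm (X h n u - v))\<^sup>2 - 2 * h * (a ?x \<bullet> (?x - v))" by simp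
      moreover have "2 * h * (a v \<bullet> (?x - v) - lam * (norm (?x - v))\<^sup>2) \<le> 2 * h * (a ?x \<bullet> (?x - v))"
        using a_mono[OF X_dom[OF h u, of "Suc n"] v] hpos
        by (intro mult_left_mono) (auto simp: inner_diff_left)
      moreover have "2 * h * (a v \<bullet> (v - ?x) + lam * (norm (?x - v))\<^sup>2) \<le> 2 * h * B"
      proof (intro mult_left_mono)
        have "a v \<bullet> (v - ?x) = a v \<bullet> (v - u) + a v \<bullet> (u - ?x)" by (simp add: inner_diff_right)
        moreover have "a v \<bullet> (u - ?x) \<le> norm (a v) * (t * E)"
          using norm_cauchy_schwarz[of "a v" "u - ?x"] mult_left_mono[OF disp norm_ge_zero[of "a v"]]
          unfolding norm_minus_commute[of ?x u] by linarith
        ultimately have 1: "a v \<bullet> (v - ?x) \<le> a v \<bullet> (v - u) + norm (a v) * E * t" by (simp add: mult_ac)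
        have "(norm (?x - v))\<^sup>2 - (norm (u - v))\<^sup>2 = (norm (?x - u))\<^sup>2 + 2 * ((?x - u) \<bullet> (u - v))"
          using norm_add_sq[of "?x - u" "u - v"] by simp
        hence "\<bar>(norm (?x - v))\<^sup>2 - (norm (u - v))\<^sup>2\<bar> \<le> (norm (?x - u))\<^sup>2 + 2 * (norm (?x - u) * norm (u - v))"
          using Cauchy_Schwarz_ineq2[of "?x - u" "u - v"] zero_le_power2[of "norm (?x - u)"] by linarith
        also have "\<dots> \<le> (t * E)\<^sup>2 + 2 * (t * E * norm (u - v))"
          using disp by (intro add_mono power_mono mult_left_mono mult_right_mono) auto
        also have "\<dots> \<le> (E\<^sup>2 + 2 * E * norm (u - v)) * t"
        proof -
          have "t * t * E\<^sup>2 \<le> t * 1 * E\<^sup>2" using t by (intro mult_right_mono mult_left_mono) auto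
          thus ?thesis by (simp add: power_mult_distrib power2_eq_square algebra_simps)
        qed
        finally have "\<bar>lam\<bar> * \<bar>(norm (?x - v))\<^sup>2 - (norm (u - v))\<^sup>2\<bar>
            \<le> \<bar>lam\<bar> * ((E\<^sup>2 + 2 * E * norm (u - v)) * t)" by (intro mult_left_mono) auto
        hence "lam * ((norm (?x - v))\<^sup>2 - (norm (u - v))\<^sup>2) \<le> \<bar>lam\<bar> * (E\<^sup>2 + 2 * E * norm (u - v)) * t"
          by (simp flip: abs_mult mult.assoc)
        with 1 show "a v \<bullet> (v - ?x) + lam * (norm (?x - v))\<^sup>2 \<le> B"
          by (simp add: B_def C_def algebra_simps)
      qed (use hpos in simp)
      moreover have "h * n \<le> t" using Suc.prems hpos by (simp add: distrib_left)
      note Suc.IH[OF this]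
      ultimately show ?case by (simp add: inner_diff_right algebra_simps)
    qed simp
    have "(\<lambda>j. (norm (Y j t u - v))\<^sup>2 - (norm (u - v))\<^sup>2) \<longlonglongrightarrow> (norm (T t u - v))\<^sup>2 - (norm (u - v))\<^sup>2"
      by (intro tendsto_intros T_limit t)
    moreover have "(\<lambda>j. 2 * (hs j * N j t) * B) \<longlonglongrightarrow> 2 * t * B"
      by (intro tendsto_intros hs_N_tendsto t)
    moreover have "\<forall>j. (norm (Y j t u - v))\<^sup>2 - (norm (u - v))\<^sup>2 \<le> 2 * (hs j * N j t) * B"
      unfolding Y_def using discrete[OF hs_step N_bounds(1)[OF t(1)]] by blast
    ultimately show ?thesis unfolding B_def[symmetric] by (intro LIMSEQ_le) auto
  qed
  thus ?thesis using that by blast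
qed

text \<open>
  The Yosida approximations \<open>y\<close> of \<open>x \<mapsto> a x + lam (x - u)\<close> at \<open>u\<close>: this operator is monotone and
  has the value \<open>a u\<close> at \<open>u\<close>.
\<close>

lemma Yosida_approximation:
  assumes u: "u \<in> D"
  obtains e :: "nat \<Rightarrow> real" and y :: "nat \<Rightarrow> 'a"
  where "\<And>n. 0 < e n" "\<And>n. (u - e n *\<^sub>R y n, (1 + lam * e n) *\<^sub>R y n) \<in> A" "y \<longlonglongrightarrow> a u"
proof -
  define e where "e n = inverse (real (Suc n))" for n
  have e: "0 < e n" for n by (simp add: e_def)
  have e0: "e \<longlonglongrightarrow> 0" unfolding e_def by (rule LIMSEQ_inverse_real_of_nat)
  have "\<exists>y. (u - e n *\<^sub>R y, (1 + lam * e n) *\<^sub>R y) \<in> A" for n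
  proof -
    have "lam < lam + 1 / e n" using e[of n] by simp
    then obtain v w where vw: "(v, w) \<in> A" "w + (lam + 1 / e n) *\<^sub>R v = (lam + 1 / e n) *\<^sub>R u"
      using onto by blast
    define y where "y = (1 / e n) *\<^sub>R (u - v)"
    have "w = (lam + 1 / e n) *\<^sub>R (u - v)" using vw(2) by (simp add: algebra_simps)
    also have "\<dots> = (1 + lam * e n) *\<^sub>R y" using e[of n] by (simp add: y_def field_simps)
    finally show ?thesis using vw(1) e[of n] by (intro exI[of _ y]) (simp add: y_def)
  qed
  then obtain y where y: "\<And>n. (u - e n *\<^sub>R y n, (1 + lam * e n) *\<^sub>R y n) \<in> A" by metis
  \<comment> \<open>Monotonicity of the shifted operator between two approximations; its values
    there are \<open>y m\<close> and \<open>y n\<close>, so \<open>lam\<close> cancels.\<close>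
  have pair: "e m * (norm (y m))\<^sup>2 + e n * (norm (y n))\<^sup>2 \<le> (e m + e n) * (y m \<bullet> y n)" for m n
  proof -
    let ?d = "e n *\<^sub>R y n - e m *\<^sub>R y m"
    have "- lam * (norm ?d)\<^sup>2 \<le> ((1 + lam * e m) *\<^sub>R y m - (1 + lam * e n) *\<^sub>R y n) \<bullet> ?d"
      using mono[OF y[of m] y[of n]] by simp
    also have "(1 + lam * e m) *\<^sub>R y m - (1 + lam * e n) *\<^sub>R y n = (y m - y n) - lam *\<^sub>R ?d"
      by (simp add: algebra_simps)
    finally have "0 \<le> (y m - y n) \<bullet> ?d"
      by (simp add: inner_diff_left[of "y m - y n"] power2_norm_eq_inner)
    thus ?thesis by (simp add: inner_diff power2_norm_eq_inner inner_commute algebra_simps)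
  qed
  have bound: "norm (y n) \<le> norm (a u)" for n
  proof -
    have "- lam * (norm (- (e n *\<^sub>R y n)))\<^sup>2 \<le> ((1 + lam * e n) *\<^sub>R y n - a u) \<bullet> (- (e n *\<^sub>R y n))"
      using mono[OF y[of n] a_graph[OF u]] by simp
    hence "e n * (norm (y n))\<^sup>2 \<le> e n * (a u \<bullet> y n)"
      by (simp add: inner_diff inner_add power_mult_distrib dot_square_norm power2_eq_square algebra_simps)
    hence "(norm (y n))\<^sup>2 \<le> norm (a u) * norm (y n)"
      using e[of n] norm_cauchy_schwarz[of "a u" "y n"] by simp
    thus ?thesis by (cases "y n = 0") (auto simp: power2_eq_square)
  qed
  have diff: "(e m + e n) * (norm (y m - y n))\<^sup>2 \<le> (e m - e n) * ((norm (y n))\<^sup>2 - (norm (y m))\<^sup>2)" for m n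
    using pair[of m n] by (simp add: norm_diff_sq algebra_simps)
  \<comment> \<open>By \<open>diff\<close> and \<open>e n < e m\<close> the norms increase with the
    index; \<open>e m - e n \<le> e m + e n\<close> then bounds the squared distance by the gap of
    the squared norms. Boundedness of the norms thus forces strong convergence.\<close>
  have incr: "(norm (y m))\<^sup>2 + (norm (y m - y n))\<^sup>2 \<le> (norm (y n))\<^sup>2" if "m < n" for m n
  proof -
    have less: "e n < e m" using that by (simp add: e_def)
    have "0 \<le> (e m - e n) * ((norm (y n))\<^sup>2 - (norm (y m))\<^sup>2)"
      using diff[of m n] e[of m] e[of n] by (smt (verit) mult_nonneg_nonneg zero_le_power2)
    hence nonneg: "0 \<le> (norm (y n))\<^sup>2 - (norm (y m))\<^sup>2" using less by (simp add: zero_le_mult_iff)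
    have "(e m + e n) * (norm (y m - y n))\<^sup>2 \<le> (e m + e n) * ((norm (y n))\<^sup>2 - (norm (y m))\<^sup>2)"
      by (rule order_trans[OF diff mult_right_mono[OF _ nonneg]]) (use e[of n] in simp)
    moreover have "0 < e m + e n" using e[of m] e[of n] by simp
    ultimately have "(norm (y m - y n))\<^sup>2 \<le> (norm (y n))\<^sup>2 - (norm (y m))\<^sup>2"
      by (simp only: mult_le_cancel_left_pos)
    thus ?thesis by simp
  qed
  have "incseq (\<lambda>n. (norm (y n))\<^sup>2)"
  proof (rule incseq_SucI)
    show "(norm (y n))\<^sup>2 \<le> (norm (y (Suc n)))\<^sup>2" for n
      using incr[of n "Suc n"] zero_le_power2[of "norm (y n - y (Suc n))"] by linarith
  qed
  moreover have "(norm (y n))\<^sup>2 \<le> (norm (a u))\<^sup>2" for n using bound by (intro power_mono) auto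
  ultimately obtain L where L: "(\<lambda>n. (norm (y n))\<^sup>2) \<longlonglongrightarrow> L" "\<forall>n. (norm (y n))\<^sup>2 \<le> L"
    using incseq_convergent[of "\<lambda>n. (norm (y n))\<^sup>2" "(norm (a u))\<^sup>2"] by blast
  have "Cauchy y"
    unfolding Cauchy_altdef2
  proof (intro allI impI)
    fix r :: real assume r: "0 < r"
    hence "\<forall>\<^sub>F n in sequentially. L - r\<^sup>2 < (norm (y n))\<^sup>2"
      by (intro order_tendstoD(1)[OF L(1)]) simp
    then obtain M where M: "L - r\<^sup>2 < (norm (y M))\<^sup>2" by (auto simp: eventually_sequentially)
    have "dist (y n) (y M) < r" if "n \<ge> M" for n
    proof (cases "n = M")
      case False
      hence "(norm (y M - y n))\<^sup>2 < r\<^sup>2" using incr[of M n] that L(2)[rule_format, of n] M by simp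
      hence "norm (y M - y n) < r" by (rule power2_less_imp_less) (use r in simp)
      thus ?thesis by (simp add: dist_norm norm_minus_commute)
    qed (use r in simp)
    thus "\<exists>M. \<forall>n\<ge>M. dist (y n) (y M) < r" by blast
  qed
  then obtain w where w: "y \<longlonglongrightarrow> w" using Cauchy_convergent convergent_def by blast
  have "(\<lambda>n. u - e n *\<^sub>R y n) \<longlonglongrightarrow> u - 0 *\<^sub>R w" "(\<lambda>n. (1 + lam * e n) *\<^sub>R y n) \<longlonglongrightarrow> (1 + lam * 0) *\<^sub>R w"
    by (intro tendsto_intros e0 w)+
  hence "(u, w) \<in> A" using closed_graph[OF y] by simp
  hence "w = a u" using a_eq by simp
  with w show ?thesis using that e y by blast
qed

text \<open>At \<open>v = u\<close>, \<open>T_inequality\<close> says nothing about the direction of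
  the quotient \<open>w t\<close>. At the Yosida points \<open>u - e n *\<^sub>R y n\<close> it
  bounds \<open>w t \<bullet> y n\<close> below by nearly \<open>(norm (y n))\<^sup>2\<close>. With
  the upper bound on \<open>norm (w t)\<close>, expanding \<open>(norm (w t - y n))\<^sup>2\<close>
  brings the quotients close to \<open>y n\<close>, hence to \<open>a u\<close>, in norm.\<close>

lemma T_differentiable:
  assumes u: "u \<in> D"
  shows "((\<lambda>t. (1 / t) *\<^sub>R (u - T t u)) \<longlongrightarrow> a u) (at_right 0)"
proof -
  obtain e :: "nat \<Rightarrow> real" and y :: "nat \<Rightarrow> 'a" where e: "\<And>n. 0 < e n"
    and y: "\<And>n. (u - e n *\<^sub>R y n, (1 + lam * e n) *\<^sub>R y n) \<in> A" and ylim: "y \<longlonglongrightarrow> a u"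
    using Yosida_approximation[OF u] by blast
  define w where "w t = (1 / t) *\<^sub>R (u - T t u)" for t
  have w_norm: "norm (w t) \<le> exp (k * t) * norm (a u)" if "0 < t" for t
    using T_displacement[OF u, of t] that by (simp add: w_def norm_minus_commute pos_divide_le_eq mult_ac)
  have inner: "\<exists>C. \<forall>t\<in>{0<..<1}. (norm (y n))\<^sup>2 - C * t \<le> w t \<bullet> y n" for n
  proof -
    define v where "v = u - e n *\<^sub>R y n"
    have v: "v \<in> D" "a v = (1 + lam * e n) *\<^sub>R y n" using y[of n] a_eq by (auto simp: v_def)
    have uv: "u - v = e n *\<^sub>R y n" "v - u = - (e n *\<^sub>R y n)" by (simp_all add: v_def)
    obtain C where C: "\<And>t. 0 \<le> t \<Longrightarrow> t \<le> 1 \<Longrightarrow> (norm (T t u - v))\<^sup>2 - (norm (u - v))\<^sup>2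
      \<le> 2 * t * (a v \<bullet> (v - u) + lam * (norm (u - v))\<^sup>2 + C * t)" using T_inequality[OF u v(1)] by blast
    have "(norm (y n))\<^sup>2 - C / e n * t \<le> w t \<bullet> y n" if t: "t \<in> {0<..<1}" for t
    proof -
      have Tv: "T t u - v = (u - v) - t *\<^sub>R w t" using t by (simp add: w_def)
      have "(norm (T t u - v))\<^sup>2 = (norm (u - v))\<^sup>2 - 2 * t * (w t \<bullet> (u - v)) + (t * norm (w t))\<^sup>2"
        unfolding Tv norm_diff_sq[of "u - v"] by (simp add: inner_commute power_mult_distrib)
      hence "- (2 * t * (w t \<bullet> (u - v))) \<le> 2 * t * (a v \<bullet> (v - u) + lam * (norm (u - v))\<^sup>2 + C * t)"
        using C[of t] t zero_le_power2[of "t * norm (w t)"] unfolding greaterThanLessThan_iff by linarith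
      hence "2 * t * - (w t \<bullet> (u - v)) \<le> 2 * t * (a v \<bullet> (v - u) + lam * (norm (u - v))\<^sup>2 + C * t)"
        by (simp only: mult_minus_right)
      hence "- (w t \<bullet> (u - v)) \<le> a v \<bullet> (v - u) + lam * (norm (u - v))\<^sup>2 + C * t"
        by (rule mult_left_le_imp_le) (use t in simp)
      hence "e n * (norm (y n))\<^sup>2 - C * t \<le> e n * (w t \<bullet> y n)"
        unfolding uv v(2) by (simp add: power_mult_distrib dot_square_norm power2_eq_square algebra_simps)
      thus ?thesis using e[of n] by (simp add: field_simps)
    qed
    thus ?thesis by blast
  qed
  have "(w \<longlongrightarrow> a u) (at_right 0)"
  proof (rule tendstoI)
    fix r :: real assume r: "0 < r"
    have "(\<lambda>n. (norm (a u))\<^sup>2 - (norm (y n))\<^sup>2) \<longlonglongrightarrow> (norm (a u))\<^sup>2 - (norm (a u))\<^sup>2"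
      by (intro tendsto_intros ylim)
    hence "\<forall>\<^sub>F n in sequentially. (norm (a u))\<^sup>2 - (norm (y n))\<^sup>2 < (r / 2)\<^sup>2"
      using order_tendstoD(2)[of _ 0 _ "(r / 2)\<^sup>2"] r by simp
    moreover have "\<forall>\<^sub>F n in sequentially. dist (y n) (a u) < r / 2"
      using tendstoD[OF ylim, of "r / 2"] r by simp
    ultimately have "\<forall>\<^sub>F n in sequentially. (norm (a u))\<^sup>2 - (norm (y n))\<^sup>2 < (r / 2)\<^sup>2 \<and> dist (y n) (a u) < r / 2"
      by (rule eventually_conj)
    then obtain n where n: "(norm (a u))\<^sup>2 - (norm (y n))\<^sup>2 < (r / 2)\<^sup>2" "dist (y n) (a u) < r / 2"
      by (auto simp: eventually_sequentially)
    obtain C where C: "\<forall>t\<in>{0<..<1}. (norm (y n))\<^sup>2 - C * t \<le> w t \<bullet> y n" using inner by blast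
    have "((\<lambda>t. (exp (k * t) * norm (a u))\<^sup>2 - (norm (y n))\<^sup>2 + 2 * C * t)
        \<longlongrightarrow> (exp (k * 0) * norm (a u))\<^sup>2 - (norm (y n))\<^sup>2 + 2 * C * 0) (at_right 0)"
      by (intro tendsto_intros)
    hence "\<forall>\<^sub>F t in at_right 0. (exp (k * t) * norm (a u))\<^sup>2 - (norm (y n))\<^sup>2 + 2 * C * t < (r / 2)\<^sup>2"
      by (rule order_tendstoD(2)) (use n(1) in simp)
    moreover have "\<forall>\<^sub>F t in at_right (0::real). t \<in> {0<..<1}" by (rule eventually_at_right_real) simp
    ultimately show "\<forall>\<^sub>F t in at_right 0. dist (w t) (a u) < r"
    proof eventually_elim
      case (elim t)
      have "(norm (w t))\<^sup>2 \<le> (exp (k * t) * norm (a u))\<^sup>2"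
        using w_norm[of t] elim by (intro power_mono) auto
      moreover have "(norm (y n))\<^sup>2 - C * t \<le> w t \<bullet> y n" using elim C by blast
      ultimately have "(norm (w t - y n))\<^sup>2 < (r / 2)\<^sup>2"
        using elim unfolding norm_diff_sq by linarith
      hence "norm (w t - y n) < r / 2" by (rule power2_less_imp_less) (use r in simp)
      hence "dist (w t) (y n) < r / 2" by (simp add: dist_norm)
      thus ?case using n(2) dist_triangle[of "w t" "a u" "y n"] by linarith
    qed
  qed
  thus ?thesis by (simp only: w_def[abs_def])
qed

lemma nonlinear_semigroup_T: "nonlinear_semigroup lam T"
  unfolding nonlinear_semigroup_def
  by (auto simp: T_0 T_add T_right_continuous T_lipschitz fun_eq_iff)

lemma semigroup_generator_T: "semigroup_generator T = A"
proof
  show "A \<subseteq> semigroup_generator T"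
    using T_differentiable a_eq by (auto simp: semigroup_generator_def Domain_iff)
next
  have "(u, w) \<in> A" if w: "((\<lambda>t. (1 / t) *\<^sub>R (u - T t u)) \<longlongrightarrow> w) (at_right 0)" for u w
  proof (rule maximal)
    fix v assume v: "v \<in> D"
    \<comment> \<open>The quotients inherit a monotonicity inequality with constant
      \<open>(1 - exp (lam * t)) / t\<close>. Its limit \<open>- lam\<close> is exactly what
      \<open>maximal\<close> asks for, and this is where the sharp Lipschitz constant
      matters.\<close>
    let ?f = "\<lambda>t. ((1 - exp (lam * t)) / t) * (norm (u - v))\<^sup>2"
    let ?g = "\<lambda>t. ((1 / t) *\<^sub>R (u - T t u) - (1 / t) *\<^sub>R (v - T t v)) \<bullet> (u - v)"
    have "(?g \<longlongrightarrow> (w - a v) \<bullet> (u - v)) (at_right 0)"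
      by (intro tendsto_intros w T_differentiable v)
    moreover have "(?f \<longlongrightarrow> - lam * (norm (u - v))\<^sup>2) (at_right 0)"
    proof (intro tendsto_intros)
      have "((\<lambda>t. 1 - exp (lam * t)) has_real_derivative - lam) (at 0)"
        by (auto intro!: derivative_eq_intros)
      hence "((\<lambda>t. (1 - exp (lam * t)) / t) \<longlongrightarrow> - lam) (at 0)"
        by (simp add: has_field_derivative_iff)
      thus "((\<lambda>t. (1 - exp (lam * t)) / t) \<longlongrightarrow> - lam) (at_right 0)"
        by (rule filterlim_mono) (auto simp: at_le)
    qed
    moreover have "\<forall>\<^sub>F t in at_right 0. ?f t \<le> ?g t"
      using eventually_at_right_less[of "0::real"]
    proof eventually_elim
      case (elim t)
      have "(T t u - T t v) \<bullet> (u - v) \<le> exp (lam * t) * norm (u - v) * norm (u - v)"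
        using norm_cauchy_schwarz[of "T t u - T t v" "u - v"] T_lipschitz[of t u v] elim
        by (meson less_imp_le mult_right_mono norm_ge_zero order_trans)
      moreover have "(u - T t u) - (v - T t v) = (u - v) - (T t u - T t v)" by simp
      ultimately have "(1 - exp (lam * t)) * (norm (u - v))\<^sup>2 \<le> ((u - T t u) - (v - T t v)) \<bullet> (u - v)"
        by (simp only: inner_diff_left[of "u - v"] dot_square_norm) (simp add: power2_eq_square left_diff_distrib)
      hence "(1 / t) * ((1 - exp (lam * t)) * (norm (u - v))\<^sup>2)
          \<le> (1 / t) * (((u - T t u) - (v - T t v)) \<bullet> (u - v))"
        using elim by (intro mult_left_mono) auto
      thus ?case by (simp flip: scaleR_diff_right)
    qed
    ultimately show "- lam * (norm (u - v))\<^sup>2 \<le> (w - a v) \<bullet> (u - v)"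
      by (intro tendsto_le[OF trivial_limit_at_right_real])
  qed
  thus "semigroup_generator T \<subseteq> A" by (auto simp: semigroup_generator_def)
qed

end

section \<open>The Friedrichs extension\<close>

lemma linear_operator_graph: "linear_operator A \<Longrightarrow> u \<in> Domain A \<Longrightarrow> (u, op_app A u) \<in> A"
  unfolding linear_operator_def by (blast intro: op_app_in_graph)

lemma linear_operator_eq: "linear_operator A \<Longrightarrow> (u, w) \<in> A \<Longrightarrow> op_app A u = w"
  unfolding linear_operator_def by (blast intro: single_valued_op_app)

lemma linear_operator_add:
  assumes A: "linear_operator A" and u: "u \<in> Domain A" and v: "v \<in> Domain A"
  shows "u + v \<in> Domain A" "op_app A (u + v) = op_app A u + op_app A v"
proof -
  have "(u, op_app A u) + (v, op_app A v) \<in> A"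
    using A u v by (intro subspace_add linear_operator_graph) (auto simp: linear_operator_def)
  hence *: "(u + v, op_app A u + op_app A v) \<in> A" by simp
  thus "u + v \<in> Domain A" by blast
  show "op_app A (u + v) = op_app A u + op_app A v" by (rule linear_operator_eq[OF A *])
qed

lemma linear_operator_scale:
  assumes A: "linear_operator A" and u: "u \<in> Domain A"
  shows "r *\<^sub>R u \<in> Domain A" "op_app A (r *\<^sub>R u) = r *\<^sub>R op_app A u"
proof -
  have "r *\<^sub>R (u, op_app A u) \<in> A"
    using A u by (intro subspace_mul linear_operator_graph) (auto simp: linear_operator_def)
  hence *: "(r *\<^sub>R u, r *\<^sub>R op_app A u) \<in> A" by simp
  thus "r *\<^sub>R u \<in> Domain A" by blast
  show "op_app A (r *\<^sub>R u) = r *\<^sub>R op_app A u" by (rule linear_operator_eq[OF A *])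
qed

lemma linear_operator_zero:
  assumes A: "linear_operator A"
  shows "0 \<in> Domain A" "op_app A 0 = 0"
proof -
  have "0 \<in> A" using A by (intro subspace_0) (simp add: linear_operator_def)
  hence *: "(0, 0) \<in> A" by (simp add: zero_prod_def)
  thus "0 \<in> Domain A" by blast
  show "op_app A 0 = 0" by (rule linear_operator_eq[OF A *])
qed

lemma linear_operator_diff:
  assumes A: "linear_operator A" and u: "u \<in> Domain A" and v: "v \<in> Domain A"
  shows "u - v \<in> Domain A" "op_app A (u - v) = op_app A u - op_app A v"
  using linear_operator_add[OF A u linear_operator_scale(1)[OF A v, of "-1"]]
    linear_operator_scale(2)[OF A v, of "-1"] by simp_all

lemma orthogonal_to_dense_imp_zero:
  fixes z :: "'a::real_inner"
  assumes "closure M = UNIV" "\<And>v. v \<in> M \<Longrightarrow> v \<bullet> z = 0"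
  shows "z = 0"
proof -
  have "closure M \<subseteq> {v. v \<bullet> z = 0}"
    by (intro closure_minimal closed_Collect_eq continuous_intros) (use assms in auto)
  hence "z \<in> {v. v \<bullet> z = 0}" using assms(1) by blast
  thus ?thesis by simp
qed

lemma op_adjointD: "(u, w) \<in> op_adjoint S \<Longrightarrow> v \<in> Domain S \<Longrightarrow> op_app S v \<bullet> u = v \<bullet> w"
  by (simp add: op_adjoint_def)

lemma op_adjoint_unique:
  assumes "densely_defined S" "(u, w) \<in> op_adjoint S" "(u, w') \<in> op_adjoint S"
  shows "w = w'"
proof -
  have "v \<bullet> (w - w') = 0" if "v \<in> Domain S" for v
  proof -
    have "v \<bullet> w = v \<bullet> w'" using op_adjointD[OF assms(2) that] op_adjointD[OF assms(3) that] by simp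
    thus ?thesis by (simp add: inner_diff_right)
  qed
  hence "w - w' = 0"
    using orthogonal_to_dense_imp_zero assms(1) unfolding densely_defined_def by blast
  thus ?thesis by simp
qed

lemma subspace_op_adjoint: "subspace (op_adjoint S)"
  by (auto simp: subspace_def op_adjoint_def zero_prod_def inner_add_right split: prod.splits)

locale semibounded_operator =
  fixes S :: "('a::{real_inner,complete_space} \<times> 'a) set" and \<omega> lam :: real
  assumes symmetric: "symmetric_operator S" and dense: "densely_defined S"
    and below: "bounded_below S (- \<omega>)" and lam: "\<omega> < lam"
begin

abbreviation "s \<equiv> op_app S"

text \<open>Since \<open>lam > \<omega>\<close>, the shifted form is an inner product on
  \<open>Domain S\<close> that dominates the Hilbert space norm up to a constant.\<close>

definition q :: "'a \<Rightarrow> 'a \<Rightarrow> real" where "q u v = (s u + lam *\<^sub>R u) \<bullet> v"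

lemma linear: "linear_operator S"
  using symmetric by (simp add: symmetric_operator_def)

lemmas S_add = linear_operator_add[OF linear] and S_scale = linear_operator_scale[OF linear]
  and S_diff = linear_operator_diff[OF linear]

lemma q_sym: "u \<in> Domain S \<Longrightarrow> v \<in> Domain S \<Longrightarrow> q u v = q v u"
  using symmetric by (simp add: symmetric_operator_def q_def inner_add inner_commute)

lemma q_add_left: "u \<in> Domain S \<Longrightarrow> v \<in> Domain S \<Longrightarrow> q (u + v) z = q u z + q v z"
  by (simp add: q_def S_add inner_add algebra_simps)

lemma q_diff_left: "u \<in> Domain S \<Longrightarrow> v \<in> Domain S \<Longrightarrow> q (u - v) z = q u z - q v z"
  by (simp add: q_def S_diff inner_add inner_diff algebra_simps)

lemma q_scale_left: "u \<in> Domain S \<Longrightarrow> q (r *\<^sub>R u) z = r * q u z"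
  by (simp add: q_def S_scale inner_add algebra_simps)

lemma q_add_right: "q z (u + v) = q z u + q z v"
  by (simp add: q_def inner_add_right)

lemma q_diff_right: "q z (u - v) = q z u - q z v"
  by (simp add: q_def inner_diff_right)

lemma q_scale_right: "q z (r *\<^sub>R u) = r * q z u"
  by (simp add: q_def)

lemma q_coercive:
  assumes "u \<in> Domain S"
  shows "(lam - \<omega>) * (norm u)\<^sup>2 \<le> q u u"
proof -
  have "- \<omega> * (norm u)\<^sup>2 \<le> s u \<bullet> u" using below assms unfolding bounded_below_def by blast
  thus ?thesis by (simp add: q_def inner_add_left dot_square_norm algebra_simps)
qed

lemma q_nonneg: "u \<in> Domain S \<Longrightarrow> 0 \<le> q u u"
  using q_coercive[of u] lam by (meson diff_ge_0_iff_ge less_imp_le mult_nonneg_nonneg order_trans zero_le_power2)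

lemma q_eq_0_iff: "u \<in> Domain S \<Longrightarrow> q u u = 0 \<longleftrightarrow> u = 0"
proof
  assume u: "u \<in> Domain S" and "q u u = 0"
  hence "(lam - \<omega>) * (norm u)\<^sup>2 \<le> 0" using q_coercive[OF u] by simp
  thus "u = 0" using lam by (auto simp: mult_le_0_iff)
qed (simp add: q_def)

lemma q_quadratic:
  assumes "u \<in> Domain S" "v \<in> Domain S"
  shows "q (u + t *\<^sub>R v) (u + t *\<^sub>R v) = q u u + 2 * t * q u v + t\<^sup>2 * q v v"
  using assms q_sym[OF assms]
  by (simp add: q_add_left q_add_right q_scale_left q_scale_right S_scale power2_eq_square algebra_simps)

lemma q_Cauchy_Schwarz:
  assumes u: "u \<in> Domain S" and v: "v \<in> Domain S"
  shows "(q u v)\<^sup>2 \<le> q u u * q v v"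
proof (cases "v = 0")
  case False
  have pos: "0 < q v v" using q_nonneg[OF v] q_eq_0_iff[OF v] False by simp
  let ?t = "- q u v / q v v"
  have "0 \<le> q (u + ?t *\<^sub>R v) (u + ?t *\<^sub>R v)"
    by (intro q_nonneg S_add S_scale u v)
  also have "\<dots> = q u u - (q u v)\<^sup>2 / q v v"
    unfolding q_quadratic[OF u v] using pos by (simp add: field_simps power2_eq_square)
  finally show ?thesis using pos by (simp add: field_simps)
qed (simp add: q_def)

lemma q_parallelogram_le:
  assumes "u \<in> Domain S" "v \<in> Domain S"
  shows "q (u + v) (u + v) \<le> 2 * q u u + 2 * q v v"
  using assms q_nonneg[of "u - v"] q_sym[OF assms]
  by (simp add: q_add_left q_add_right q_diff_left q_diff_right S_diff algebra_simps)

section \<open>Form-Cauchy sequences and the closed form domain\<close>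

definition q_Cauchy :: "(nat \<Rightarrow> 'a) \<Rightarrow> bool" where
  "q_Cauchy x \<longleftrightarrow> (\<forall>n. x n \<in> Domain S) \<and>
     (\<forall>e>0. \<exists>M. \<forall>m\<ge>M. \<forall>n\<ge>M. q (x m - x n) (x m - x n) < e)"

lemma q_Cauchy_dom: "q_Cauchy x \<Longrightarrow> x n \<in> Domain S"
  by (simp add: q_Cauchy_def)

lemma q_Cauchy_imp_Cauchy:
  assumes "q_Cauchy x"
  shows "Cauchy x"
proof (rule metric_CauchyI)
  fix e :: real assume e: "0 < e"
  hence "0 < (lam - \<omega>) * e\<^sup>2" using lam by simp
  then obtain M where M: "\<forall>m\<ge>M. \<forall>n\<ge>M. q (x m - x n) (x m - x n) < (lam - \<omega>) * e\<^sup>2"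
    using assms unfolding q_Cauchy_def by blast
  have "dist (x m) (x n) < e" if "m \<ge> M" "n \<ge> M" for m n
  proof -
    have "(lam - \<omega>) * (norm (x m - x n))\<^sup>2 < (lam - \<omega>) * e\<^sup>2"
      by (rule le_less_trans[OF q_coercive]) (use that M assms in \<open>auto intro: S_diff q_Cauchy_dom\<close>)
    hence "(norm (x m - x n))\<^sup>2 < e\<^sup>2" using lam by simp
    hence "norm (x m - x n) < e" by (rule power2_less_imp_less) (use e in simp)
    thus ?thesis by (simp add: dist_norm)
  qed
  thus "\<exists>M. \<forall>m\<ge>M. \<forall>n\<ge>M. dist (x m) (x n) < e" by blast
qed

text \<open>Along a convergent sequence the shift contributes only \<open>lam\<close> times squared
  norms of differences, which vanish in the double limit; so being Cauchy for the form of
  \<open>S\<close> and for \<open>q\<close> agree.\<close>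

lemma closed_form_domain_iff:
  "u \<in> closed_form_domain S \<longleftrightarrow> (\<exists>x. q_Cauchy x \<and> x \<longlonglongrightarrow> u)"
proof -
  have "((\<lambda>(m, n). s (x m - x n) \<bullet> (x m - x n)) \<longlongrightarrow> 0) (sequentially \<times>\<^sub>F sequentially)
      \<longleftrightarrow> q_Cauchy x" if dom: "\<forall>n. x n \<in> Domain S" and lim: "x \<longlonglongrightarrow> u" for x
  proof -
    let ?s = "\<lambda>(m, n). s (x m - x n) \<bullet> (x m - x n)" and ?q = "\<lambda>(m, n). q (x m - x n) (x m - x n)"
    have d: "((\<lambda>p. x (fst p) - x (snd p)) \<longlongrightarrow> u - u) (sequentially \<times>\<^sub>F sequentially)"
      by (intro tendsto_diff filterlim_compose[OF lim] filterlim_fst filterlim_snd)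
    have z: "((\<lambda>p. lam * ((x (fst p) - x (snd p)) \<bullet> (x (fst p) - x (snd p)))) \<longlongrightarrow> 0)
        (sequentially \<times>\<^sub>F sequentially)"
      using tendsto_inner[OF d d] by (intro tendsto_mult_right_zero) simp
    have sq: "?q = (\<lambda>p. ?s p + lam * ((x (fst p) - x (snd p)) \<bullet> (x (fst p) - x (snd p))))"
      by (auto simp: q_def inner_add_left)
    have "(?s \<longlongrightarrow> 0) (sequentially \<times>\<^sub>F sequentially) \<longleftrightarrow> (?q \<longlongrightarrow> 0) (sequentially \<times>\<^sub>F sequentially)"
      using tendsto_add[OF _ z, of ?s 0] tendsto_diff[OF _ z, of ?q 0] unfolding sq by auto
    also have "\<dots> \<longleftrightarrow> q_Cauchy x"
    proof -
      have "\<bar>q (x m - x n) (x m - x n)\<bar> = q (x m - x n) (x m - x n)" for m n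
        using dom by (simp add: q_nonneg S_diff)
      thus ?thesis
        using dom unfolding tendsto_iff eventually_prod_sequentially q_Cauchy_def
        by (simp add: dist_real_def) blast
    qed
    finally show ?thesis .
  qed
  thus ?thesis unfolding closed_form_domain_def mem_Collect_eq using q_Cauchy_dom by meson
qed

text \<open>For fixed \<open>n\<close>, \<open>q (x m) (y n)\<close> tends to
  \<open>(w + lam *\<^sub>R u) \<bullet> y n\<close> as \<open>m\<close> grows, by the adjoint
  relation. The \<open>y n\<close> are bounded in the form norm, so Cauchy-Schwarz for
  \<open>q\<close> makes this uniform in large \<open>n\<close>, and the diagonal may be
  taken.\<close>

lemma form_limit:
  assumes x: "q_Cauchy x" "x \<longlonglongrightarrow> u" and w: "(u, w) \<in> op_adjoint S" and y: "q_Cauchy y"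
  shows "(\<lambda>n. q (x n) (y n) - (w + lam *\<^sub>R u) \<bullet> y n) \<longlonglongrightarrow> 0"
proof (rule LIMSEQ_I)
  fix e :: real assume e: "0 < e"
  obtain M1 where M1: "\<forall>m\<ge>M1. \<forall>n\<ge>M1. q (y m - y n) (y m - y n) < 1"
    using y zero_less_one unfolding q_Cauchy_def by blast
  define B where "B = 2 + 2 * q (y M1) (y M1)"
  have B: "0 < B" using q_nonneg[OF q_Cauchy_dom[OF y], of M1] by (simp add: B_def)
  have yB: "q (y n) (y n) \<le> B" if "n \<ge> M1" for n
    using q_parallelogram_le[of "y n - y M1" "y M1"] M1[rule_format, OF that order_refl]
    by (simp add: B_def S_diff q_Cauchy_dom[OF y])
  have "0 < (e / 2)\<^sup>2 / B" using e B by simp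
  then obtain M2 where M2: "\<forall>m\<ge>M2. \<forall>n\<ge>M2. q (x m - x n) (x m - x n) < (e / 2)\<^sup>2 / B"
    using x(1) unfolding q_Cauchy_def by blast
  have "norm (q (x n) (y n) - (w + lam *\<^sub>R u) \<bullet> y n - 0) < e" if n: "n \<ge> max M1 M2" for n
  proof -
    have yn: "y n \<in> Domain S" by (rule q_Cauchy_dom[OF y])
    have "(\<lambda>m. (s (y n) + lam *\<^sub>R y n) \<bullet> x m) \<longlonglongrightarrow> (s (y n) + lam *\<^sub>R y n) \<bullet> u"
      by (intro tendsto_intros x(2))
    moreover have "(s (y n) + lam *\<^sub>R y n) \<bullet> x m = q (x m) (y n)" for m
      using q_sym[OF q_Cauchy_dom[OF x(1)] yn] by (simp add: q_def)
    moreover have "s (y n) \<bullet> u = y n \<bullet> w" using w yn by (auto simp: op_adjoint_def)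
    hence "(s (y n) + lam *\<^sub>R y n) \<bullet> u = (w + lam *\<^sub>R u) \<bullet> y n"
      by (simp add: inner_add inner_commute[of u] inner_commute[of w])
    ultimately have "(\<lambda>m. q (x m) (y n)) \<longlonglongrightarrow> (w + lam *\<^sub>R u) \<bullet> y n" by simp
    hence "(\<lambda>m. \<bar>q (x n) (y n) - q (x m) (y n)\<bar>) \<longlonglongrightarrow> \<bar>q (x n) (y n) - (w + lam *\<^sub>R u) \<bullet> y n\<bar>"
      by (intro tendsto_intros)
    moreover have "\<bar>q (x n) (y n) - q (x m) (y n)\<bar> \<le> e / 2" if "m \<ge> M2" for m
    proof -
      have "(q (x n - x m) (y n))\<^sup>2 \<le> q (x n - x m) (x n - x m) * q (y n) (y n)"
        by (intro q_Cauchy_Schwarz S_diff q_Cauchy_dom[OF x(1)] yn)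
      also have "\<dots> \<le> (e / 2)\<^sup>2 / B * B"
        using M2 n that yB[of n] B q_nonneg[OF yn] by (intro mult_mono) (auto intro: less_imp_le)
      also have "\<dots> = (e / 2)\<^sup>2" using B by simp
      finally have "\<bar>q (x n - x m) (y n)\<bar> \<le> e / 2" using e abs_le_square_iff[of _ "e / 2"] by simp
      thus ?thesis by (simp add: q_diff_left q_Cauchy_dom[OF x(1)])
    qed
    ultimately have "\<bar>q (x n) (y n) - (w + lam *\<^sub>R u) \<bullet> y n\<bar> \<le> e / 2"
      by (intro LIMSEQ_le_const2) auto
    thus ?thesis using e by simp
  qed
  thus "\<exists>M. \<forall>n\<ge>M. norm (q (x n) (y n) - (w + lam *\<^sub>R u) \<bullet> y n - 0) < e" by blast
qed

section \<open>Symmetry, lower bound, linearity and range of the Friedrichs extension\<close>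

abbreviation "A0 \<equiv> friedrichs_extension S"

lemma form_limit_A0:
  assumes x: "q_Cauchy x" "x \<longlonglongrightarrow> u" and y: "q_Cauchy y" "y \<longlonglongrightarrow> v" and w: "(u, w) \<in> A0"
  shows "(\<lambda>n. q (x n) (y n)) \<longlonglongrightarrow> (w + lam *\<^sub>R u) \<bullet> v"
proof -
  have "(u, w) \<in> op_adjoint S" using w by (simp add: friedrichs_extension_def)
  note form_limit[OF x this y(1)]
  moreover have "(\<lambda>n. (w + lam *\<^sub>R u) \<bullet> y n) \<longlonglongrightarrow> (w + lam *\<^sub>R u) \<bullet> v" by (intro tendsto_intros y)
  ultimately show ?thesis using tendsto_add by fastforce
qed

lemma A0_form_sequence:
  assumes "(u, w) \<in> A0"
  obtains x where "q_Cauchy x" "x \<longlonglongrightarrow> u"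
  using assms by (auto simp: friedrichs_extension_def closed_form_domain_iff)

lemma A0_symmetric:
  assumes "(u, w) \<in> A0" "(v, z) \<in> A0"
  shows "w \<bullet> v = u \<bullet> z"
proof -
  obtain x y where x: "q_Cauchy x" "x \<longlonglongrightarrow> u" and y: "q_Cauchy y" "y \<longlonglongrightarrow> v"
    using A0_form_sequence assms by metis
  have "(\<lambda>n. q (x n) (y n)) = (\<lambda>n. q (y n) (x n))"
    by (intro ext q_sym q_Cauchy_dom x y)
  hence "(w + lam *\<^sub>R u) \<bullet> v = (z + lam *\<^sub>R v) \<bullet> u"
    using form_limit_A0[OF x y assms(1)] form_limit_A0[OF y x assms(2)] LIMSEQ_unique by metis
  thus ?thesis by (simp add: inner_add inner_commute[of v] inner_commute[of z])
qed

lemma A0_coercive: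
  assumes "(u, w) \<in> A0"
  shows "(lam - \<omega>) * (norm u)\<^sup>2 \<le> (w + lam *\<^sub>R u) \<bullet> u"
proof -
  obtain x where x: "q_Cauchy x" "x \<longlonglongrightarrow> u" using A0_form_sequence[OF assms] .
  have "(\<lambda>n. (lam - \<omega>) * (norm (x n))\<^sup>2) \<longlonglongrightarrow> (lam - \<omega>) * (norm u)\<^sup>2"
    by (intro tendsto_intros x)
  thus ?thesis
    using form_limit_A0[OF x x assms] q_coercive[OF q_Cauchy_dom[OF x(1)]] by (blast intro: LIMSEQ_le)
qed

lemma q_Cauchy_lin:
  assumes x: "q_Cauchy x" and y: "q_Cauchy y"
  shows "q_Cauchy (\<lambda>n. x n + r *\<^sub>R y n)"
  unfolding q_Cauchy_def
proof (intro conjI allI impI)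
  fix n show "x n + r *\<^sub>R y n \<in> Domain S" by (intro S_add S_scale q_Cauchy_dom x y)
next
  fix e :: real assume e: "0 < e"
  obtain M1 where M1: "\<forall>m\<ge>M1. \<forall>n\<ge>M1. q (x m - x n) (x m - x n) < e / 4"
    using x e unfolding q_Cauchy_def by (meson divide_pos_pos zero_less_numeral)
  have "0 < e / (4 * (r\<^sup>2 + 1))" using e by (intro divide_pos_pos mult_pos_pos add_nonneg_pos) auto
  then obtain M2 where M2: "\<forall>m\<ge>M2. \<forall>n\<ge>M2. q (y m - y n) (y m - y n) < e / (4 * (r\<^sup>2 + 1))"
    using y unfolding q_Cauchy_def by blast
  have "q (x m + r *\<^sub>R y m - (x n + r *\<^sub>R y n)) (x m + r *\<^sub>R y m - (x n + r *\<^sub>R y n)) < e"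
    if "m \<ge> max M1 M2" "n \<ge> max M1 M2" for m n
  proof -
    have dom: "x m - x n \<in> Domain S" "y m - y n \<in> Domain S"
      by (intro S_diff q_Cauchy_dom x y)+
    have "x m + r *\<^sub>R y m - (x n + r *\<^sub>R y n) = (x m - x n) + r *\<^sub>R (y m - y n)"
      by (simp add: algebra_simps)
    moreover have "q ((x m - x n) + r *\<^sub>R (y m - y n)) ((x m - x n) + r *\<^sub>R (y m - y n))
        \<le> 2 * q (x m - x n) (x m - x n) + 2 * (r\<^sup>2 * q (y m - y n) (y m - y n))"
      using q_parallelogram_le[OF dom(1) S_scale(1)[OF dom(2), of r]]
      by (simp add: q_scale_left q_scale_right dom power2_eq_square mult.assoc)
    moreover have "r\<^sup>2 * q (y m - y n) (y m - y n) \<le> (r\<^sup>2 + 1) * (e / (4 * (r\<^sup>2 + 1)))"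
      using M2 that q_nonneg[OF dom(2)] by (intro mult_mono) (auto intro: less_imp_le)
    moreover have "(r\<^sup>2 + 1) * (e / (4 * (r\<^sup>2 + 1))) = e / 4"
    proof -
      have "r\<^sup>2 + 1 \<noteq> 0" by (smt (verit) zero_le_power2)
      moreover have "d * (e / (4 * d)) = e / 4" if "d \<noteq> 0" for d :: real using that by simp
      ultimately show ?thesis by blast
    qed
    moreover have "q (x m - x n) (x m - x n) < e / 4" using M1 that by simp
    ultimately show ?thesis by (simp only:)
  qed
  thus "\<exists>M. \<forall>m\<ge>M. \<forall>n\<ge>M.
      q (x m + r *\<^sub>R y m - (x n + r *\<^sub>R y n)) (x m + r *\<^sub>R y m - (x n + r *\<^sub>R y n)) < e" by blast
qed

lemma q_Cauchy_const: "v \<in> Domain S \<Longrightarrow> q_Cauchy (\<lambda>_. v)"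
  by (auto simp: q_Cauchy_def q_def)

lemma closed_form_domain_lin:
  assumes "u \<in> closed_form_domain S" "v \<in> closed_form_domain S"
  shows "u + r *\<^sub>R v \<in> closed_form_domain S"
proof -
  obtain x y where x: "q_Cauchy x" "x \<longlonglongrightarrow> u" and y: "q_Cauchy y" "y \<longlonglongrightarrow> v"
    using assms unfolding closed_form_domain_iff by blast
  have "(\<lambda>n. x n + r *\<^sub>R y n) \<longlonglongrightarrow> u + r *\<^sub>R v" by (intro tendsto_intros x y)
  with q_Cauchy_lin[OF x(1) y(1)] show ?thesis unfolding closed_form_domain_iff by blast
qed

lemma Domain_subset_closed_form_domain: "Domain S \<subseteq> closed_form_domain S"
  using q_Cauchy_const tendsto_const by (auto simp: closed_form_domain_iff, blast)

lemma S_subset_A0: "S \<subseteq> A0"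
proof
  fix p assume p: "p \<in> S"
  obtain u w where uw: "p = (u, w)" by force
  have u: "u \<in> Domain S" and w: "w = s u" using p linear_operator_eq[OF linear] by (auto simp: uw)
  have "(u, w) \<in> op_adjoint S"
    using symmetric u by (auto simp: op_adjoint_def symmetric_operator_def w)
  thus "p \<in> A0" using u Domain_subset_closed_form_domain by (auto simp: friedrichs_extension_def uw)
qed

lemma linear_operator_A0: "linear_operator A0"
proof -
  have "subspace (closed_form_domain S)"
  proof (rule subspaceI)
    show zero: "0 \<in> closed_form_domain S"
      using linear_operator_zero(1)[OF linear] Domain_subset_closed_form_domain by blast
    show "u + v \<in> closed_form_domain S" if "u \<in> closed_form_domain S" "v \<in> closed_form_domain S" for u v
      using closed_form_domain_lin[OF that, of 1] by simp
    show "r *\<^sub>R u \<in> closed_form_domain S" if "u \<in> closed_form_domain S" for u r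
      using closed_form_domain_lin[OF zero that, of r] by simp
  qed
  moreover have "A0 = op_adjoint S \<inter> closed_form_domain S \<times> UNIV"
    by (auto simp: friedrichs_extension_def)
  ultimately have "subspace A0"
    using subspace_op_adjoint[of S] by (simp add: subspace_inter subspace_Times)
  moreover have "single_valued A0"
    using op_adjoint_unique[OF dense] by (auto simp: single_valued_def friedrichs_extension_def)
  ultimately show ?thesis by (simp add: linear_operator_def)
qed

text \<open>Direct method for the energy functional \<open>v \<mapsto> q v v / 2 - f \<bullet> v\<close> on the domain of \<open>S\<close>.\<close>

lemma A0_plus_lam_onto:
  obtains u w where "(u, w) \<in> A0" "w + lam *\<^sub>R u = f"
proof -
  define c where "c = lam - \<omega>"
  have c: "0 < c" using lam by (simp add: c_def)
  define F where "F v = q v v / 2 - f \<bullet> v" for v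
  define I where "I = Inf (F ` Domain S)"
  have ne: "Domain S \<noteq> {}" using linear_operator_zero(1)[OF linear] by blast
  have bdd: "bdd_below (F ` Domain S)"
  proof (rule bdd_belowI2)
    fix v assume v: "v \<in> Domain S"
    have "0 \<le> (c * norm v - norm f)\<^sup>2" by simp
    hence "2 * c * (norm f * norm v) \<le> c * (c * (norm v)\<^sup>2) + (norm f)\<^sup>2"
      by (simp add: power2_diff power_mult_distrib power2_eq_square algebra_simps)
    also have "\<dots> \<le> c * q v v + (norm f)\<^sup>2"
      using q_coercive[OF v] c by (intro add_right_mono mult_left_mono) (auto simp: c_def)
    finally have "2 * c * (norm f * norm v) \<le> c * q v v + (norm f)\<^sup>2" .
    moreover have "2 * c * (f \<bullet> v) \<le> 2 * c * (norm f * norm v)"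
      using c by (intro mult_left_mono norm_cauchy_schwarz) auto
    ultimately have "2 * c * (f \<bullet> v) \<le> c * q v v + (norm f)\<^sup>2" by linarith
    thus "- ((norm f)\<^sup>2 / (2 * c)) \<le> F v" using c by (simp add: F_def field_simps)
  qed
  have I_le: "I \<le> F v" if "v \<in> Domain S" for v
    unfolding I_def by (rule cINF_lower[OF bdd that])
  have "\<exists>v\<in>Domain S. F v < I + inverse (real (Suc n))" for n
    using cINF_less_iff[OF ne bdd, of "I + inverse (real (Suc n))"] by (simp add: I_def)
  then obtain x where x: "\<And>n. x n \<in> Domain S" and x_lt: "\<And>n. F (x n) < I + inverse (real (Suc n))"
    by metis
  have var: "F (u + t *\<^sub>R v) = F u + t * (q u v - f \<bullet> v) + t\<^sup>2 * q v v / 2"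
    if "u \<in> Domain S" "v \<in> Domain S" for u v t
    unfolding F_def q_quadratic[OF that] by (simp add: inner_add_right field_simps)
  \<comment> \<open>The midpoint of \<open>x m\<close> and \<open>x n\<close> lies in the domain, so
    its energy is at least \<open>I\<close>.\<close>
  have diff: "q (x m - x n) (x m - x n) \<le> 4 * (F (x m) - I) + 4 * (F (x n) - I)" for m n
  proof -
    let ?d = "x m - x n"
    have d: "?d \<in> Domain S" by (intro S_diff x)
    have "F (x m) = F (x n) + (q (x n) ?d - f \<bullet> ?d) + q ?d ?d / 2" using var[OF x d, of n 1] by simp
    moreover have "I \<le> F (x n) + (q (x n) ?d - f \<bullet> ?d) / 2 + q ?d ?d / 8"
      using I_le[OF S_add(1)[OF x S_scale(1)[OF d]], of n "1 / 2"] var[OF x d, of n "1 / 2"]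
      by (simp add: power2_eq_square)
    ultimately show ?thesis by (simp add: field_simps)
  qed
  have qC: "q_Cauchy x"
    unfolding q_Cauchy_def
  proof (intro conjI allI impI x)
    fix e :: real assume "0 < e"
    then obtain M where M: "inverse (real (Suc M)) < e / 8"
      using reals_Archimedean[of "e / 8"] by auto
    have small: "F (x n) - I < e / 8" if "n \<ge> M" for n
    proof -
      have "inverse (real (Suc n)) \<le> inverse (real (Suc M))"
        using that by (intro le_imp_inverse_le) auto
      thus ?thesis using x_lt[of n] M by linarith
    qed
    have "q (x m - x n) (x m - x n) < e" if "m \<ge> M" "n \<ge> M" for m n
      using diff[of m n] small[OF that(1)] small[OF that(2)] by (simp add: algebra_simps)
    thus "\<exists>M. \<forall>m\<ge>M. \<forall>n\<ge>M. q (x m - x n) (x m - x n) < e" by blast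
  qed
  then obtain u where u: "x \<longlonglongrightarrow> u"
    using q_Cauchy_imp_Cauchy Cauchy_convergent convergent_def by blast
  have "s v \<bullet> u = v \<bullet> (f - lam *\<^sub>R u)" if v: "v \<in> Domain S" for v
  proof -
    \<comment> \<open>The infimum need not be attained in \<open>Domain S\<close>. Minimising along
      the line through \<open>x n\<close> in direction \<open>v\<close> bounds the directional
      derivative by the excess energy, so the Euler equation holds in the limit.\<close>
    have grad: "(q (x n) v - f \<bullet> v)\<^sup>2 \<le> 2 * q v v * inverse (real (Suc n))" for n
    proof (cases "v = 0")
      case False
      have pos: "0 < q v v" using q_nonneg[OF v] q_eq_0_iff[OF v] False by simp
      let ?g = "q (x n) v - f \<bullet> v"
      have "I \<le> F (x n) + (- ?g / q v v) * ?g + (- ?g / q v v)\<^sup>2 * q v v / 2"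
        using I_le[OF S_add(1)[OF x S_scale(1)[OF v]]] var[OF x v] by metis
      also have "\<dots> = F (x n) - ?g\<^sup>2 / (2 * q v v)" using pos by (simp add: field_simps power2_eq_square)
      finally have "?g\<^sup>2 / (2 * q v v) \<le> inverse (real (Suc n))" using x_lt[of n] by linarith
      thus ?thesis using pos by (simp add: pos_divide_le_eq mult.commute)
    qed (simp add: q_def)
    have "(\<lambda>n. 2 * q v v * inverse (real (Suc n))) \<longlonglongrightarrow> 2 * q v v * 0"
      by (intro tendsto_intros LIMSEQ_inverse_real_of_nat)
    hence lim: "(\<lambda>n. 2 * q v v * inverse (real (Suc n))) \<longlonglongrightarrow> 0" by simp
    have "(\<lambda>n. (q (x n) v - f \<bullet> v)\<^sup>2) \<longlonglongrightarrow> 0"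
      by (rule Lim_null_comparison[OF always_eventually lim]) (use grad in simp)
    moreover have "(\<lambda>n. (q (x n) v - f \<bullet> v)\<^sup>2) \<longlonglongrightarrow> ((s v + lam *\<^sub>R v) \<bullet> u - f \<bullet> v)\<^sup>2"
    proof -
      have "q (x n) v = (s v + lam *\<^sub>R v) \<bullet> x n" for n using q_sym[OF x v] by (simp add: q_def)
      thus ?thesis by (simp only:) (intro tendsto_intros u)
    qed
    ultimately have "((s v + lam *\<^sub>R v) \<bullet> u - f \<bullet> v)\<^sup>2 = 0" using LIMSEQ_unique by blast
    thus ?thesis by (simp add: inner_add_left inner_diff_right inner_commute[of v])
  qed
  hence "(u, f - lam *\<^sub>R u) \<in> op_adjoint S" by (simp add: op_adjoint_def)
  moreover have "u \<in> closed_form_domain S" using qC u closed_form_domain_iff by blast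
  ultimately show ?thesis using that[of u "f - lam *\<^sub>R u"] by (simp add: friedrichs_extension_def)
qed

end

section \<open>Extensions parametrised by maximal monotone relations\<close>

context semibounded_operator
begin

section \<open>Resolvent and graph metric of the Friedrichs extension\<close>

abbreviation "a0 \<equiv> op_app A0"

abbreviation "R \<equiv> resolvent A0 lam"

lemmas A0_add = linear_operator_add[OF linear_operator_A0]
  and A0_scale = linear_operator_scale[OF linear_operator_A0]
  and A0_diff = linear_operator_diff[OF linear_operator_A0]
  and A0_zero = linear_operator_zero[OF linear_operator_A0]
  and A0_graph = linear_operator_graph[OF linear_operator_A0]
  and A0_eq = linear_operator_eq[OF linear_operator_A0]

lemma a0_eq_s: "v \<in> Domain S \<Longrightarrow> v \<in> Domain A0 \<and> a0 v = s v"
  using S_subset_A0 linear_operator_graph[OF linear] A0_eq by blast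

lemma a0_coercive: "u \<in> Domain A0 \<Longrightarrow> (lam - \<omega>) * (norm u)\<^sup>2 \<le> (a0 u + lam *\<^sub>R u) \<bullet> u"
  by (rule A0_coercive[OF A0_graph])

lemma a0_coercive_norm:
  assumes "u \<in> Domain A0"
  shows "(lam - \<omega>) * norm u \<le> norm (a0 u + lam *\<^sub>R u)"
proof -
  have "(lam - \<omega>) * (norm u)\<^sup>2 \<le> norm (a0 u + lam *\<^sub>R u) * norm u"
    using a0_coercive[OF assms] norm_cauchy_schwarz order_trans by blast
  thus ?thesis by (cases "norm u = 0") (auto simp: power2_eq_square simp flip: mult.assoc)
qed

lemma a0_symmetric: "u \<in> Domain A0 \<Longrightarrow> v \<in> Domain A0 \<Longrightarrow> a0 u \<bullet> v = u \<bullet> a0 v"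
  by (rule A0_symmetric[OF A0_graph A0_graph])

lemma resolvent_exists: "\<exists>!u. u \<in> Domain A0 \<and> a0 u + lam *\<^sub>R u = f"
proof -
  obtain u w where uw: "(u, w) \<in> A0" "w + lam *\<^sub>R u = f" using A0_plus_lam_onto .
  show ?thesis
  proof (rule ex1I[of _ u])
    show "u \<in> Domain A0 \<and> a0 u + lam *\<^sub>R u = f" using uw A0_eq by auto
    fix v assume v: "v \<in> Domain A0 \<and> a0 v + lam *\<^sub>R v = f"
    have u: "u \<in> Domain A0" "a0 u + lam *\<^sub>R u = f" using uw A0_eq by auto
    have "a0 (v - u) + lam *\<^sub>R (v - u) = (a0 v + lam *\<^sub>R v) - (a0 u + lam *\<^sub>R u)"
      using u v by (simp add: A0_diff(2) algebra_simps)
    hence "(lam - \<omega>) * norm (v - u) \<le> 0"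
      using a0_coercive_norm[OF A0_diff(1), of v u] u v by simp
    thus "v = u" using lam by (simp add: mult_le_0_iff)
  qed
qed

lemma R_dom: "R f \<in> Domain A0" and R_eq: "a0 (R f) + lam *\<^sub>R R f = f"
  using theI'[OF resolvent_exists[of f]] unfolding resolvent_def by auto

lemma R_unique: "u \<in> Domain A0 \<Longrightarrow> a0 u + lam *\<^sub>R u = f \<Longrightarrow> R f = u"
  using resolvent_exists[of f] R_dom R_eq by blast

lemma R_norm: "norm (R f) \<le> norm f / (lam - \<omega>)"
  using a0_coercive_norm[OF R_dom, of f] lam by (simp add: R_eq pos_le_divide_eq mult.commute)

lemma R_add: "R (f + g) = R f + R g"
proof (rule R_unique)
  show "a0 (R f + R g) + lam *\<^sub>R (R f + R g) = f + g"
    using R_eq[of f] R_eq[of g] by (simp add: A0_add(2) R_dom algebra_simps)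
qed (intro A0_add R_dom)

lemma R_scale: "R (r *\<^sub>R f) = r *\<^sub>R R f"
proof (rule R_unique)
  have "a0 (r *\<^sub>R R f) + lam *\<^sub>R (r *\<^sub>R R f) = r *\<^sub>R (a0 (R f) + lam *\<^sub>R R f)"
    by (simp add: A0_scale(2) R_dom algebra_simps)
  thus "a0 (r *\<^sub>R R f) + lam *\<^sub>R (r *\<^sub>R R f) = r *\<^sub>R f" by (simp only: R_eq)
qed (intro A0_scale R_dom)

lemma graph_dist_eq:
  assumes "u \<in> Domain A0" "v \<in> Domain A0"
  shows "graph_dist A0 u v = dist (a0 u, u) (a0 v, v)"
  using assms by (simp add: graph_dist_def graph_inner_def dist_norm norm_Pair A0_diff dot_square_norm)

lemma Metric_space_graph: "Metric_space (Domain A0) (graph_dist A0)"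
proof
  show "0 \<le> graph_dist A0 u v" for u v by (simp add: graph_dist_def graph_inner_def)
  show "graph_dist A0 u v = graph_dist A0 v u" for u v
  proof (cases "u - v \<in> Domain A0")
    case True
    have "a0 (v - u) = - a0 (u - v)"
      using A0_scale(2)[OF True, of "-1"] by simp
    moreover have "v - u = - (u - v)" by simp
    ultimately show ?thesis unfolding graph_dist_def graph_inner_def by (simp only: inner_minus_left inner_minus_right minus_minus)
  next
    \<comment> \<open>\<open>Metric_space\<close> asks for symmetry on the whole type. Off the
      domain \<open>op_app\<close> describes an unsatisfiable predicate, so it has the same default
      value at both differences.\<close>
    case False
    have "v - u \<notin> Domain A0" using A0_scale(1)[of "v - u" "-1"] False by auto
    with False have "a0 (v - u) = a0 (u - v)" unfolding op_app_def by (metis DomainI)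
    moreover have "v - u = - (u - v)" by simp
    ultimately show ?thesis unfolding graph_dist_def graph_inner_def by (metis inner_minus_left inner_minus_right minus_minus)
  qed
qed (auto simp: graph_dist_eq dist_triangle)

end

locale boundary_map = semibounded_operator S \<omega> lam
  for S :: "('a::{real_inner,complete_space} \<times> 'a) set" and \<omega> lam :: real +
  fixes \<tau> :: "'a \<Rightarrow> 'b::{real_inner,complete_space}"
  assumes tau_linear: "linear_map_on (Domain A0) \<tau>"
    and tau_continuous: "continuous_map (graph_topology A0) euclidean \<tau>"
    and tau_surj: "\<tau> ` Domain A0 = UNIV"
    and S_domain: "Domain S = {u \<in> Domain A0. \<tau> u = 0}"
begin

section \<open>The boundary map, the range of \<open>G\<close> and the adjoint of
  \<open>S\<close>\<close>

lemma tau_add: "u \<in> Domain A0 \<Longrightarrow> v \<in> Domain A0 \<Longrightarrow> \<tau> (u + v) = \<tau> u + \<tau> v"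
  and tau_scale: "u \<in> Domain A0 \<Longrightarrow> \<tau> (r *\<^sub>R u) = r *\<^sub>R \<tau> u"
  using tau_linear by (auto simp: linear_map_on_def)

lemma tau_diff: "u \<in> Domain A0 \<Longrightarrow> v \<in> Domain A0 \<Longrightarrow> \<tau> (u - v) = \<tau> u - \<tau> v"
  using tau_add[of u "(-1) *\<^sub>R v"] tau_scale[of v "-1"] A0_scale(1)[of v "-1"] by simp

lemma tau_zero: "\<tau> 0 = 0"
  using tau_scale[OF A0_zero(1), of 0] by simp

lemma tau_bounded:
  obtains K where "0 \<le> K" "\<And>u. u \<in> Domain A0 \<Longrightarrow> norm (\<tau> u) \<le> K * (norm (a0 u) + norm u)"
proof -
  interpret Metric_space "Domain A0" "graph_dist A0" by (rule Metric_space_graph)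
  have "openin mtopology {u \<in> topspace mtopology. \<tau> u \<in> ball 0 1}"
    using tau_continuous unfolding graph_topology_def
    by (rule openin_continuous_map_preimage) simp
  hence "\<exists>r>0. mball 0 r \<subseteq> {u \<in> Domain A0. \<tau> u \<in> ball 0 1}"
    unfolding openin_mtopology by (simp add: A0_zero tau_zero)
  then obtain r where r: "0 < r" "\<And>u. u \<in> mball 0 r \<Longrightarrow> norm (\<tau> u) < 1" by (auto simp: subset_iff)
  have "norm (\<tau> u) \<le> 2 / r * (norm (a0 u) + norm u)" if u: "u \<in> Domain A0" for u
  proof (cases "u = 0")
    case False
    define n where "n = norm (a0 u) + norm u"
    have n: "0 < n" using False by (simp add: n_def add_nonneg_pos)
    let ?c = "r / (2 * n)"
    have c: "0 < ?c" using n r by simp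
    have "graph_dist A0 0 (?c *\<^sub>R u) = dist 0 (?c *\<^sub>R (a0 u, u))"
      by (subst graph_dist_eq) (simp_all add: A0_zero A0_scale u zero_prod_def)
    also have "\<dots> = ?c * norm (a0 u, u)" using c by (simp only: dist_0_norm norm_scaleR abs_of_pos)
    also have "\<dots> \<le> ?c * n" using c norm_Pair_le[of "a0 u" u] by (intro mult_left_mono) (auto simp: n_def)
    also have "\<dots> < r" using n r by simp
    finally have "norm (\<tau> (?c *\<^sub>R u)) < 1" by (intro r) (simp add: A0_zero A0_scale u)
    hence "?c * norm (\<tau> u) < 1" unfolding tau_scale[OF u] norm_scaleR abs_of_pos[OF c] .
    thus ?thesis using n r unfolding n_def[symmetric] by (simp add: field_simps)
  qed (simp add: tau_zero A0_zero)
  thus ?thesis using that[of "2 / r"] r by simp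
qed

definition T :: "'a \<Rightarrow> 'b" where "T f = \<tau> (R f)"

abbreviation G :: "'b \<Rightarrow> 'a" where "G \<equiv> adjoint T"

lemma G_map_eq: "G_map A0 \<tau> lam = G"
  by (simp add: G_map_def T_def[abs_def])

lemma T_bounded_linear: "bounded_linear T"
proof -
  obtain K where K: "0 \<le> K" "\<And>u. u \<in> Domain A0 \<Longrightarrow> norm (\<tau> u) \<le> K * (norm (a0 u) + norm u)"
    using tau_bounded by metis
  show ?thesis
  proof (rule bounded_linear_intro)
    show "T (f + g) = T f + T g" for f g by (simp add: T_def R_add tau_add R_dom)
    show "T (r *\<^sub>R f) = r *\<^sub>R T f" for r f by (simp add: T_def R_scale tau_scale R_dom)
    fix f
    have "a0 (R f) = f - lam *\<^sub>R R f" using R_eq[of f] by (simp add: algebra_simps)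
    hence "norm (a0 (R f)) \<le> norm f + \<bar>lam\<bar> * norm (R f)"
      using norm_triangle_ineq4[of f "lam *\<^sub>R R f"] by simp
    hence "norm (a0 (R f)) + norm (R f) \<le> norm f + (\<bar>lam\<bar> + 1) * norm (R f)"
      by (simp add: algebra_simps)
    also have "\<dots> \<le> norm f + (\<bar>lam\<bar> + 1) * (norm f / (lam - \<omega>))"
      by (intro add_left_mono mult_left_mono R_norm) simp
    finally have "norm (T f) \<le> K * (norm f + (\<bar>lam\<bar> + 1) * (norm f / (lam - \<omega>)))"
      using K(2)[OF R_dom, of f] K(1) unfolding T_def by (meson mult_left_mono order_trans)
    thus "norm (T f) \<le> norm f * (K * (1 + (\<bar>lam\<bar> + 1) / (lam - \<omega>)))"
      by (simp add: algebra_simps)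
  qed
qed

lemma T_surj: "surj T"
proof -
  have "\<exists>f. T f = \<eta>" for \<eta>
  proof -
    obtain u where "u \<in> Domain A0" "\<tau> u = \<eta>" using tau_surj by (metis UNIV_I imageE)
    hence "T (a0 u + lam *\<^sub>R u) = \<eta>" by (simp add: T_def R_unique)
    thus ?thesis by blast
  qed
  thus ?thesis by (metis surjI)
qed

lemma G_bounded_linear: "bounded_linear G"
  by (rule bounded_linear_adjoint[OF T_bounded_linear])

sublocale G: bounded_linear G
  by (rule G_bounded_linear)

text \<open>The adjoint relation with \<open>f\<close> written as \<open>(A0 + lam) u\<close>; for
  \<open>\<tau> u = 0\<close> it says that the range of \<open>G\<close> is orthogonal to the range
  of \<open>S + lam\<close>.\<close>

lemma G_inner: "u \<in> Domain A0 \<Longrightarrow> (a0 u + lam *\<^sub>R u) \<bullet> G \<xi> = \<tau> u \<bullet> \<xi>"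
  by (simp add: T_def R_unique flip: adjoint_inner[OF T_bounded_linear])

lemma G_eq_0: "G \<xi> = 0 \<Longrightarrow> \<xi> = 0"
proof -
  assume "G \<xi> = 0"
  moreover obtain f where "T f = \<xi>" using T_surj by (metis surjD)
  ultimately have "\<xi> \<bullet> \<xi> = 0" using adjoint_inner[OF T_bounded_linear, of f \<xi>] by simp
  thus "\<xi> = 0" by simp
qed

text \<open>Symmetry moves \<open>A0 + lam\<close> over to \<open>G \<xi>\<close>, and the result is
  orthogonal to the dense \<open>Domain S\<close>, where \<tau> vanishes. So \<open>G \<xi>\<close>
  lies in the kernel of \<open>A0 + lam\<close>, which is zero. Uniqueness of the decomposition
  rests on this.\<close>

lemma G_in_domain:
  assumes "G \<xi> \<in> Domain A0"
  shows "\<xi> = 0"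
proof -
  have "v \<bullet> (a0 (G \<xi>) + lam *\<^sub>R G \<xi>) = 0" if "v \<in> Domain S" for v
  proof -
    have v: "v \<in> Domain A0" "\<tau> v = 0" using that S_domain by auto
    show ?thesis
      using G_inner[OF v(1), of \<xi>] a0_symmetric[OF v(1) assms] v(2)
      by (simp add: inner_add_left inner_add_right)
  qed
  hence "a0 (G \<xi>) + lam *\<^sub>R G \<xi> = 0"
    using dense orthogonal_to_dense_imp_zero unfolding densely_defined_def by blast
  hence "G \<xi> = R 0" using R_unique[OF assms] by simp
  also have "\<dots> = 0" using R_scale[of 0 0] by simp
  finally show ?thesis by (rule G_eq_0)
qed

lemma decomposition_unique:
  assumes "u \<in> Domain A0" "v \<in> Domain A0" "u + G \<xi> = v + G \<zeta>"
  shows "u = v" "\<xi> = \<zeta>"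
proof -
  have "G (\<xi> - \<zeta>) = v - u" using assms(3) by (simp add: G.diff algebra_simps)
  hence "G (\<xi> - \<zeta>) \<in> Domain A0" using assms A0_diff(1) by simp
  from G_in_domain[OF this] show "\<xi> = \<zeta>" by simp
  thus "u = v" using assms(3) by simp
qed

lemma op_adjoint_S:
  "op_adjoint S = {(u + G \<xi>, a0 u - lam *\<^sub>R G \<xi>) | u \<xi>. u \<in> Domain A0}"
proof (intro equalityI subsetI)
  fix p assume p: "p \<in> op_adjoint S"
  obtain u w where uw: "p = (u, w)" by force
  \<comment> \<open>The choice is forced: the adjoint plus \<open>lam\<close> has to send
    \<open>u0 + G \<xi>\<close> to \<open>(A0 + lam) u0\<close>.\<close>
  define u0 where "u0 = R (w + lam *\<^sub>R u)"
  have u0: "u0 \<in> Domain A0" "a0 u0 + lam *\<^sub>R u0 = w + lam *\<^sub>R u"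
    using R_dom R_eq by (auto simp: u0_def)
  \<comment> \<open>\<open>T x = 0\<close> places \<open>R x\<close> in \<open>Domain S\<close>, so
    \<open>x\<close> is in the range of \<open>S + lam\<close> and the adjoint relation applies to
    it.\<close>
  have "x \<bullet> (u - u0) = 0" if "T x = 0" for x
  proof -
    have v: "R x \<in> Domain S" using that by (simp add: S_domain T_def R_dom)
    have sx: "s (R x) + lam *\<^sub>R R x = x" using R_eq[of x] a0_eq_s[OF v] by simp
    have "x \<bullet> u = R x \<bullet> (w + lam *\<^sub>R u)"
      using op_adjointD[OF p[unfolded uw] v] by (subst (1) sx[symmetric]) (simp add: inner_add)
    also have "\<dots> = R x \<bullet> (a0 u0 + lam *\<^sub>R u0)" by (simp add: u0)
    also have "\<dots> = (a0 (R x) + lam *\<^sub>R R x) \<bullet> u0"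
      using a0_symmetric[OF R_dom u0(1)] by (simp add: inner_add)
    also have "\<dots> = x \<bullet> u0" by (simp only: R_eq)
    finally show ?thesis by (simp add: inner_diff_right)
  qed
  hence "u - u0 \<in> range G"
    by (intro orthogonal_kernel_in_range_adjoint T_bounded_linear T_surj)
  then obtain \<xi> where "u - u0 = G \<xi>" by blast
  hence \<xi>: "u = u0 + G \<xi>" by (simp add: algebra_simps)
  moreover have "w = a0 u0 - lam *\<^sub>R G \<xi>" using u0(2) by (simp add: \<xi> algebra_simps)
  ultimately show "p \<in> {(u + G \<xi>, a0 u - lam *\<^sub>R G \<xi>) | u \<xi>. u \<in> Domain A0}"
    using u0(1) uw by blast
next
  fix p assume "p \<in> {(u + G \<xi>, a0 u - lam *\<^sub>R G \<xi>) | u \<xi>. u \<in> Domain A0}"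
  then obtain u \<xi> where u: "u \<in> Domain A0" and p: "p = (u + G \<xi>, a0 u - lam *\<^sub>R G \<xi>)" by blast
  have "s v \<bullet> (u + G \<xi>) = v \<bullet> (a0 u - lam *\<^sub>R G \<xi>)" if "v \<in> Domain S" for v
  proof -
    have v: "v \<in> Domain A0" "\<tau> v = 0" "a0 v = s v" using that[unfolded S_domain] a0_eq_s[OF that] by auto
    have "(s v + lam *\<^sub>R v) \<bullet> G \<xi> = 0" using G_inner[OF v(1), of \<xi>] v by simp
    moreover have "s v \<bullet> u = v \<bullet> a0 u" using a0_symmetric[OF v(1) u] v(3) by simp
    ultimately show ?thesis by (simp add: inner_add inner_diff)
  qed
  thus "p \<in> op_adjoint S" by (simp add: op_adjoint_def p)
qed

end

section \<open>The operator defined by a maximal monotone relation\<close>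

locale maximal_monotone_boundary = boundary_map S \<omega> lam \<tau>
  for S :: "('a::{real_inner,complete_space} \<times> 'a) set" and \<omega> lam :: real
    and \<tau> :: "'a \<Rightarrow> 'b::{real_inner,complete_space}" +
  fixes \<Theta> :: "('b \<times> 'b) set"
  assumes Theta: "maximal_monotone_relation \<Theta>"
begin

abbreviation "AT \<equiv> extension_operator A0 \<tau> lam \<Theta>"

lemma AT_iff: "(x, y) \<in> AT \<longleftrightarrow>
    (\<exists>u \<xi>. u \<in> Domain A0 \<and> (\<xi>, \<tau> u) \<in> \<Theta> \<and> x = u + G \<xi> \<and> y = a0 u - lam *\<^sub>R G \<xi>)"
  unfolding extension_operator_def G_map_eq by blast

lemma AT_mono:
  assumes "(x, y) \<in> AT" "(x', y') \<in> AT"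
  shows "- lam * (norm (x - x'))\<^sup>2 \<le> (y - y') \<bullet> (x - x')"
proof -
  obtain u \<xi> v \<zeta> where u: "u \<in> Domain A0" "(\<xi>, \<tau> u) \<in> \<Theta>" "x = u + G \<xi>" "y = a0 u - lam *\<^sub>R G \<xi>"
    and v: "v \<in> Domain A0" "(\<zeta>, \<tau> v) \<in> \<Theta>" "x' = v + G \<zeta>" "y' = a0 v - lam *\<^sub>R G \<zeta>"
    using assms unfolding AT_iff by blast
  have d: "u - v \<in> Domain A0" by (intro A0_diff u v)
  have x: "x - x' = (u - v) + G (\<xi> - \<zeta>)" by (simp add: u v G.diff)
  have "(y - y') + lam *\<^sub>R (x - x') = a0 (u - v) + lam *\<^sub>R (u - v)"
    by (simp add: u v A0_diff(2) algebra_simps)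
  hence "(y - y') \<bullet> (x - x') + lam * (norm (x - x'))\<^sup>2
      = (a0 (u - v) + lam *\<^sub>R (u - v)) \<bullet> ((u - v) + G (\<xi> - \<zeta>))"
    by (metis x dot_square_norm inner_add_left inner_scaleR_left)
  also have "\<dots> = (a0 (u - v) + lam *\<^sub>R (u - v)) \<bullet> (u - v) + (\<tau> u - \<tau> v) \<bullet> (\<xi> - \<zeta>)"
    using G_inner[OF d, of "\<xi> - \<zeta>"] by (simp add: inner_add_right tau_diff u v)
  also have "0 \<le> \<dots>"
  proof (rule add_nonneg_nonneg)
    show "0 \<le> (a0 (u - v) + lam *\<^sub>R (u - v)) \<bullet> (u - v)"
      by (rule order_trans[OF _ a0_coercive[OF d]]) (use lam in simp)
    show "0 \<le> (\<tau> u - \<tau> v) \<bullet> (\<xi> - \<zeta>)"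
      using Theta u(2) v(2) by (intro monotone_relationD[of \<Theta>]) (auto simp: maximal_monotone_relation_def)
  qed
  finally show ?thesis by linarith
qed

lemma AT_single_valued: "single_valued AT"
proof (rule single_valuedI)
  fix x y z assume "(x, y) \<in> AT" "(x, z) \<in> AT"
  then obtain u \<xi> v \<zeta> where u: "u \<in> Domain A0" "x = u + G \<xi>" "y = a0 u - lam *\<^sub>R G \<xi>"
    and v: "v \<in> Domain A0" "x = v + G \<zeta>" "z = a0 v - lam *\<^sub>R G \<zeta>"
    unfolding AT_iff by blast
  have "u + G \<xi> = v + G \<zeta>" using u v by simp
  from decomposition_unique[OF u(1) v(1) this] show "y = z" by (simp add: u v)
qed

text \<open>
  With \<open>u = R' (f - \<epsilon> G \<xi>)\<close>, where \<open>R'\<close> is the resolvent at \<open>lam + \<epsilon>\<close>, the equation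
  \<open>(AT + lam + \<epsilon>) (u + G \<xi>) = f\<close> reduces to \<open>\<tau> (R' f) \<in> \<Theta> \<xi> + M \<xi>\<close> with the coercive map
  \<open>M \<xi> = \<epsilon> \<tau> (R' (G \<xi>))\<close>.
\<close>

lemma AT_onto:
  assumes \<nu>: "lam < \<nu>"
  shows "\<exists>x y. (x, y) \<in> AT \<and> y + \<nu> *\<^sub>R x = f"
proof -
  define \<epsilon> where "\<epsilon> = \<nu> - lam"
  have \<epsilon>: "0 < \<epsilon>" "\<nu> = lam + \<epsilon>" using \<nu> by (auto simp: \<epsilon>_def)
  \<comment> \<open>The same boundary data with the shift \<nu>: \<open>E.R\<close> and
    \<open>E.T\<close> belong to \<nu>, while \<open>G\<close> keeps the shift
    \<open>lam\<close>.\<close>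
  interpret E: boundary_map S \<omega> \<nu> \<tau>
    by unfold_locales
      (use symmetric dense below lam \<nu> tau_linear tau_continuous tau_surj S_domain in auto)
  interpret ET: bounded_linear E.T by (rule E.T_bounded_linear)
  define M where "M \<xi> = \<epsilon> *\<^sub>R E.T (G \<xi>)" for \<xi>
  have M: "bounded_linear M"
    unfolding M_def
    by (intro bounded_linear_compose[OF bounded_linear_scaleR_right]
        bounded_linear_compose[OF E.T_bounded_linear G_bounded_linear])
  obtain g where g: "0 < g" "\<And>\<xi>. g * norm \<xi> \<le> norm (G \<xi>)"
    using adjoint_bounded_below[OF T_bounded_linear T_surj] by metis
  define c where "c = lam - \<omega>"
  have c: "0 < c" using lam by (simp add: c_def)
  define d where "d = 1 + \<epsilon> / c"
  have d: "0 < d" using \<epsilon> c by (simp add: d_def add_pos_pos)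
  have coercive: "\<epsilon> * (g / d)\<^sup>2 * (norm \<xi>)\<^sup>2 \<le> M \<xi> \<bullet> \<xi>" for \<xi>
  proof -
    define y where "y = E.R (G \<xi>)"
    \<comment> \<open>\<open>b\<close> is \<open>(A0 + lam) y\<close>, so
      \<open>b \<bullet> G \<xi>\<close> equals \<open>\<tau> y \<bullet> \<xi>\<close> by
      \<open>G_inner\<close>. As \<open>G \<xi> = b + \<epsilon> *\<^sub>R y\<close>, it also
      dominates \<open>(norm b)\<^sup>2\<close>, and \<open>d\<close> compares \<open>norm b\<close>
      with \<open>norm (G \<xi>)\<close>.\<close>
    define b where "b = a0 y + lam *\<^sub>R y"
    have Gb: "G \<xi> = b + \<epsilon> *\<^sub>R y"
      using E.R_eq[of "G \<xi>"] by (simp add: b_def y_def \<epsilon>(2) algebra_simps)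
    have yb: "c * norm y \<le> norm b" "c * (norm y)\<^sup>2 \<le> b \<bullet> y"
      unfolding c_def b_def y_def by (rule a0_coercive_norm[OF E.R_dom], rule a0_coercive[OF E.R_dom])
    have "0 \<le> c * (norm y)\<^sup>2" using c by simp
    with yb(2) have b_y: "0 \<le> b \<bullet> y" by linarith
    have "norm (G \<xi>) \<le> norm b + \<epsilon> * norm y"
      unfolding Gb using norm_triangle_ineq[of b "\<epsilon> *\<^sub>R y"] \<epsilon>(1) by simp
    also have "\<dots> \<le> norm b + \<epsilon> * (norm b / c)"
      using yb(1) c \<epsilon>(1) by (intro add_left_mono mult_left_mono) (auto simp: pos_le_divide_eq mult.commute)
    also have "\<dots> = d * norm b" by (simp add: d_def algebra_simps)
    finally have "g * norm \<xi> \<le> d * norm b" using g(2) order_trans by blast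
    hence "g / d * norm \<xi> \<le> norm b" using d by (simp add: pos_divide_le_eq mult.commute)
    hence "(g / d * norm \<xi>)\<^sup>2 \<le> (norm b)\<^sup>2" using g(1) d by (intro power_mono) auto
    also have "(norm b)\<^sup>2 \<le> b \<bullet> G \<xi>"
      using b_y \<epsilon>(1) unfolding Gb by (simp add: inner_add_right dot_square_norm)
    also have "b \<bullet> G \<xi> = E.T (G \<xi>) \<bullet> \<xi>"
      unfolding b_def y_def by (subst G_inner[OF E.R_dom]) (simp add: E.T_def)
    finally have "\<epsilon> * (g / d * norm \<xi>)\<^sup>2 \<le> \<epsilon> * (E.T (G \<xi>) \<bullet> \<xi>)"
      using \<epsilon>(1) by (intro mult_left_mono) auto
    thus ?thesis by (simp add: M_def power_mult_distrib power_divide mult.assoc)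
  qed
  have "0 < \<epsilon> * (g / d)\<^sup>2" using \<epsilon> g d by simp
  then obtain \<xi> \<eta> where \<xi>: "(\<xi>, \<eta>) \<in> \<Theta>" "\<eta> + M \<xi> = E.T f"
    using maximal_monotone_plus_coercive_onto[OF Theta M _ coercive] by metis
  define u where "u = E.R (f - \<epsilon> *\<^sub>R G \<xi>)"
  have u: "u \<in> Domain A0" "a0 u + \<nu> *\<^sub>R u = f - \<epsilon> *\<^sub>R G \<xi>"
    unfolding u_def by (rule E.R_dom, rule E.R_eq)
  have "\<tau> u = E.T (f - \<epsilon> *\<^sub>R G \<xi>)" by (simp add: u_def E.T_def)
  also have "\<dots> = \<eta>" using \<xi>(2) by (simp add: ET.diff ET.scale M_def algebra_simps)
  finally have "(u + G \<xi>, a0 u - lam *\<^sub>R G \<xi>) \<in> AT" using u(1) \<xi>(1) unfolding AT_iff by blast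
  moreover have "(a0 u - lam *\<^sub>R G \<xi>) + \<nu> *\<^sub>R (u + G \<xi>) = f"
    using u(2) by (simp add: \<epsilon>(2) algebra_simps)
  ultimately show ?thesis by blast
qed

sublocale AT: quasi_maximal_monotone AT lam
  by unfold_locales (fact AT_single_valued AT_mono AT_onto)+

lemma maximal_monotone_operator_AT: "maximal_monotone_operator_of_type lam AT"
proof -
  have "(\<lambda>u. op_app AT u + (lam + 1) *\<^sub>R u) ` Domain AT = UNIV"
  proof (intro equalityI subset_UNIV subsetI)
    fix f :: 'a
    obtain x y where "(x, y) \<in> AT" "y + (lam + 1) *\<^sub>R x = f" using AT_onto[of "lam + 1" f] by auto
    thus "f \<in> (\<lambda>u. op_app AT u + (lam + 1) *\<^sub>R u) ` Domain AT" using AT.a_eq by force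
  qed
  thus ?thesis
    unfolding maximal_monotone_operator_of_type_def monotone_operator_of_type_def
    using AT_single_valued AT.a_mono by (auto intro!: exI[of _ "lam + 1"])
qed

section \<open>Domains, generation and the intersection with \<open>Domain A0\<close>\<close>

lemma AT_subset_adjoint: "AT \<subseteq> op_adjoint S"
  unfolding op_adjoint_S extension_operator_def G_map_eq by blast

lemma in_AT_if_zero: "u \<in> Domain A0 \<Longrightarrow> (0, \<tau> u) \<in> \<Theta> \<Longrightarrow> (u, a0 u) \<in> AT"
  unfolding AT_iff by (intro exI[of _ u] exI[of _ 0]) (simp add: G.zero)

lemma A0_inter_AT: "Domain A0 \<inter> Domain AT = {u \<in> Domain A0. (0, \<tau> u) \<in> \<Theta>}"
proof (intro equalityI subsetI)
  fix u assume u: "u \<in> Domain A0 \<inter> Domain AT"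
  then obtain y where "(u, y) \<in> AT" by blast
  then obtain v \<xi> where v: "v \<in> Domain A0" "(\<xi>, \<tau> v) \<in> \<Theta>" "u = v + G \<xi>"
    unfolding AT_iff by blast
  have "u + G 0 = v + G \<xi>" using v(3) by (simp add: G.zero)
  from decomposition_unique[OF _ v(1) this] u v(2)
  show "u \<in> {u \<in> Domain A0. (0, \<tau> u) \<in> \<Theta>}" by auto
qed (use in_AT_if_zero in blast)

text \<open>From left to right the single point zero suffices: it lies in \<open>Domain A0\<close>,
  and \<tau> maps it to zero.\<close>

lemma Domain_S_subset_iff: "Domain S \<subseteq> Domain AT \<longleftrightarrow> (0, 0) \<in> \<Theta>"
proof
  assume "Domain S \<subseteq> Domain AT"
  hence "0 \<in> Domain A0 \<inter> Domain AT" using linear_operator_zero(1)[OF linear] A0_zero(1) by blast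
  thus "(0, 0) \<in> \<Theta>" unfolding A0_inter_AT by (simp add: tau_zero)
next
  assume "(0, 0) \<in> \<Theta>"
  thus "Domain S \<subseteq> Domain AT" using A0_inter_AT unfolding S_domain by auto
qed

lemma S_subset_iff: "S \<subseteq> AT \<longleftrightarrow> Domain S \<subseteq> Domain AT"
proof
  assume "Domain S \<subseteq> Domain AT"
  hence zero: "(0, 0) \<in> \<Theta>" by (simp add: Domain_S_subset_iff)
  show "S \<subseteq> AT"
  proof clarify
    fix u w assume "(u, w) \<in> S"
    hence u: "u \<in> Domain S" "a0 u = w" using a0_eq_s linear_operator_eq[OF linear] by auto
    thus "(u, w) \<in> AT" using in_AT_if_zero[of u] zero by (auto simp: S_domain)
  qed
qed blast

lemma dense_AT: "(0, 0) \<in> \<Theta> \<Longrightarrow> closure (Domain AT) = UNIV"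
  using dense closure_mono[of "Domain S" "Domain AT"] Domain_S_subset_iff
  unfolding densely_defined_def by blast

lemma AT_generates:
  assumes "(0, 0) \<in> \<Theta>"
  shows "\<exists>U. nonlinear_semigroup lam U \<and> semigroup_generator U = AT"
proof -
  interpret D: dense_quasi_maximal_monotone AT lam
    by unfold_locales (rule dense_AT[OF assms])
  show ?thesis using D.nonlinear_semigroup_T D.semigroup_generator_T by blast
qed

lemma A0_inter_AT_nonempty_iff: "Domain A0 \<inter> Domain AT \<noteq> {} \<longleftrightarrow> 0 \<in> Domain \<Theta>"
proof
  assume "0 \<in> Domain \<Theta>"
  then obtain \<eta> where \<eta>: "(0, \<eta>) \<in> \<Theta>" by blast
  obtain u where "u \<in> Domain A0" "\<tau> u = \<eta>" using tau_surj by (metis UNIV_I imageE)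
  thus "Domain A0 \<inter> Domain AT \<noteq> {}" using \<eta> unfolding A0_inter_AT by blast
qed (use A0_inter_AT in blast)

lemma AT_eq_on_A0: "u \<in> Domain A0 \<inter> Domain AT \<Longrightarrow> op_app AT u = a0 u"
  using in_AT_if_zero AT.a_eq unfolding A0_inter_AT by blast

text \<open>Maximality makes the image of \<open>0\<close> under \<open>\<Theta>\<close> an intersection of closed half spaces.\<close>

lemma image_of_zero: "{\<eta>. (0, \<eta>) \<in> \<Theta>} = (\<Inter>q\<in>\<Theta>. {\<eta>. fst q \<bullet> \<eta> \<le> fst q \<bullet> snd q})"
proof -
  have "(0, \<eta>) \<in> \<Theta> \<longleftrightarrow> (\<forall>q\<in>\<Theta>. fst q \<bullet> \<eta> \<le> fst q \<bullet> snd q)" for \<eta>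
  proof
    assume "(0, \<eta>) \<in> \<Theta>"
    thus "\<forall>q\<in>\<Theta>. fst q \<bullet> \<eta> \<le> fst q \<bullet> snd q"
      using Theta monotone_relationD[of \<Theta> 0 \<eta>]
      by (auto simp: maximal_monotone_relation_def inner_diff inner_commute)
  next
    assume le: "\<forall>q\<in>\<Theta>. fst q \<bullet> \<eta> \<le> fst q \<bullet> snd q"
    show "(0, \<eta>) \<in> \<Theta>"
      by (rule maximal_monotoneD[OF Theta]) (use le in \<open>force simp: inner_diff inner_commute\<close>)
  qed
  thus ?thesis by auto
qed

text \<open>By \<open>A0_inter_AT\<close> the set is the preimage under \<tau> of the values of
  \<Theta> at zero, so convexity comes from the linearity of \<tau> and closedness from its
  continuity.\<close>

lemma convex_A0_inter_AT: "convex (Domain A0 \<inter> Domain AT)"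
proof -
  have cv: "convex {\<eta>. (0, \<eta>) \<in> \<Theta>}"
    unfolding image_of_zero by (intro convex_INT convex_halfspace_le)
  show ?thesis
    unfolding A0_inter_AT
  proof (rule convexI)
    fix u v and r t :: real
    assume u: "u \<in> {u \<in> Domain A0. (0, \<tau> u) \<in> \<Theta>}" and v: "v \<in> {u \<in> Domain A0. (0, \<tau> u) \<in> \<Theta>}"
      and rt: "0 \<le> r" "0 \<le> t" "r + t = 1"
    have "r *\<^sub>R \<tau> u + t *\<^sub>R \<tau> v \<in> {\<eta>. (0, \<eta>) \<in> \<Theta>}"
      by (rule convexD[OF cv]) (use u v rt in auto)
    thus "r *\<^sub>R u + t *\<^sub>R v \<in> {u \<in> Domain A0. (0, \<tau> u) \<in> \<Theta>}"
      using u v by (simp add: A0_add(1) A0_scale(1) tau_add tau_scale)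
  qed
qed

lemma closedin_A0_inter_AT: "closedin (graph_topology A0) (Domain A0 \<inter> Domain AT)"
proof -
  interpret Metric_space "Domain A0" "graph_dist A0" by (rule Metric_space_graph)
  have "closed {\<eta>. (0, \<eta>) \<in> \<Theta>}"
    unfolding image_of_zero by (intro closed_INT ballI closed_halfspace_le)
  hence "closedin (graph_topology A0) {u \<in> topspace (graph_topology A0). \<tau> u \<in> {\<eta>. (0, \<eta>) \<in> \<Theta>}}"
    by (intro closedin_continuous_map_preimage[OF tau_continuous]) simp
  thus ?thesis unfolding A0_inter_AT graph_topology_def by simp
qed

end

theorem mainTheorem3:
  fixes S A0 AT :: "('a::{real_inner, complete_space} \<times> 'a) set"
    and \<tau> :: "'a \<Rightarrow> 'b::{real_inner, complete_space}"
    and G :: "'b \<Rightarrow> 'a"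
    and N :: "'a set"
    and \<omega> lam :: real
    and \<Theta> :: "('b \<times> 'b) set"
  assumes S_symmetric: "symmetric_operator S"
    and S_dense: "densely_defined S"
    and S_bounded_below: "bounded_below S (- \<omega>)"
    and S_not_esa: "\<not> essentially_selfadjoint S"
    and A0: "A0 = friedrichs_extension S"
    and tau_linear: "linear_map_on (Domain A0) \<tau>"
    and tau_continuous: "continuous_map (graph_topology A0) euclidean \<tau>"
    and tau_surj: "\<tau> ` Domain A0 = UNIV"
    and N: "N = {u \<in> Domain A0. \<tau> u = 0}"
    and S_domain: "Domain S = N"
    and N_dense: "closure N = UNIV"
    and lam: "lam > \<omega>"
    and G: "G = G_map A0 \<tau> lam"
    and Theta: "maximal_monotone_relation \<Theta>"
    and AT: "AT = extension_operator A0 \<tau> lam \<Theta>"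
  shows
   "maximal_monotone_operator_of_type lam AT \<and>
    (op_adjoint S = {(u\<^sub>0 + G \<xi>, op_app A0 u\<^sub>0 - lam *\<^sub>R G \<xi>) | u\<^sub>0 \<xi>. u\<^sub>0 \<in> Domain A0} \<and>
     AT \<subseteq> op_adjoint S) \<and>
    ((S \<subseteq> AT \<longleftrightarrow> N \<subseteq> Domain AT) \<and>
     (N \<subseteq> Domain AT \<longleftrightarrow> (0, 0) \<in> \<Theta>) \<and>
     ((0, 0) \<in> \<Theta> \<longrightarrow> closure (Domain AT) = UNIV)) \<and>
    ((0, 0) \<in> \<Theta> \<longrightarrow> (\<exists>T. nonlinear_semigroup lam T \<and> semigroup_generator T = AT)) \<and>
    (Domain A0 \<inter> Domain AT = {u \<in> Domain A0. (0, \<tau> u) \<in> \<Theta>} \<and>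
     (Domain A0 \<inter> Domain AT \<noteq> {} \<longleftrightarrow> 0 \<in> Domain \<Theta>)) \<and>
    (\<forall>u \<in> Domain A0 \<inter> Domain AT. op_app AT u = op_app A0 u) \<and>
    (convex (Domain A0 \<inter> Domain AT) \<and>
     closedin (graph_topology A0) (Domain A0 \<inter> Domain AT))"
proof -
  interpret B: maximal_monotone_boundary S \<omega> lam \<tau> \<Theta>
    by unfold_locales
      (use S_symmetric S_dense S_bounded_below lam tau_linear tau_continuous tau_surj N S_domain Theta
        in \<open>simp_all add: A0\<close>)
  have G': "G = B.G" unfolding G A0 by (rule B.G_map_eq)
  show ?thesis
    unfolding G' AT A0 S_domain[symmetric]
    using B.maximal_monotone_operator_AT B.op_adjoint_S B.AT_subset_adjoint B.S_subset_iff
      B.Domain_S_subset_iff B.dense_AT B.AT_generates B.A0_inter_AT B.A0_inter_AT_nonempty_iff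
      B.AT_eq_on_A0 B.convex_A0_inter_AT B.closedin_A0_inter_AT
    by (intro conjI ballI impI) simp_all
qed

end
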